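(* Let $S$ be a countably infinite set, let $k\ge 1$ and let $K$ be a standard Borel space. For every exchangeable random $k$-uniform $K$-coloured hypergraph $\mu$ on $S$ (that is, every Borel probability measure on $K^{\binom{S}{k}}$ invariant under the vertex-permuting action of $\mathrm{Sym}_0(S)$) there is a sequence of ingredients $$(Z_0,\mu_0),\ (Z_1,P_1),\ \ldots,\ (Z_{k-1},P_{k-1}),\ (K,P_k)$$ which yields $\mu$ upon following the standard recipe.
   Context: $\binom{S}{i}$ is the set of $i$-element subsets of $S$. $\mathrm{Sym}_0(S)$ is the group of finitely-supported permutations of $S$; it acts on $K^{\binom{S}{k}}$ by $\tau^g((\omega_e)_e)=(\omega_{g(e)})_e$, where $g(e)=\{g(s):s\in e\}$. $\mu$ is exchangeable if $(\tau^g)_\#\mu=\mu$ for all $g\in\mathrm{Sym}_0(S)$. A probability kernel $P:Y\rightsquigarrow X$ between standard Borel spaces is a map $(y,A)\mapsto P(y,A)$ that is measurable in $y\in Y$ for each measurable $A\subseteq X$ and a probability measure on $X$ in $A$ for each $y$. A sequence of ingredients consists of standard Borel spaces $Z_0,Z_1,\ldots,Z_{k-1}$, a probability measure $\mu_0$ on $Z_0$ and, setting $Z_k:=K$, for each $i=1,\ldots,k$ a probability kernel $$P_i: Z_0\times Z_1^{i}\times Z_2^{\binom{i}{2}}\times\cdots\times Z_{i-1}^{\binom{i}{i-1}}\rightsquigarrow Z_i$$ (the factor $Z_j^{\binom{i}{j}}$ being indexed by the $j$-subsets of $[i]=\{1,\ldots,i\}$) that is symmetric (invariant) under the natural coordinate-permuting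 action of $\mathrm{Sym}([i])$ on the domain. By this symmetry, for any $i$-element set $u$ the measure $P_i(z_\emptyset,(z_s)_{s\in u},\ldots,(z_v)_{v\in\binom{u}{i-1}},\cdot)$ is well defined using any enumeration of $u$. The standard recipe for picking a random member $(\omega_e)_{e\in\binom{S}{k}}$ of $K^{\binom{S}{k}}$ is: choose $z_\emptyset\in Z_0$ with law $\mu_0$; then successively for $i=1,2,\ldots,k-1$, conditionally on all previous choices, choose for each $u\in\binom{S}{i}$ a point $z_u\in Z_i$, independently for different $u$, with law $P_i(z_\emptyset,(z_s)_{s\in u},\ldots,(z_v)_{v\in\binom{u}{i-1}},\cdot)$; finally, conditionally on all previous choices, choose for each $e\in\binom{S}{k}$ a colour $\omega_e\in K$, independently for different $e$, with law $P_k(z_\emptyset,(z_s)_{s\in e},\ldots,(z_u)_{u\in\binom{e}{k-1}},\cdot)$. The ingredients yield $\mu$ if $\mu$ is the law of $(\omega_e)_{e\in\binom{S}{k}}$. *)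

theory Defs
  imports
    "HOL-Probability.Probability"
    "HOL-Library.Ramsey"
    "HOL-Combinatorics.Permutations"
begin

text \<open>Throughout, \<open>nsets S i\<close> is the set of \<open>i\<close>-element subsets of \<open>S\<close>. A measurable space is
  represented by a measure of which only \<open>space\<close> and \<open>sets\<close> matter.\<close>

definition standard_borel :: "'a measure \<Rightarrow> bool" where
  "standard_borel M \<longleftrightarrow>
    (\<exists>X. completely_metrizable_space X \<and> separable_space X \<and>
      topspace X = space M \<and> sets M = sigma_sets (topspace X) {U. openin X U})"

definition Sym0 :: "'s set \<Rightarrow> ('s \<Rightarrow> 's) set" where
  "Sym0 S = {g. g permutes S \<and> finite {s. g s \<noteq> s}}"

definition hypergraph_space :: "'s set \<Rightarrow> nat \<Rightarrow> 'c measure \<Rightarrow> ('s set \<Rightarrow> 'c) measure" where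
  "hypergraph_space S k K = (\<Pi>\<^sub>M e\<in>nsets S k. K)"

definition vertex_action ::
    "'s set \<Rightarrow> nat \<Rightarrow> ('s \<Rightarrow> 's) \<Rightarrow> ('s set \<Rightarrow> 'c) \<Rightarrow> ('s set \<Rightarrow> 'c)" where
  "vertex_action S k g \<omega> = (\<lambda>e\<in>nsets S k. \<omega> (g ` e))"

text \<open>For countable \<open>S\<close> and standard Borel \<open>K\<close>, the product sigma-algebra of \<open>hypergraph_space S k K\<close>
  is the Borel sigma-algebra of the product topology.\<close>

definition exchangeable_hypergraph ::
    "'s set \<Rightarrow> nat \<Rightarrow> 'c measure \<Rightarrow> ('s set \<Rightarrow> 'c) measure \<Rightarrow> bool" where
  "exchangeable_hypergraph S k K \<mu> \<longleftrightarrow>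
    \<mu> \<in> space (prob_algebra (hypergraph_space S k K)) \<and>
    (\<forall>g\<in>Sym0 S. distr \<mu> (hypergraph_space S k K) (vertex_action S k g) = \<mu>)"

text \<open>The domain of the \<open>i\<close>-th kernel, \<open>Z\<^sub>0 \<times> Z\<^sub>1\<^sup>i \<times> \<dots>\<close>, as one product over all proper subsets of
  \<open>{1..i}\<close>: a subset of size \<open>j\<close> carries a copy of \<open>Z j\<close>, and \<open>Z 0\<close> sits at the empty set.\<close>

definition kernel_dom :: "(nat \<Rightarrow> 'z measure) \<Rightarrow> nat \<Rightarrow> (nat set \<Rightarrow> 'z) measure" where
  "kernel_dom Z i = (\<Pi>\<^sub>M a\<in>{a. a \<subset> {1..i}}. Z (card a))"

definition symmetric_kernel ::
    "(nat \<Rightarrow> 'z measure) \<Rightarrow> nat \<Rightarrow> 'x measure \<Rightarrow> ((nat set \<Rightarrow> 'z) \<Rightarrow> 'x measure) \<Rightarrow> bool" where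
  "symmetric_kernel Z i X P \<longleftrightarrow>
    P \<in> kernel_dom Z i \<rightarrow>\<^sub>M prob_algebra X \<and>
    (\<forall>\<sigma>. \<sigma> permutes {1..i} \<longrightarrow>
      (\<forall>x\<in>space (kernel_dom Z i). P (\<lambda>a\<in>{a. a \<subset> {1..i}}. x (\<sigma> ` a)) = P x))"

text \<open>The last kernel \<open>Q\<close>, whose target is \<open>Z\<^sub>k = K\<close>, is kept apart from the \<open>P i\<close> with
  \<open>1 \<le> i < k\<close> because its values are measures on a different type. Only \<open>Z i\<close> with \<open>i < k\<close> and
  \<open>P i\<close> with \<open>1 \<le> i < k\<close> are relevant. Since HOL cannot quantify existentially over types, existence
  statements have to fix \<open>'z\<close>; taking \<open>'z = real\<close> loses no generality, because every standard Borel
  space is Borel isomorphic to one carried by a set of reals.\<close>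

definition ingredients ::
    "nat \<Rightarrow> 'c measure \<Rightarrow> (nat \<Rightarrow> 'z measure) \<Rightarrow> 'z measure \<Rightarrow>
      (nat \<Rightarrow> (nat set \<Rightarrow> 'z) \<Rightarrow> 'z measure) \<Rightarrow> ((nat set \<Rightarrow> 'z) \<Rightarrow> 'c measure) \<Rightarrow> bool" where
  "ingredients k K Z \<mu>0 P Q \<longleftrightarrow>
    (\<forall>i<k. standard_borel (Z i)) \<and>
    \<mu>0 \<in> space (prob_algebra (Z 0)) \<and>
    (\<forall>i\<in>{1..<k}. symmetric_kernel Z i (Z i) (P i)) \<and>
    symmetric_kernel Z k K Q"

text \<open>\<open>pullback f u z\<close> transports the coordinates of \<open>z\<close> at the proper subsets of \<open>u\<close> to the proper
  subsets of \<open>{1..card u}\<close> along an enumeration \<open>f\<close> of \<open>u\<close>. The choice of enumeration in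
  \<open>kernel_at\<close> is immaterial for a symmetric kernel; see \<open>kernel_at_eq\<close>.\<close>

definition pullback :: "(nat \<Rightarrow> 's) \<Rightarrow> 's set \<Rightarrow> ('s set \<Rightarrow> 'z) \<Rightarrow> (nat set \<Rightarrow> 'z)" where
  "pullback f u z = (\<lambda>a\<in>{a. a \<subset> {1..card u}}. z (f ` a))"

definition kernel_at ::
    "((nat set \<Rightarrow> 'z) \<Rightarrow> 'x measure) \<Rightarrow> 's set \<Rightarrow> ('s set \<Rightarrow> 'z) \<Rightarrow> 'x measure" where
  "kernel_at P u z = P (pullback (SOME f. bij_betw f {1..card u} u) u z)"

definition subsets_upto :: "'s set \<Rightarrow> nat \<Rightarrow> 's set set" where
  "subsets_upto S i = (\<Union>j\<le>i. nsets S j)"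

definition levels_space :: "'s set \<Rightarrow> (nat \<Rightarrow> 'z measure) \<Rightarrow> nat \<Rightarrow> ('s set \<Rightarrow> 'z) measure" where
  "levels_space S Z i = (\<Pi>\<^sub>M u\<in>subsets_upto S i. Z (card u))"

text \<open>\<open>levels_law S Z \<mu>0 P i\<close> is the joint law of all \<open>z\<^sub>u\<close> with \<open>card u \<le> i\<close> in the standard recipe.
  The inner product measure expresses that, given the previous choices, the \<open>z\<^sub>u\<close> with
  \<open>card u = Suc i\<close> are chosen independently.\<close>

primrec levels_law ::
    "'s set \<Rightarrow> (nat \<Rightarrow> 'z measure) \<Rightarrow> 'z measure \<Rightarrow>
      (nat \<Rightarrow> (nat set \<Rightarrow> 'z) \<Rightarrow> 'z measure) \<Rightarrow> nat \<Rightarrow> ('s set \<Rightarrow> 'z) measure" where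
  "levels_law S Z \<mu>0 P 0 =
    distr \<mu>0 (levels_space S Z 0) (\<lambda>x. \<lambda>u\<in>{{}}. x)"
| "levels_law S Z \<mu>0 P (Suc i) =
    levels_law S Z \<mu>0 P i \<bind>
      (\<lambda>z. distr (\<Pi>\<^sub>M u\<in>nsets S (Suc i). kernel_at (P (Suc i)) u z) (levels_space S Z (Suc i))
        (\<lambda>y. merge (subsets_upto S i) (nsets S (Suc i)) (z, y)))"

definition recipe_law ::
    "'s set \<Rightarrow> nat \<Rightarrow> (nat \<Rightarrow> 'z measure) \<Rightarrow> 'z measure \<Rightarrow>
      (nat \<Rightarrow> (nat set \<Rightarrow> 'z) \<Rightarrow> 'z measure) \<Rightarrow> ((nat set \<Rightarrow> 'z) \<Rightarrow> 'c measure) \<Rightarrow>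
      ('s set \<Rightarrow> 'c) measure" where
  "recipe_law S k Z \<mu>0 P Q =
    levels_law S Z \<mu>0 P (k - 1) \<bind> (\<lambda>z. \<Pi>\<^sub>M e\<in>nsets S k. kernel_at Q e z)"

lemma kernel_at_eq:
  assumes P: "symmetric_kernel Z i X P"
    and u: "u \<in> nsets S i" and z: "\<And>v. v \<subset> u \<Longrightarrow> z v \<in> space (Z (card v))"
    and f: "bij_betw f {1..i} u"
  shows "kernel_at P u z = P (pullback f u z)"
proof -
  have cu: "card u = i" using u by (simp add: nsets_def)
  define h where "h = (SOME f. bij_betw f {1..card u} u)"
  have h: "bij_betw h {1..i} u"
    unfolding h_def cu using f by (rule someI[where P = "\<lambda>f. bij_betw f {1..i} u"])
  define \<sigma> where "\<sigma> = (\<lambda>x. if x \<in> {1..i} then the_inv_into {1..i} f (h x) else x)"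
  have "bij_betw (the_inv_into {1..i} f \<circ> h) {1..i} {1..i}"
    using h bij_betw_the_inv_into[OF f] by (rule bij_betw_trans)
  moreover have "bij_betw \<sigma> {1..i} {1..i} =
      bij_betw (the_inv_into {1..i} f \<circ> h) {1..i} {1..i}"
    by (rule bij_betw_cong) (simp add: \<sigma>_def)
  ultimately have "bij_betw \<sigma> {1..i} {1..i}" by blast
  then have \<sigma>: "\<sigma> permutes {1..i}"
    by (rule bij_imp_permutes) (auto simp: \<sigma>_def)
  have f\<sigma>: "f (\<sigma> x) = h x" if "x \<in> {1..i}" for x
    using that f_the_inv_into_f_bij_betw[OF f, of "h x"] bij_betwE[OF h]
    by (simp add: \<sigma>_def)
  have *: "pullback h u z = (\<lambda>a\<in>{a. a \<subset> {1..i}}. pullback f u z (\<sigma> ` a))"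
  proof
    fix a
    show "pullback h u z a = (\<lambda>a\<in>{a. a \<subset> {1..i}}. pullback f u z (\<sigma> ` a)) a"
    proof (cases "a \<subset> {1..i}")
      case True
      have "\<sigma> ` a \<subset> \<sigma> ` {1..i}"
        using image_strict_mono[OF permutes_inj_on[OF \<sigma>] True] .
      then have "\<sigma> ` a \<subset> {1..i}" using permutes_image[OF \<sigma>] by simp
      moreover have "f ` \<sigma> ` a = h ` a"
        using True f\<sigma> by (force simp: image_image intro!: image_cong)
      ultimately show ?thesis using True by (simp add: pullback_def cu)
    qed (simp add: pullback_def cu)
  qed
  have "pullback f u z \<in> space (kernel_dom Z i)"
    unfolding kernel_dom_def space_PiM pullback_def cu
  proof (rule restrict_PiE_iff[THEN iffD2], intro ballI)
    fix a assume "a \<in> {a. a \<subset> {1..i}}"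
    then have a: "a \<subset> {1..i}" by simp
    have inj: "inj_on f {1..i}" and im: "f ` {1..i} = u" using f by (auto simp: bij_betw_def)
    have "f ` a \<subset> u" using image_strict_mono[OF inj a] im by simp
    moreover have "card (f ` a) = card a"
      using a inj by (meson card_image inj_on_subset psubset_imp_subset)
    ultimately show "z (f ` a) \<in> space (Z (card a))" using z[of "f ` a"] by simp
  qed
  then show ?thesis
    using P \<sigma> * unfolding symmetric_kernel_def kernel_at_def h_def by metis
qed

end

theory Submission
  imports Defs
begin

text \<open>The ingredients are read off from the hypergraph itself, by keeping an infinite set of vertices
  in reserve. Choose an injection \<open>a\<close> of \<open>S\<close> into \<open>S\<close> such that \<open>T = S - a ` S\<close> is infinite, and
  for a finite set \<open>u\<close> of at most \<open>k\<close> vertices let \<open>X u\<close> be a real code of the whole family of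
  colours \<open>\<omega> (a ` u \<union> w)\<close>, where \<open>w\<close> ranges over the subsets of \<open>T\<close> with \<open>k - card u\<close> elements.
  All the \<open>Z i\<close> are the real line, \<open>\<mu>0\<close> is the law of \<open>X {}\<close>, and the \<open>i\<close>-th kernel is the
  conditional law of \<open>X u\<close>, \<open>card u = i\<close>, given the \<open>X v\<close> with \<open>v \<subset> u\<close>. For \<open>card u = k\<close> the code
  \<open>X u\<close> amounts to the single colour \<open>\<omega> (a ` u)\<close>, and by exchangeability the array of these
  colours again has law \<open>\<mu>\<close>. Hence it suffices that the recipe with these kernels reproduces the
  joint law of all the \<open>X u\<close>.

  The heart of the matter is the conditional independence \<open>cond_law_other_coordinates\<close>: given
  \<^emph>\<open>all\<close> the other \<open>X v\<close> with \<open>card v \<le> i\<close>, the law of \<open>X u\<close> depends only on the \<open>X v\<close> with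
  \<open>v \<subset> u\<close>. Consider an event about \<open>X u\<close> that involves only finitely many colours, hence only a
  finite part \<open>T0\<close> of the reserve. There is an injection \<open>p\<close> of \<open>S\<close> that fixes \<open>a ` u \<union> T0\<close> and
  moves every other vertex into the reserve. It preserves \<open>\<mu>\<close> and the event, but an \<open>X v\<close> with
  \<open>v \<noteq> u\<close> turns into a function of \<open>X (v \<inter> u)\<close>, and \<open>v \<inter> u\<close> is a proper subset of \<open>u\<close>. So the
  event can be predicted from the proper subsets of \<open>u\<close> as well, in mean square, as from all other
  sets together; as a projection in \<open>L\<^sup>2\<close> that keeps the norm does not change the vector, the two
  conditional probabilities agree (\<open>cond_prob_fun_transfer\<close>).

  Around this core there are four auxiliary constructions. Standard Borel spaces, and sequences of
  reals, are coded by reals with a measurable decoding (\<open>standard_borel_real_coding\<close>), which gives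
  regular conditional distributions (\<open>cond_law_exists\<close>). The conditional law is made exactly
  symmetric by averaging over the permutations of \<open>{1..i}\<close>; it remains a version of the
  conditional law since by exchangeability the joint law does not depend on \<open>u\<close> or its enumeration
  (\<open>symmetric_conditional_kernel\<close>). Resampling the nodes of one level one at a time then yields
  the product formula \<open>joint_law_of_level\<close>, which says that, given the lower levels, the nodes of
  a level are independent with laws given by the kernel; induction on the level finishes the
  proof.\<close>

section \<open>Coding standard Borel spaces by real numbers\<close>

text \<open>The digits \<open>0\<close> and \<open>1\<close> in base \<open>4\<close> leave gaps, so that the expansion is unique; the parity of an
  integer part recovers a digit.\<close>

definition cantor_code :: "(nat \<Rightarrow> bool) \<Rightarrow> real" where
  "cantor_code b = (\<Sum>i. of_bool (b i) / 4 ^ Suc i)"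

definition cantor_digit :: "real \<Rightarrow> nat \<Rightarrow> bool" where
  "cantor_digit t i \<longleftrightarrow> odd \<lfloor>4 ^ Suc i * t\<rfloor>"

lemma cantor_code_summable: "summable (\<lambda>i. of_bool (b i) / (4::real) ^ (Suc i))"
proof (rule summable_comparison_test)
  show "\<exists>N. \<forall>n\<ge>N. norm (of_bool (b n) / (4::real) ^ (Suc n)) \<le> (1/4) ^ n"
    by (intro exI[of _ 0]) (auto simp: power_divide of_bool_def field_simps)
  show "summable (\<lambda>n. (1/4::real) ^ n)" by (rule summable_geometric) simp
qed

lemma cantor_digit_code: "cantor_digit (cantor_code b) i = b i"
proof -
  let ?f = "\<lambda>i. of_bool (b i) / (4::real) ^ (Suc i)"
  have f0: "0 \<le> ?f j" for j by simp
  define tail where "tail = (\<Sum>j. ?f (j + Suc i))"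
  have sm: "summable (\<lambda>j. ?f (j + Suc i))"
    using cantor_code_summable[of b] by (rule summable_ignore_initial_segment)
  \<comment> \<open>All later digits together contribute less than one unit of the digit in position \<open>i\<close>.\<close>
  have geo: "(\<lambda>j. (1/4::real) ^ Suc (Suc i) * (1/4) ^ j) sums ((1/4) ^ Suc (Suc i) * (1 / (1 - 1/4)))"
    by (intro sums_mult geometric_sums) simp
  have "tail \<le> (\<Sum>j. (1/4::real) ^ Suc (Suc i) * (1/4) ^ j)"
    unfolding tail_def
  proof (rule suminf_le[OF _ sm])
    show "summable (\<lambda>j. (1/4::real) ^ Suc (Suc i) * (1/4) ^ j)" using geo by (rule sums_summable)
    show "?f (j + Suc i) \<le> (1/4::real) ^ Suc (Suc i) * (1/4) ^ j" for j
      by (auto simp: of_bool_def power_add power_divide mult_ac)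
  qed
  also have "\<dots> = (1/4) ^ Suc (Suc i) * (1 / (1 - 1/4))" using geo by (rule sums_unique[symmetric])
  finally have "4 ^ Suc i * tail \<le> 4 ^ Suc i * ((1/4) ^ Suc (Suc i) * (1 / (1 - 1/4)))" by (rule mult_left_mono) simp
  then have t1: "4 ^ Suc i * tail < 1" by (simp add: power_divide field_simps)
  have t0: "0 \<le> 4 ^ Suc i * tail" unfolding tail_def using sm by (intro mult_nonneg_nonneg suminf_nonneg) auto
  have "cantor_code b = tail + (\<Sum>j<Suc i. ?f j)"
    unfolding cantor_code_def tail_def by (rule suminf_split_initial_segment[OF cantor_code_summable])
  then have "4 ^ Suc i * cantor_code b = 4 ^ Suc i * tail + (\<Sum>j<Suc i. 4 ^ Suc i * ?f j)"
    by (simp add: distrib_left sum_distrib_left)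
  also have "(\<Sum>j<Suc i. 4 ^ Suc i * ?f j) = (\<Sum>j<Suc i. real_of_int (of_bool (b j) * 4 ^ (i - j)))"
  proof (intro sum.cong refl)
    fix j assume "j \<in> {..<Suc i}"
    then have "(4::real) ^ Suc i = 4 ^ (i - j) * 4 ^ Suc j" by (simp flip: power_add)
    then show "4 ^ Suc i * ?f j = real_of_int (of_bool (b j) * 4 ^ (i - j))" by simp
  qed
  also have "\<dots> = real_of_int (4 * (\<Sum>j<i. of_bool (b j) * 4 ^ (i - j - 1)) + of_bool (b i))"
  proof -
    have "(\<Sum>j<i. of_bool (b j) * (4::int) ^ (i - j)) = 4 * (\<Sum>j<i. of_bool (b j) * 4 ^ (i - j - 1))"
      unfolding sum_distrib_left
    proof (intro sum.cong refl)
      fix j assume "j \<in> {..<i}"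
      then have "i - j = Suc (i - j - 1)" by auto
      then show "of_bool (b j) * (4::int) ^ (i - j) = 4 * (of_bool (b j) * 4 ^ (i - j - 1))"
        by (metis mult.left_commute power_Suc)
    qed
    then show ?thesis unfolding of_int_sum[symmetric] by simp
  qed
  finally have "4 ^ Suc i * cantor_code b = real_of_int (4 * (\<Sum>j<i. of_bool (b j) * 4 ^ (i - j - 1)) + of_bool (b i)) + 4 ^ Suc i * tail"
    by simp
  then have "\<lfloor>4 ^ Suc i * cantor_code b\<rfloor> = 4 * (\<Sum>j<i. of_bool (b j) * 4 ^ (i - j - 1)) + of_bool (b i)"
    using t0 t1 by (intro floor_eq2) auto
  then show ?thesis unfolding cantor_digit_def by simp
qed

lemma measurable_cantor_code:
  assumes [measurable]: "\<And>i. Measurable.pred M (\<lambda>x. b x i)"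
  shows "(\<lambda>x. cantor_code (b x)) \<in> borel_measurable M"
  unfolding cantor_code_def of_bool_def by measurable

lemma measurable_cantor_digit: "Measurable.pred borel (\<lambda>t. cantor_digit t i)"
  unfolding cantor_digit_def by measurable

text \<open>A left inverse of \<open>\<phi>\<close> is enough to transport laws to the real line and back, whatever the image
  of \<open>\<phi>\<close>.\<close>

definition real_coding :: "'a measure \<Rightarrow> ('a \<Rightarrow> real) \<Rightarrow> (real \<Rightarrow> 'a) \<Rightarrow> bool" where
  "real_coding M \<phi> r \<longleftrightarrow> \<phi> \<in> borel_measurable M \<and> r \<in> borel \<rightarrow>\<^sub>M M \<and> (\<forall>x\<in>space M. r (\<phi> x) = x)"

text \<open>A point \<open>x\<close> is coded by recording, for a dense sequence \<open>c\<close>, which of the inequalities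
  \<open>d x (c n) < (1/2)^m\<close> hold. To decode, take for each \<open>m\<close> the first admissible \<open>c n\<close>; for the
  code of a point these form a Cauchy sequence converging to it. The decoding sends codes without
  such a Cauchy sequence to a fixed point.\<close>

lemma standard_borel_real_coding:
  assumes "standard_borel M" "space M \<noteq> {}"
  shows "\<exists>\<phi> r. real_coding M \<phi> r"
proof -
  obtain X where X: "completely_metrizable_space X" "separable_space X" "topspace X = space M"
      "sets M = sigma_sets (topspace X) {U. openin X U}"
    using assms(1) unfolding standard_borel_def by blast
  obtain A d where "Metric_space A d" "Metric_space.mcomplete A d" and XA: "X = Metric_space.mtopology A d"
    using X(1) unfolding completely_metrizable_space_def by blast
  interpret Metric_space A d by fact
  have A: "space M = A" using X(3) by (simp add: XA)
  have openM: "U \<in> sets M" if "openin mtopology U" for U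
    using that unfolding X(4) XA by (intro sigma_sets.Basic) simp
  obtain C where C: "countable C" "C \<subseteq> A" "mtopology closure_of C = A"
    using X(2) unfolding separable_space_def by (auto simp: XA)
  have "C \<noteq> {}" using C(3) assms(2) A by auto
  define c where "c = from_nat_into C"
  have cA: "c n \<in> A" for n using from_nat_into[OF \<open>C \<noteq> {}\<close>] C(2) by (auto simp: c_def)
  have dense: "\<exists>n. d x (c n) < e" if x: "x \<in> A" and e: "e > 0" for x e
  proof -
    have "x \<in> mtopology closure_of C" using that C by simp
    then obtain y where "y \<in> C" "y \<in> mball x e" using e unfolding metric_closure_of by blast
    then show ?thesis using from_nat_into_surj[OF C(1)] by (metis c_def in_mball)
  qed
  define bits where "bits x i = (case prod_decode i of (m, n) \<Rightarrow> d x (c n) < (1/2)^m)" for x i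
  define \<phi> where "\<phi> x = cantor_code (bits x)" for x
  define dig where "dig t m n = cantor_digit t (prod_encode (m, n))" for t m n
  define j where "j t m = (LEAST n. dig t m n)" for t m
  \<comment> \<open>A quantitative Cauchy condition: it makes goodness a countable condition on the code
    and ties the limit to the sequence with an explicit error.\<close>
  define good where "good t \<longleftrightarrow> (\<forall>m m'. d (c (j t m)) (c (j t m')) < (1/2)^m + (1/2)^m')" for t
  define lim where "lim t x \<longleftrightarrow> x \<in> A \<and> (\<forall>m. d (c (j t m)) x \<le> (1/2)^m)" for t x
  obtain x0 where x0: "x0 \<in> A" using assms(2) A by auto
  define r where "r t = (if good t then SOME x. lim t x else x0)" for t
  have p2: "\<exists>m. (1/2::real)^m < e" if "e > 0" for e
    using that by (metis divide_less_eq_1_pos one_less_numeral_iff real_arch_pow_inv semiring_norm(76) zero_less_numeral)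
  have ex_lim: "\<exists>x. lim t x" if "good t" for t
  proof -
    have "MCauchy (\<lambda>m. c (j t m))"
      unfolding MCauchy_def
    proof (intro conjI allI impI)
      show "range (\<lambda>m. c (j t m)) \<subseteq> A" using cA by auto
      fix e :: real assume "e > 0"
      then obtain N where N: "(1/2::real)^N < e/2" using p2[of "e/2"] by auto
      have "d (c (j t n)) (c (j t n')) < e" if "N \<le> n" "N \<le> n'" for n n'
      proof -
        have "d (c (j t n)) (c (j t n')) < (1/2)^n + (1/2)^n'" using \<open>good t\<close> by (simp add: good_def)
        also have "\<dots> \<le> (1/2)^N + (1/2)^N" using that by (intro add_mono power_decreasing) auto
        finally show ?thesis using N by simp
      qed
      then show "\<exists>N. \<forall>n n'. N \<le> n \<longrightarrow> N \<le> n' \<longrightarrow> d (c (j t n)) (c (j t n')) < e" by blast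
    qed
    then obtain x where x: "limitin mtopology (\<lambda>m. c (j t m)) x sequentially"
      using \<open>mcomplete\<close> unfolding mcomplete_def by blast
    then have xA: "x \<in> A" by (simp add: limitin_metric)
    have "d (c (j t m)) x \<le> (1/2)^m" for m
    proof (rule field_le_epsilon)
      fix e :: real assume "e > 0"
      obtain N1 where N1: "(1/2::real)^N1 < e/2" using p2[of "e/2"] \<open>e > 0\<close> by auto
      obtain N2 where N2: "\<And>n. n \<ge> N2 \<Longrightarrow> d (c (j t n)) x < e/2"
        using x \<open>e > 0\<close> unfolding limitin_metric eventually_sequentially by (metis half_gt_zero)
      let ?n = "max N1 N2"
      have "d (c (j t m)) x \<le> d (c (j t m)) (c (j t ?n)) + d (c (j t ?n)) x" using cA xA by (intro triangle)
      also have "\<dots> \<le> ((1/2)^m + (1/2)^?n) + e/2"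
        using \<open>good t\<close> N2[of ?n] unfolding good_def by (intro add_mono) (auto intro: less_imp_le)
      also have "(1/2::real)^?n \<le> (1/2)^N1" by (intro power_decreasing) auto
      finally show "d (c (j t m)) x \<le> (1/2)^m + e" using N1 by simp
    qed
    then show ?thesis using xA unfolding lim_def by blast
  qed
  have lim_r: "lim t (r t)" if "good t" for t
    unfolding r_def using that ex_lim[OF that] by (auto intro: someI_ex)
  have rA: "r t \<in> A" for t using lim_r[of t] x0 by (cases "good t") (auto simp: r_def lim_def)
  have r_bad: "r t = x0" if "\<not> good t" for t using that by (simp add: r_def)
  \<comment> \<open>Membership of the limit in an open set is decided at some finite stage, hence
    measurably.\<close>
  have r_in: "r t \<in> U \<longleftrightarrow> (\<exists>m. mball (c (j t m)) (2 * (1/2)^m) \<subseteq> U)" if t: "good t" and U: "openin mtopology U" for t U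
  proof
    assume "r t \<in> U"
    then obtain e where e: "e > 0" "mball (r t) e \<subseteq> U" using U unfolding openin_mtopology by blast
    obtain m where m: "(1/2::real)^m < e/3" using p2[of "e/3"] e by auto
    have "mball (c (j t m)) (2 * (1/2)^m) \<subseteq> mball (r t) e"
    proof
      fix y assume "y \<in> mball (c (j t m)) (2 * (1/2)^m)"
      then have y: "y \<in> A" "d (c (j t m)) y < 2 * (1/2)^m" by auto
      have "d (r t) y \<le> d (r t) (c (j t m)) + d (c (j t m)) y" using y cA rA by (intro triangle)
      also have "\<dots> < (1/2)^m + 2 * (1/2)^m"
        using lim_r[OF t] y by (intro add_le_less_mono) (auto simp: lim_def commute)
      finally show "y \<in> mball (r t) e" using m y rA by auto
    qed
    then show "\<exists>m. mball (c (j t m)) (2 * (1/2)^m) \<subseteq> U" using e by blast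
  next
    assume "\<exists>m. mball (c (j t m)) (2 * (1/2)^m) \<subseteq> U"
    then obtain m where m: "mball (c (j t m)) (2 * (1/2)^m) \<subseteq> U" by blast
    have "d (c (j t m)) (r t) \<le> (1/2)^m" using lim_r[OF t] by (simp add: lim_def)
    also have "\<dots> < 2 * (1/2)^m" by simp
    finally show "r t \<in> U" using m cA rA by auto
  qed
  have [measurable]: "Measurable.pred borel (\<lambda>t. dig t m n)" for m n
    unfolding dig_def by (rule measurable_cantor_digit)
  have jm[measurable]: "(\<lambda>t. j t m) \<in> borel \<rightarrow>\<^sub>M count_space UNIV" for m
    unfolding j_def by measurable
  have good_m[measurable]: "Measurable.pred borel good"
    unfolding good_def
  proof (intro pred_intros_countable)
    fix m m'
    have "Measurable.pred borel (\<lambda>t. d (c n) (c (j t m')) < (1/2)^m + (1/2)^m')" for n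
      by (rule measurable_compose[OF jm]) simp
    then show "Measurable.pred borel (\<lambda>t. d (c (j t m)) (c (j t m')) < (1/2)^m + (1/2)^m')"
      by (rule measurable_compose_countable[OF _ jm])
  qed
  have r_m: "r \<in> borel \<rightarrow>\<^sub>M M"
  proof (rule measurable_sigma_sets[where \<Omega>="space M" and A="{U. openin X U}"])
    show "sets M = sigma_sets (space M) {U. openin X U}" using X by simp
    show "{U. openin X U} \<subseteq> Pow (space M)" using openin_subset X(3) by force
    show "r \<in> space borel \<rightarrow> space M" using rA A by auto
    fix U assume "U \<in> {U. openin X U}"
    then have U: "openin mtopology U" by (simp add: XA)
    have "r -` U \<inter> space borel = {t. (good t \<and> (\<exists>m. mball (c (j t m)) (2 * (1/2)^m) \<subseteq> U)) \<or> (\<not> good t \<and> x0 \<in> U)}"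
    proof (intro set_eqI)
      fix t show "t \<in> r -` U \<inter> space borel \<longleftrightarrow> t \<in> {t. (good t \<and> (\<exists>m. mball (c (j t m)) (2 * (1/2)^m) \<subseteq> U)) \<or> (\<not> good t \<and> x0 \<in> U)}"
        using r_in[OF _ U, of t] r_bad[of t] by (cases "good t") simp_all
    qed
    also have "\<dots> \<in> sets borel"
    proof -
      have "Measurable.pred borel (\<lambda>t. (\<lambda>n. mball (c n) (2 * (1/2)^m) \<subseteq> U) (j t m))" for m
        by (rule measurable_compose[OF jm]) simp
      then have [measurable]: "Measurable.pred borel (\<lambda>t. mball (c (j t m)) (2 * (1/2)^m) \<subseteq> U)" for m by simp
      have [measurable]: "Measurable.pred borel (\<lambda>t. \<exists>m. mball (c (j t m)) (2 * (1/2)^m) \<subseteq> U)"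
        by (intro pred_intros_countable) measurable
      show ?thesis by measurable
    qed
    finally show "r -` U \<inter> space borel \<in> sets borel" .
  qed
  have \<phi>_m: "\<phi> \<in> borel_measurable M"
    unfolding \<phi>_def
  proof (rule measurable_cantor_code)
    fix i
    obtain m n where i: "prod_decode i = (m, n)" by force
    have "{x\<in>space M. bits x i} = mball (c n) ((1/2)^m)"
      using cA by (auto simp: A bits_def i commute)
    then show "Measurable.pred M (\<lambda>x. bits x i)"
      unfolding pred_def using openM[OF openin_mball] by simp
  qed
  have r\<phi>: "r (\<phi> x) = x" if "x \<in> space M" for x
  proof -
    have xA: "x \<in> A" using that A by simp
    have dig: "dig (\<phi> x) m n \<longleftrightarrow> d x (c n) < (1/2)^m" for m n
      by (simp add: dig_def \<phi>_def cantor_digit_code bits_def)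
    have jx: "d x (c (j (\<phi> x) m)) < (1/2)^m" for m
    proof -
      obtain n where "d x (c n) < (1/2)^m" using dense[OF xA, of "(1/2)^m"] by auto
      then show ?thesis unfolding j_def dig by (rule LeastI)
    qed
    have g: "good (\<phi> x)"
      unfolding good_def
    proof (intro allI)
      fix m m'
      have "d (c (j (\<phi> x) m)) (c (j (\<phi> x) m')) \<le> d (c (j (\<phi> x) m)) x + d x (c (j (\<phi> x) m'))"
        using cA xA by (intro triangle)
      also have "\<dots> < (1/2)^m + (1/2)^m'" using jx by (intro add_strict_mono) (auto simp: commute)
      finally show "d (c (j (\<phi> x) m)) (c (j (\<phi> x) m')) < (1/2)^m + (1/2)^m'" .
    qed
    have "d (r (\<phi> x)) x \<le> 0"
    proof (rule field_le_epsilon)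
      fix e :: real assume "e > 0"
      then obtain m where m: "(1/2::real)^m < e/2" using p2[of "e/2"] by auto
      have "d (r (\<phi> x)) x \<le> d (r (\<phi> x)) (c (j (\<phi> x) m)) + d (c (j (\<phi> x) m)) x"
        using cA xA rA by (intro triangle)
      also have "\<dots> \<le> (1/2)^m + (1/2)^m"
        using lim_r[OF g] jx by (intro add_mono) (auto simp: lim_def commute less_imp_le)
      finally show "d (r (\<phi> x)) x \<le> 0 + e" using m by simp
    qed
    then show ?thesis using rA xA by (metis antisym nonneg zero)
  qed
  show ?thesis unfolding real_coding_def using r_m \<phi>_m r\<phi> by blast
qed

lemma standard_borel_polish: "standard_borel (borel :: 'a::polish_space measure)"
proof -
  obtain B :: "'a set set" where "countable B" "topological_basis B"
    using ex_countable_basis by blast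
  then have "second_countable (euclidean :: 'a topology)"
    unfolding second_countable_def
    by (intro exI[of _ B]) (auto simp: topological_basis_open intro: topological_basisE)
  then have "separable_space (euclidean :: 'a topology)"
    by (rule second_countable_imp_separable_space)
  then show ?thesis
    unfolding standard_borel_def
    by (intro exI[of _ euclidean] conjI completely_metrizable_space_euclidean) (auto simp: borel_def)
qed

lemma sequence_real_coding: "\<exists>\<phi> r. real_coding (borel :: (nat \<Rightarrow> real) measure) \<phi> r"
  by (rule standard_borel_real_coding[OF standard_borel_polish]) simp

lemma sequence_coordinate_measurable: "(\<lambda>s :: nat \<Rightarrow> real. s m) \<in> borel_measurable borel"
  using measurable_component_singleton[of m UNIV "\<lambda>_. borel :: real measure"]
  by (simp add: measurable_cong_sets[OF sets_PiM_equal_borel refl])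

section \<open>Conditional probabilities of a single event\<close>

text \<open>\<open>p \<circ> \<eta>\<close> is a version of the conditional probability of \<open>E\<close> given \<open>\<eta>\<close>. Taking \<open>p\<close> on the target
  space of \<open>\<eta>\<close>, and not a function on \<open>M\<close> measurable with respect to \<open>\<eta>\<close>, makes composition with
  other maps immediate.\<close>

definition cond_prob_fun ::
    "'w measure \<Rightarrow> 'w set \<Rightarrow> ('w \<Rightarrow> 'y) \<Rightarrow> 'y measure \<Rightarrow> ('y \<Rightarrow> real) \<Rightarrow> bool" where
  "cond_prob_fun M E \<eta> N p \<longleftrightarrow>
    p \<in> borel_measurable N \<and> (\<forall>y. 0 \<le> p y \<and> p y \<le> 1) \<and>
    (\<forall>B\<in>sets N. emeasure M (E \<inter> \<eta> -` B \<inter> space M) =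
      (\<integral>\<^sup>+\<omega>. indicator B (\<eta> \<omega>) * ennreal (p (\<eta> \<omega>)) \<partial>M))"

context prob_space
begin

text \<open>The function is a Radon-Nikodym derivative, truncated at \<open>1\<close>.\<close>

lemma cond_prob_fun_exists:
  assumes [measurable]: "E \<in> sets M" "\<eta> \<in> M \<rightarrow>\<^sub>M N"
  shows "\<exists>p. cond_prob_fun M E \<eta> N p"
proof -
  define \<nu> where "\<nu> = distr M N \<eta>"
  define \<nu>E where "\<nu>E = distr (density M (indicator E)) N \<eta>"
  interpret \<nu>: prob_space \<nu> unfolding \<nu>_def by (rule prob_space_distr) simp
  have sets[measurable_cong, simp]: "sets \<nu> = sets N" "sets \<nu>E = sets N"
    by (auto simp: \<nu>_def \<nu>E_def)
  have emE: "emeasure \<nu>E B = emeasure M (E \<inter> \<eta> -` B \<inter> space M)" if [measurable]: "B \<in> sets N" for B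
  proof -
    have "emeasure \<nu>E B = (\<integral>\<^sup>+\<omega>. indicator E \<omega> * indicator (\<eta> -` B \<inter> space M) \<omega> \<partial>M)"
      unfolding \<nu>E_def by (subst emeasure_distr) (auto simp: emeasure_density)
    also have "\<dots> = (\<integral>\<^sup>+\<omega>. indicator (E \<inter> \<eta> -` B \<inter> space M) \<omega> \<partial>M)"
      by (intro nn_integral_cong) (auto split: split_indicator)
    finally show ?thesis by simp
  qed
  have le: "emeasure \<nu>E B \<le> emeasure \<nu> B" if [measurable]: "B \<in> sets N" for B
    unfolding emE[OF that] by (simp add: \<nu>_def emeasure_distr) (intro emeasure_mono, auto)
  have ac: "absolutely_continuous \<nu> \<nu>E"
    unfolding absolutely_continuous_def null_sets_def using le by (auto simp: le_zero_eq) (metis le le_zero_eq)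
  define D where "D = RN_deriv \<nu> \<nu>E"
  have [measurable]: "D \<in> borel_measurable N" unfolding D_def using borel_measurable_RN_deriv[of \<nu>] by (simp cong: measurable_cong_sets)
  have D: "emeasure \<nu>E B = (\<integral>\<^sup>+y. D y * indicator B y \<partial>\<nu>)" if [measurable]: "B \<in> sets N" for B
    using \<nu>.density_RN_deriv[OF ac] unfolding D_def
    by (metis emeasure_density borel_measurable_RN_deriv that sets(1) sets(2))
  define B1 where "B1 = {y\<in>space N. 1 < D y}"
  have [measurable]: "B1 \<in> sets N" unfolding B1_def by measurable
  have "(\<integral>\<^sup>+y. (D y - 1) * indicator B1 y \<partial>\<nu>) + emeasure \<nu> B1
      = (\<integral>\<^sup>+y. (D y - 1) * indicator B1 y + indicator B1 y \<partial>\<nu>)"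
    by (subst nn_integral_add) auto
  also have "\<dots> = (\<integral>\<^sup>+y. D y * indicator B1 y \<partial>\<nu>)"
    by (intro nn_integral_cong) (auto simp: B1_def diff_add_cancel_ennreal less_imp_le split: split_indicator)
  also have "\<dots> = emeasure \<nu>E B1" by (simp add: D)
  also have "\<dots> \<le> 0 + emeasure \<nu> B1" using le by simp
  finally have "(\<integral>\<^sup>+y. (D y - 1) * indicator B1 y \<partial>\<nu>) \<le> 0"
    using \<nu>.emeasure_finite by (simp add: ennreal_add_left_cancel_le add.commute)
  then have "AE y in \<nu>. (D y - 1) * indicator B1 y = 0"
    by (simp add: nn_integral_0_iff_AE)
  moreover have "AE y in \<nu>. y \<in> space N" using AE_space[of \<nu>] by (simp add: \<nu>_def)
  ultimately have D1: "AE y in \<nu>. D y \<le> 1"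
    by eventually_elim (force simp: B1_def diff_eq_0_iff_ennreal split: split_indicator_asm)
  define p where "p y = enn2real (min 1 (D y))" for y
  have [measurable]: "p \<in> borel_measurable N" unfolding p_def by measurable
  have ep: "ennreal (p y) = min 1 (D y)" for y
    unfolding p_def by (rule ennreal_enn2real) (auto simp: min_def less_top[symmetric] top_unique)
  show ?thesis
    unfolding cond_prob_fun_def
  proof (intro exI[of _ p] conjI allI ballI)
    fix y show "0 \<le> p y" by (simp add: p_def)
    show "p y \<le> 1" unfolding p_def using enn2real_mono[of "min 1 (D y)" 1] by simp
  next
    fix B assume [measurable]: "B \<in> sets N"
    have "emeasure M (E \<inter> \<eta> -` B \<inter> space M) = (\<integral>\<^sup>+y. D y * indicator B y \<partial>\<nu>)"
      by (simp add: emE[symmetric] D)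
    also have "\<dots> = (\<integral>\<^sup>+y. indicator B y * ennreal (p y) \<partial>\<nu>)"
      using D1 by (intro nn_integral_cong_AE) (auto elim!: eventually_mono simp: ep min_def mult.commute antisym)
    also have "\<dots> = (\<integral>\<^sup>+\<omega>. indicator B (\<eta> \<omega>) * ennreal (p (\<eta> \<omega>)) \<partial>M)"
      unfolding \<nu>_def by (subst nn_integral_distr) auto
    finally show "emeasure M (E \<inter> \<eta> -` B \<inter> space M) = (\<integral>\<^sup>+\<omega>. indicator B (\<eta> \<omega>) * ennreal (p (\<eta> \<omega>)) \<partial>M)" .
  qed simp
qed

lemma cond_prob_fun_integral:
  assumes p: "cond_prob_fun M E \<eta> N p" and [measurable]: "E \<in> sets M" "\<eta> \<in> M \<rightarrow>\<^sub>M N" "g \<in> borel_measurable N"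
  shows "(\<integral>\<omega>. indicator E \<omega> * g (\<eta> \<omega>) \<partial>M) = (\<integral>\<omega>. p (\<eta> \<omega>) * g (\<eta> \<omega>) \<partial>M)"
proof -
  have [measurable]: "p \<in> borel_measurable N" and p0: "0 \<le> p y" for y
    using p by (auto simp: cond_prob_fun_def)
  define M1 where "M1 = density M (\<lambda>\<omega>. ennreal (indicator E \<omega>))"
  define M2 where "M2 = density M (\<lambda>\<omega>. ennreal (p (\<eta> \<omega>)))"
  have [measurable_cong]: "sets M1 = sets M" "sets M2 = sets M" by (auto simp: M1_def M2_def)
  have "distr M1 N \<eta> = distr M2 N \<eta>"
  proof (rule measure_eqI)
    fix B assume "B \<in> sets (distr M1 N \<eta>)"
    then have [measurable]: "B \<in> sets N" by simp
    have "emeasure (distr M1 N \<eta>) B = (\<integral>\<^sup>+\<omega>. indicator (E \<inter> \<eta> -` B \<inter> space M) \<omega> \<partial>M)"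
      unfolding M1_def by (subst emeasure_distr)
        (auto simp: emeasure_density simp del: nn_integral_indicator split: split_indicator intro!: nn_integral_cong)
    also have "\<dots> = emeasure M (E \<inter> \<eta> -` B \<inter> space M)" by simp
    also have "\<dots> = (\<integral>\<^sup>+\<omega>. indicator B (\<eta> \<omega>) * ennreal (p (\<eta> \<omega>)) \<partial>M)"
      using p by (simp add: cond_prob_fun_def)
    also have "\<dots> = emeasure (distr M2 N \<eta>) B"
      unfolding M2_def by (subst emeasure_distr) (auto simp: emeasure_density split: split_indicator intro!: nn_integral_cong)
    finally show "emeasure (distr M1 N \<eta>) B = emeasure (distr M2 N \<eta>) B" .
  qed simp
  then have "(\<integral>y. g y \<partial>distr M1 N \<eta>) = (\<integral>y. g y \<partial>distr M2 N \<eta>)" by simp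
  then have "(\<integral>\<omega>. g (\<eta> \<omega>) \<partial>M1) = (\<integral>\<omega>. g (\<eta> \<omega>) \<partial>M2)"
    by (simp add: integral_distr)
  then show ?thesis
    unfolding M1_def M2_def by (simp add: integral_real_density p0)
qed

text \<open>The information in \<open>\<eta>\<close> is contained in that in \<open>\<zeta>\<close>, but the measure-preserving map \<open>T\<close>, which
  leaves \<open>E\<close> invariant, carries \<open>\<zeta>\<close> to a function of \<open>\<eta>\<close>. Let \<open>a\<close> and \<open>b\<close> be the conditional
  probabilities of \<open>E\<close> given \<open>\<zeta>\<close> and given \<open>\<eta>\<close>, and let \<open>c = a \<circ> T\<close>, a function of \<open>\<eta>\<close>. Then \<open>b\<close>
  is the projection of \<open>a\<close>, so its norm is at most that of \<open>a\<close>. Conversely \<open>c\<close> has the norm of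
  \<open>a\<close>, and its inner product with \<open>b\<close>, being its inner product with the indicator of \<open>E\<close>, is the
  square of that norm; expanding the norm of \<open>b - c\<close> shows that the norm of \<open>b\<close> is at least that
  of \<open>a\<close>. Hence \<open>a = b\<close> almost surely.\<close>

lemma cond_prob_fun_transfer:
  assumes p: "cond_prob_fun M E \<eta> N p"
    and [measurable]: "E \<in> sets M" "\<eta> \<in> M \<rightarrow>\<^sub>M N" "\<zeta> \<in> M \<rightarrow>\<^sub>M N'" "h \<in> N' \<rightarrow>\<^sub>M N" "g \<in> N \<rightarrow>\<^sub>M N'" "T \<in> M \<rightarrow>\<^sub>M M"
    and T: "distr M M T = M"
    and TE: "\<And>\<omega>. \<omega> \<in> space M \<Longrightarrow> T \<omega> \<in> E \<longleftrightarrow> \<omega> \<in> E"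
    and h: "\<And>\<omega>. \<omega> \<in> space M \<Longrightarrow> \<eta> \<omega> = h (\<zeta> \<omega>)"
    and g: "\<And>\<omega>. \<omega> \<in> space M \<Longrightarrow> \<zeta> (T \<omega>) = g (\<eta> \<omega>)"
  shows "cond_prob_fun M E \<zeta> N' (\<lambda>z. p (h z))"
proof -
  have [measurable]: "p \<in> borel_measurable N" and p01: "0 \<le> p y" "p y \<le> 1" for y
    using p by (auto simp: cond_prob_fun_def)
  obtain \<alpha> where \<alpha>: "cond_prob_fun M E \<zeta> N' \<alpha>"
    using cond_prob_fun_exists[of E \<zeta> N'] by auto
  then have [measurable]: "\<alpha> \<in> borel_measurable N'" and \<alpha>01: "0 \<le> \<alpha> y" "\<alpha> y \<le> 1" for y
    by (auto simp: cond_prob_fun_def)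
  define a where "a \<omega> = \<alpha> (\<zeta> \<omega>)" for \<omega>
  define b where "b \<omega> = p (\<eta> \<omega>)" for \<omega>
  define c where "c \<omega> = \<alpha> (g (\<eta> \<omega>))" for \<omega>
  have [measurable]: "a \<in> borel_measurable M" "b \<in> borel_measurable M" "c \<in> borel_measurable M"
    unfolding a_def b_def c_def by measurable
  have bd: "\<bar>a \<omega>\<bar> \<le> 1" "\<bar>b \<omega>\<bar> \<le> 1" "\<bar>c \<omega>\<bar> \<le> 1" for \<omega>
    using \<alpha>01 p01 by (simp_all add: a_def b_def c_def abs_of_nonneg)
  have I: "integrable M (\<lambda>\<omega>. x \<omega> * y \<omega>)"
    if [measurable]: "x \<in> borel_measurable M" "y \<in> borel_measurable M" and "\<And>\<omega>. \<bar>x \<omega>\<bar> \<le> 1" "\<And>\<omega>. \<bar>y \<omega>\<bar> \<le> 1" for x y :: "_ \<Rightarrow> real"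
  proof (rule integrable_const_bound[where B=1])
    show "AE \<omega> in M. norm (x \<omega> * y \<omega>) \<le> 1"
      using that(3,4) by (auto simp: abs_mult intro!: AE_I2 mult_le_one)
  qed simp
  have invT: "(\<integral>\<omega>. f (T \<omega>) \<partial>M) = (\<integral>\<omega>. f \<omega> \<partial>M)" if [measurable]: "f \<in> borel_measurable M" for f :: "_ \<Rightarrow> real"
  proof -
    have "(\<integral>\<omega>. f \<omega> \<partial>M) = (\<integral>\<omega>. f \<omega> \<partial>distr M M T)" by (simp add: T)
    also have "\<dots> = (\<integral>\<omega>. f (T \<omega>) \<partial>M)" by (subst integral_distr) auto
    finally show ?thesis by simp
  qed
  have aT: "a (T \<omega>) = c \<omega>" if "\<omega> \<in> space M" for \<omega>
    using g that by (simp add: a_def c_def)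
  have Ea: "(\<integral>\<omega>. indicator E \<omega> * a \<omega> \<partial>M) = (\<integral>\<omega>. a \<omega> * a \<omega> \<partial>M)"
    using cond_prob_fun_integral[OF \<alpha>, of \<alpha>] by (simp add: a_def)
  have Eb: "(\<integral>\<omega>. indicator E \<omega> * b \<omega> \<partial>M) = (\<integral>\<omega>. b \<omega> * b \<omega> \<partial>M)"
    using cond_prob_fun_integral[OF p, of p] by (simp add: b_def)
  have Ec: "(\<integral>\<omega>. indicator E \<omega> * c \<omega> \<partial>M) = (\<integral>\<omega>. b \<omega> * c \<omega> \<partial>M)"
    using cond_prob_fun_integral[OF p, of "\<lambda>y. \<alpha> (g y)"] by (simp add: b_def c_def)
  have "(\<integral>\<omega>. indicator E \<omega> * b \<omega> \<partial>M) = (\<integral>\<omega>. indicator E \<omega> * p (h (\<zeta> \<omega>)) \<partial>M)"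
    by (intro Bochner_Integration.integral_cong) (auto simp: b_def h)
  also have "\<dots> = (\<integral>\<omega>. \<alpha> (\<zeta> \<omega>) * p (h (\<zeta> \<omega>)) \<partial>M)"
    using cond_prob_fun_integral[OF \<alpha>, of "\<lambda>z. p (h z)"] by simp
  also have "\<dots> = (\<integral>\<omega>. a \<omega> * b \<omega> \<partial>M)"
    by (intro Bochner_Integration.integral_cong) (auto simp: b_def a_def h)
  finally have ab: "(\<integral>\<omega>. a \<omega> * b \<omega> \<partial>M) = (\<integral>\<omega>. b \<omega> * b \<omega> \<partial>M)" using Eb by simp
  have "(\<integral>\<omega>. a \<omega> * a \<omega> \<partial>M) = (\<integral>\<omega>. a (T \<omega>) * a (T \<omega>) \<partial>M)" by (subst invT) auto
  also have "\<dots> = (\<integral>\<omega>. c \<omega> * c \<omega> \<partial>M)"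
    by (intro Bochner_Integration.integral_cong) (auto simp: aT)
  finally have cc: "(\<integral>\<omega>. c \<omega> * c \<omega> \<partial>M) = (\<integral>\<omega>. a \<omega> * a \<omega> \<partial>M)" by simp
  have "(\<integral>\<omega>. indicator E \<omega> * a \<omega> \<partial>M) = (\<integral>\<omega>. indicator E (T \<omega>) * a (T \<omega>) \<partial>M)"
    by (subst invT[of "\<lambda>\<omega>. indicator E \<omega> * a \<omega>"]) auto
  also have "\<dots> = (\<integral>\<omega>. indicator E \<omega> * c \<omega> \<partial>M)"
    by (intro Bochner_Integration.integral_cong) (auto simp: aT TE indicator_def)
  finally have bc: "(\<integral>\<omega>. b \<omega> * c \<omega> \<partial>M) = (\<integral>\<omega>. a \<omega> * a \<omega> \<partial>M)" using Ea Ec by simp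
  have "0 \<le> (\<integral>\<omega>. (b \<omega> - c \<omega>) * (b \<omega> - c \<omega>) \<partial>M)" by simp
  also have "\<dots> = (\<integral>\<omega>. b \<omega> * b \<omega> - 2 * (b \<omega> * c \<omega>) + c \<omega> * c \<omega> \<partial>M)"
    by (simp add: algebra_simps)
  also have "\<dots> = (\<integral>\<omega>. b \<omega> * b \<omega> \<partial>M) - 2 * (\<integral>\<omega>. b \<omega> * c \<omega> \<partial>M) + (\<integral>\<omega>. c \<omega> * c \<omega> \<partial>M)"
    by (simp add: I bd)
  finally have 1: "(\<integral>\<omega>. a \<omega> * a \<omega> \<partial>M) \<le> (\<integral>\<omega>. b \<omega> * b \<omega> \<partial>M)" using bc cc by simp
  have "(\<integral>\<omega>. (a \<omega> - b \<omega>) * (a \<omega> - b \<omega>) \<partial>M) = (\<integral>\<omega>. a \<omega> * a \<omega> - 2 * (a \<omega> * b \<omega>) + b \<omega> * b \<omega> \<partial>M)"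
    by (simp add: algebra_simps)
  also have "\<dots> = (\<integral>\<omega>. a \<omega> * a \<omega> \<partial>M) - 2 * (\<integral>\<omega>. a \<omega> * b \<omega> \<partial>M) + (\<integral>\<omega>. b \<omega> * b \<omega> \<partial>M)"
    by (simp add: I bd)
  finally have "(\<integral>\<omega>. (a \<omega> - b \<omega>) * (a \<omega> - b \<omega>) \<partial>M) \<le> 0" using ab 1 by simp
  then have "(\<integral>\<omega>. (a \<omega> - b \<omega>) * (a \<omega> - b \<omega>) \<partial>M) = 0" by (simp add: antisym)
  moreover have "integrable M (\<lambda>\<omega>. (a \<omega> - b \<omega>) * (a \<omega> - b \<omega>))"
  proof (intro I)
    show "\<bar>a \<omega> - b \<omega>\<bar> \<le> 1" for \<omega>
      using \<alpha>01[of "\<zeta> \<omega>"] p01[of "\<eta> \<omega>"] by (simp add: a_def b_def)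
    then show "\<bar>a \<omega> - b \<omega>\<bar> \<le> 1" for \<omega> .
  qed auto
  ultimately have "AE \<omega> in M. (a \<omega> - b \<omega>) * (a \<omega> - b \<omega>) = 0"
    by (subst (asm) integral_nonneg_eq_0_iff_AE) auto
  then have AE: "AE \<omega> in M. a \<omega> = b \<omega>" by simp
  show ?thesis
    unfolding cond_prob_fun_def
  proof (intro conjI ballI allI)
    fix C assume [measurable]: "C \<in> sets N'"
    have "emeasure M (E \<inter> \<zeta> -` C \<inter> space M) = (\<integral>\<^sup>+\<omega>. indicator C (\<zeta> \<omega>) * ennreal (a \<omega>) \<partial>M)"
      using \<alpha> by (simp add: cond_prob_fun_def a_def)
    also have "\<dots> = (\<integral>\<^sup>+\<omega>. indicator C (\<zeta> \<omega>) * ennreal (p (h (\<zeta> \<omega>))) \<partial>M)"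
      by (rule nn_integral_cong_AE, use AE AE_space in eventually_elim) (simp add: b_def h)
    finally show "emeasure M (E \<inter> \<zeta> -` C \<inter> space M) = (\<integral>\<^sup>+\<omega>. indicator C (\<zeta> \<omega>) * ennreal (p (h (\<zeta> \<omega>))) \<partial>M)" .
  qed (auto simp: p01)
qed

end

section \<open>Regular conditional distributions\<close>

text \<open>\<open>\<kappa> \<circ> \<eta>\<close> is a regular version of the conditional distribution of \<open>Y\<close> given \<open>\<eta>\<close>.\<close>

definition cond_law ::
    "'w measure \<Rightarrow> ('w \<Rightarrow> 'y) \<Rightarrow> 'y measure \<Rightarrow> ('w \<Rightarrow> 'x) \<Rightarrow> 'x measure \<Rightarrow> ('y \<Rightarrow> 'x measure) \<Rightarrow> bool" where
  "cond_law M \<eta> N Y L \<kappa> \<longleftrightarrow> \<kappa> \<in> N \<rightarrow>\<^sub>M prob_algebra L \<and>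
    (\<forall>A\<in>sets L. \<forall>B\<in>sets N. emeasure M (Y -` A \<inter> \<eta> -` B \<inter> space M) =
      (\<integral>\<^sup>+\<omega>. indicator B (\<eta> \<omega>) * emeasure (\<kappa> (\<eta> \<omega>)) A \<partial>M))"

lemma Int_stable_insert_space:
  assumes "Int_stable G" "G \<subseteq> Pow \<Omega>" shows "Int_stable (insert \<Omega> G)"
proof (rule Int_stableI)
  fix a b assume "a \<in> insert \<Omega> G" "b \<in> insert \<Omega> G"
  moreover have "a \<inter> b \<in> G" if "a \<in> G" "b \<in> G" using assms(1) that by (rule Int_stableD)
  moreover have "a \<inter> \<Omega> = a" "\<Omega> \<inter> a = a" if "a \<in> G" for a using assms(2) that by auto
  ultimately show "a \<inter> b \<in> insert \<Omega> G" by auto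
qed

context prob_space
begin

text \<open>For fixed \<open>B\<close> both sides of the defining equation are finite measures in \<open>A\<close>, of the same total
  mass.\<close>

lemma cond_lawI_generator:
  assumes gen: "sets L = sigma_sets (space L) G" "Int_stable G" "G \<subseteq> Pow (space L)"
    and [measurable]: "Y \<in> M \<rightarrow>\<^sub>M L" "\<eta> \<in> M \<rightarrow>\<^sub>M N" "\<kappa> \<in> N \<rightarrow>\<^sub>M prob_algebra L"
    and eq: "\<And>A B. A \<in> G \<Longrightarrow> B \<in> sets N \<Longrightarrow> emeasure M (Y -` A \<inter> \<eta> -` B \<inter> space M) =
      (\<integral>\<^sup>+\<omega>. indicator B (\<eta> \<omega>) * emeasure (\<kappa> (\<eta> \<omega>)) A \<partial>M)"
  shows "cond_law M \<eta> N Y L \<kappa>"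
  unfolding cond_law_def
proof (intro conjI ballI)
  fix A B assume A: "A \<in> sets L" and B[measurable]: "B \<in> sets N"
  define m1 where "m1 = distr (density M (\<lambda>\<omega>. indicator B (\<eta> \<omega>))) L Y"
  define m2 where "m2 = density M (\<lambda>\<omega>. indicator B (\<eta> \<omega>)) \<bind> (\<lambda>\<omega>. \<kappa> (\<eta> \<omega>))"
  have sub[measurable]: "\<kappa> \<in> N \<rightarrow>\<^sub>M subprob_algebra L" by (rule measurable_prob_algebraD) simp
  have ne: "space M \<noteq> {}" by (rule not_empty)
  have k: "(\<lambda>\<omega>. \<kappa> (\<eta> \<omega>)) \<in> density M (\<lambda>\<omega>. indicator B (\<eta> \<omega>)) \<rightarrow>\<^sub>M subprob_algebra L"
    by simp
  have e1: "emeasure m1 A = emeasure M (Y -` A \<inter> \<eta> -` B \<inter> space M)" if [measurable]: "A \<in> sets L" for A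
  proof -
    have "emeasure m1 A = (\<integral>\<^sup>+\<omega>. indicator B (\<eta> \<omega>) * indicator (Y -` A \<inter> space M) \<omega> \<partial>M)"
      unfolding m1_def by (subst emeasure_distr) (auto simp: emeasure_density)
    also have "\<dots> = (\<integral>\<^sup>+\<omega>. indicator (Y -` A \<inter> \<eta> -` B \<inter> space M) \<omega> \<partial>M)"
      by (intro nn_integral_cong) (auto split: split_indicator)
    finally show ?thesis by simp
  qed
  have e2: "emeasure m2 A = (\<integral>\<^sup>+\<omega>. indicator B (\<eta> \<omega>) * emeasure (\<kappa> (\<eta> \<omega>)) A \<partial>M)" if [measurable]: "A \<in> sets L" for A
  proof -
    have [measurable]: "(\<lambda>\<omega>. emeasure (\<kappa> (\<eta> \<omega>)) A) \<in> borel_measurable M"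
      by (rule measurable_compose[OF _ measurable_emeasure_kernel[OF sub that]]) simp
    have "emeasure m2 A = (\<integral>\<^sup>+\<omega>. emeasure (\<kappa> (\<eta> \<omega>)) A \<partial>density M (\<lambda>\<omega>. indicator B (\<eta> \<omega>)))"
      unfolding m2_def by (rule emeasure_bind[OF _ k that]) (simp add: ne)
    also have "\<dots> = (\<integral>\<^sup>+\<omega>. indicator B (\<eta> \<omega>) * emeasure (\<kappa> (\<eta> \<omega>)) A \<partial>M)"
      by (subst nn_integral_density) auto
    finally show ?thesis .
  qed
  have "m1 = m2"
  proof (rule measure_eqI_generator_eq[where E="insert (space L) G" and \<Omega>="space L" and A="\<lambda>_. space L"])
    show "Int_stable (insert (space L) G)" using gen by (intro Int_stable_insert_space)
    show "insert (space L) G \<subseteq> Pow (space L)" using gen by auto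
    have S: "sigma_sets (space L) (insert (space L) G) = sets L"
    proof
      have "insert (space L) G \<subseteq> sets L" using gen(1) by auto
      then show "sigma_sets (space L) (insert (space L) G) \<subseteq> sets L" by (rule sets.sigma_sets_subset)
      show "sets L \<subseteq> sigma_sets (space L) (insert (space L) G)"
        unfolding gen(1) by (rule sigma_sets_mono') auto
    qed
    show "sets m1 = sigma_sets (space L) (insert (space L) G)" by (simp add: S m1_def)
    show "sets m2 = sigma_sets (space L) (insert (space L) G)" unfolding S m2_def
      by (rule sets_bind) (auto simp: ne intro!: sets_kernel[OF k])
    fix A assume "A \<in> insert (space L) G"
    then show "emeasure m1 A = emeasure m2 A"
    proof
      assume A: "A = space L"
      have p: "prob_space (\<kappa> (\<eta> \<omega>))" "space (\<kappa> (\<eta> \<omega>)) = space L" if "\<omega> \<in> space M" for \<omega>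
        using that measurable_space[OF \<open>\<kappa> \<in> N \<rightarrow>\<^sub>M prob_algebra L\<close>, of "\<eta> \<omega>"] measurable_space[OF \<open>\<eta> \<in> M \<rightarrow>\<^sub>M N\<close>]
        by (auto simp: space_prob_algebra dest: sets_eq_imp_space_eq)
      have "emeasure m1 A = emeasure M (\<eta> -` B \<inter> space M)"
        unfolding A e1[OF sets.top] using measurable_space[OF \<open>Y \<in> M \<rightarrow>\<^sub>M L\<close>] by (intro arg_cong[where f="emeasure M"]) auto
      also have "\<dots> = (\<integral>\<^sup>+\<omega>. indicator B (\<eta> \<omega>) * emeasure (\<kappa> (\<eta> \<omega>)) A \<partial>M)"
        by (subst nn_integral_indicator[symmetric], simp, intro nn_integral_cong)
          (auto simp: A p(2)[symmetric] prob_space.emeasure_space_1[OF p(1)] simp del: p(2) split: split_indicator)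
      also have "\<dots> = emeasure m2 A" by (simp add: A e2)
      finally show ?thesis .
    next
      assume "A \<in> G"
      then show ?thesis using eq[OF _ B, of A] gen(1) by (subst e1, auto, subst e2, auto)
    qed
  next
    have "emeasure m1 (space L) \<le> emeasure M (space M)" by (simp add: e1 emeasure_mono)
    then show "emeasure m1 (space L) \<noteq> \<infinity>" by (auto simp: emeasure_space_1 top_unique)
  qed auto
  then show "emeasure M (Y -` A \<inter> \<eta> -` B \<inter> space M) =
      (\<integral>\<^sup>+\<omega>. indicator B (\<eta> \<omega>) * emeasure (\<kappa> (\<eta> \<omega>)) A \<partial>M)"
    using e1[OF A] e2[OF A] by simp
qed simp

lemma cond_law_distr:
  assumes c: "cond_law M \<eta> N Y L \<kappa>" and [measurable]: "Y \<in> M \<rightarrow>\<^sub>M L" "\<eta> \<in> M \<rightarrow>\<^sub>M N" "f \<in> L \<rightarrow>\<^sub>M L'"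
    and Y': "\<And>\<omega>. \<omega> \<in> space M \<Longrightarrow> Y' \<omega> = f (Y \<omega>)"
  shows "cond_law M \<eta> N Y' L' (\<lambda>y. distr (\<kappa> y) L' f)"
  unfolding cond_law_def
proof (intro conjI ballI)
  have [measurable]: "\<kappa> \<in> N \<rightarrow>\<^sub>M prob_algebra L" using c by (simp add: cond_law_def)
  show "(\<lambda>y. distr (\<kappa> y) L' f) \<in> N \<rightarrow>\<^sub>M prob_algebra L'" by measurable
  fix A B assume [measurable]: "A \<in> sets L'" "B \<in> sets N"
  have sk: "sets (\<kappa> (\<eta> \<omega>)) = sets L" if "\<omega> \<in> space M" for \<omega>
    using that measurable_space[OF \<open>\<kappa> \<in> N \<rightarrow>\<^sub>M prob_algebra L\<close>, of "\<eta> \<omega>"] measurable_space[OF \<open>\<eta> \<in> M \<rightarrow>\<^sub>M N\<close>]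
    by (auto simp: space_prob_algebra)
  have "Y' -` A \<inter> \<eta> -` B \<inter> space M = Y -` (f -` A \<inter> space L) \<inter> \<eta> -` B \<inter> space M"
    using measurable_space[OF \<open>Y \<in> M \<rightarrow>\<^sub>M L\<close>] by (auto simp: Y')
  then have "emeasure M (Y' -` A \<inter> \<eta> -` B \<inter> space M) =
      (\<integral>\<^sup>+\<omega>. indicator B (\<eta> \<omega>) * emeasure (\<kappa> (\<eta> \<omega>)) (f -` A \<inter> space L) \<partial>M)"
    using c measurable_sets[OF \<open>f \<in> L \<rightarrow>\<^sub>M L'\<close> \<open>A \<in> sets L'\<close>] \<open>B \<in> sets N\<close>
    unfolding cond_law_def by (simp only:)
  also have "\<dots> = (\<integral>\<^sup>+\<omega>. indicator B (\<eta> \<omega>) * emeasure (distr (\<kappa> (\<eta> \<omega>)) L' f) A \<partial>M)"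
  proof (intro nn_integral_cong)
    fix \<omega> assume \<omega>: "\<omega> \<in> space M"
    have "f \<in> \<kappa> (\<eta> \<omega>) \<rightarrow>\<^sub>M L'" using sk[OF \<omega>] by (simp cong: measurable_cong_sets)
    then show "indicator B (\<eta> \<omega>) * emeasure (\<kappa> (\<eta> \<omega>)) (f -` A \<inter> space L) =
        indicator B (\<eta> \<omega>) * emeasure (distr (\<kappa> (\<eta> \<omega>)) L' f) A"
      using sets_eq_imp_space_eq[OF sk[OF \<omega>]] by (simp add: emeasure_distr)
  qed
  finally show "emeasure M (Y' -` A \<inter> \<eta> -` B \<inter> space M) =
      (\<integral>\<^sup>+\<omega>. indicator B (\<eta> \<omega>) * emeasure (distr (\<kappa> (\<eta> \<omega>)) L' f) A \<partial>M)" .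
qed

lemma cond_prob_fun_mono:
  assumes p: "cond_prob_fun M E \<eta> N p" and p': "cond_prob_fun M E' \<eta> N p'"
    and [measurable]: "E \<in> sets M" "E' \<in> sets M" "\<eta> \<in> M \<rightarrow>\<^sub>M N" and sub: "E \<subseteq> E'"
  shows "AE \<omega> in M. p (\<eta> \<omega>) \<le> p' (\<eta> \<omega>)"
proof -
  have [measurable]: "p \<in> borel_measurable N" "p' \<in> borel_measurable N"
    and p01: "0 \<le> p y" "p y \<le> 1" "0 \<le> p' y" "p' y \<le> 1" for y
    using p p' by (auto simp: cond_prob_fun_def)
  define B where "B = {y\<in>space N. p' y < p y}"
  have [measurable]: "B \<in> sets N" unfolding B_def by measurable
  have I: "integrable M x" if "x \<in> borel_measurable M" "\<And>\<omega>. \<bar>x \<omega>\<bar> \<le> 1" for x :: "_ \<Rightarrow> real"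
    using that by (intro integrable_const_bound[where B=1]) auto
  have I1: "integrable M (\<lambda>\<omega>. p (\<eta> \<omega>) * indicator B (\<eta> \<omega>))" "integrable M (\<lambda>\<omega>. p' (\<eta> \<omega>) * indicator B (\<eta> \<omega>))"
    using p01 by (auto intro!: I simp: abs_mult abs_of_nonneg split: split_indicator)
  have "(\<integral>\<omega>. (p (\<eta> \<omega>) - p' (\<eta> \<omega>)) * indicator B (\<eta> \<omega>) \<partial>M)
      = (\<integral>\<omega>. p (\<eta> \<omega>) * indicator B (\<eta> \<omega>) \<partial>M) - (\<integral>\<omega>. p' (\<eta> \<omega>) * indicator B (\<eta> \<omega>) \<partial>M)"
    using I1 by (simp add: left_diff_distrib)
  also have "\<dots> = (\<integral>\<omega>. indicator E \<omega> * indicator B (\<eta> \<omega>) \<partial>M) - (\<integral>\<omega>. indicator E' \<omega> * indicator B (\<eta> \<omega>) \<partial>M)"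
    using cond_prob_fun_integral[OF p, of "indicator B"] cond_prob_fun_integral[OF p', of "indicator B"] by simp
  also have "\<dots> \<le> 0"
    using sub by (intro diff_le_0_iff_le[THEN iffD2] integral_mono I) (auto split: split_indicator)
  finally have "(\<integral>\<omega>. (p (\<eta> \<omega>) - p' (\<eta> \<omega>)) * indicator B (\<eta> \<omega>) \<partial>M) \<le> 0" .
  moreover have nn: "0 \<le> (p (\<eta> \<omega>) - p' (\<eta> \<omega>)) * indicator B (\<eta> \<omega>)" for \<omega>
    by (auto simp: B_def split: split_indicator)
  ultimately have "(\<integral>\<omega>. (p (\<eta> \<omega>) - p' (\<eta> \<omega>)) * indicator B (\<eta> \<omega>) \<partial>M) = 0"
    by (intro antisym integral_nonneg_AE) auto
  moreover have "integrable M (\<lambda>\<omega>. (p (\<eta> \<omega>) - p' (\<eta> \<omega>)) * indicator B (\<eta> \<omega>))"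
    using I1 by (simp add: left_diff_distrib)
  ultimately have "AE \<omega> in M. (p (\<eta> \<omega>) - p' (\<eta> \<omega>)) * indicator B (\<eta> \<omega>) = 0"
    using nn by (subst (asm) integral_nonneg_eq_0_iff_AE) auto
  with AE_space show ?thesis
    by eventually_elim (use measurable_space[OF \<open>\<eta> \<in> M \<rightarrow>\<^sub>M N\<close>] in \<open>auto simp: B_def not_less split: split_indicator_asm\<close>)
qed

text \<open>Choose conditional probabilities \<open>G q\<close> of the events \<open>Y \<le> q\<close> for rational \<open>q\<close> and let \<open>\<kappa> y\<close> be
  the law of the quantile function \<open>Q y\<close> at a uniformly distributed argument. This is a
  probability measure for \<^emph>\<open>every\<close> \<open>y\<close>, even where the \<open>G q y\<close> fail to be monotone in \<open>q\<close>, because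
  \<open>\<kappa> y {..<x}\<close> is always the supremum of the \<open>G q y\<close> with \<open>q < x\<close>. Values in the extended reals
  keep the infimum in the definition of \<open>Q\<close> meaningful where the admissible \<open>q\<close> are unbounded
  below or do not exist.\<close>

lemma cond_law_ereal_exists:
  fixes Y :: "'a \<Rightarrow> ereal"
  assumes [measurable]: "Y \<in> borel_measurable M" "\<eta> \<in> M \<rightarrow>\<^sub>M N"
  shows "\<exists>\<kappa>. cond_law M \<eta> N Y borel \<kappa>"
proof -
  let ?r = "\<lambda>q::rat. ereal (of_rat q)"
  define E where "E q = {\<omega>\<in>space M. Y \<omega> \<le> ?r q}" for q
  have [measurable]: "E q \<in> sets M" for q unfolding E_def by measurable
  have "\<forall>q. \<exists>p. cond_prob_fun M (E q) \<eta> N p"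
    by (auto intro!: cond_prob_fun_exists)
  then obtain G where G: "\<And>q. cond_prob_fun M (E q) \<eta> N (G q)" by metis
  have [measurable]: "G q \<in> borel_measurable N" and G01: "0 \<le> G q y" "G q y \<le> 1" for q y
    using G[of q] by (auto simp: cond_prob_fun_def)
  define Q where "Q y t = (INF q. if t \<le> G q y then ?r q else \<infinity>)" for y and t :: real
  have Q_less: "Q y t < x \<longleftrightarrow> (\<exists>q. t \<le> G q y \<and> ?r q < x)" for y t x
    unfolding Q_def INF_less_iff by auto
  have [measurable]: "case_prod Q \<in> borel_measurable (N \<Otimes>\<^sub>M borel)"
    unfolding Q_def split_beta' by measurable
  define U where "U = uniform_measure lborel {0..1::real}"
  have U: "U \<in> space (prob_algebra borel)"
    unfolding U_def space_prob_algebra by (auto intro!: prob_space_uniform_measure)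
  interpret U: prob_space U using U by (simp add: space_prob_algebra)
  have sU[measurable_cong, simp]: "sets U = sets borel" using U by (simp add: space_prob_algebra)
  have spU[simp]: "space U = UNIV" using sets_eq_imp_space_eq[OF sU] by simp
  have Uc: "emeasure U {..c} = ennreal c" if "0 \<le> c" "c \<le> 1" for c
  proof -
    have "{0..1} \<inter> {..c} = {0..c}" using that by auto
    then show ?thesis using that unfolding U_def by (simp add: divide_ennreal_def)
  qed
  define \<kappa> where "\<kappa> y = distr U borel (Q y)" for y
  have \<kappa>m: "\<kappa> \<in> N \<rightarrow>\<^sub>M prob_algebra borel"
    unfolding \<kappa>_def by (rule measurable_distr_prob_space2[where M=borel]) (use U in auto)
  have [measurable]: "Q y \<in> borel_measurable borel" if "y \<in> space N" for y
    using measurable_Pair2[OF \<open>case_prod Q \<in> borel_measurable (N \<Otimes>\<^sub>M borel)\<close> that] by simp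
  have \<kappa>_le: "emeasure (\<kappa> y) {..<x} \<le> s" if "y \<in> space N" "\<And>q. ?r q < x \<Longrightarrow> ennreal (G q y) \<le> s" for y x s
  proof (cases "s \<ge> 1")
    case True
    then show ?thesis unfolding \<kappa>_def using that
      by (subst emeasure_distr) (auto intro!: order_trans[OF U.emeasure_le_1])
  next
    case False
    then obtain s' where s': "s = ennreal s'" "0 \<le> s'" "s' \<le> 1"
      by (cases s) (auto simp: not_le top_unique)
    have "emeasure (\<kappa> y) {..<x} = emeasure U {t. Q y t < x}"
      unfolding \<kappa>_def using that by (subst emeasure_distr) (auto intro!: arg_cong[where f="emeasure U"])
    also have "\<dots> \<le> emeasure U {..s'}"
      using that(2) s' by (intro emeasure_mono) (fastforce simp: Q_less ennreal_le_iff)+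
    also have "\<dots> = s" using s' by (simp add: Uc)
    finally show ?thesis .
  qed
  have \<kappa>_ge: "ennreal (G q y) \<le> emeasure (\<kappa> y) {..<x}" if "y \<in> space N" "?r q < x" for y x q
  proof -
    have "ennreal (G q y) = emeasure U {..G q y}" using G01 by (simp add: Uc)
    also have "\<dots> \<le> emeasure U {t. Q y t < x}"
      using that by (intro emeasure_mono) (auto simp: Q_less)
    also have "\<dots> = emeasure (\<kappa> y) {..<x}"
      unfolding \<kappa>_def using that by (subst emeasure_distr) (auto intro!: arg_cong[where f="emeasure U"])
    finally show ?thesis .
  qed
  have "cond_law M \<eta> N Y borel \<kappa>"
  proof (rule cond_lawI_generator[where G="range lessThan"])
    show "sets borel = sigma_sets (space borel) (range lessThan :: ereal set set)"
      unfolding borel_Iio[where 'a=ereal] by (simp only: space_measure_of_conv sets_measure_of_conv Pow_UNIV subset_UNIV if_True)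
    show "Int_stable (range lessThan :: ereal set set)"
    proof (rule Int_stableI, safe)
      fix x y :: ereal
      have "{..<x} \<inter> {..<y} = {..<min x y}" by auto
      then show "{..<x} \<inter> {..<y} \<in> range lessThan" by blast
    qed
    fix A :: "ereal set" and B assume "A \<in> range lessThan" and [measurable]: "B \<in> sets N"
    then obtain x where A: "A = {..<x}" by auto
    define F where "F = {\<omega>\<in>space M. Y \<omega> < x}"
    have [measurable]: "F \<in> sets M" unfolding F_def by measurable
    obtain H where H: "cond_prob_fun M F \<eta> N H" using cond_prob_fun_exists[of F \<eta> N] by auto
    let ?K = "\<integral>\<^sup>+\<omega>. indicator B (\<eta> \<omega>) * emeasure (\<kappa> (\<eta> \<omega>)) A \<partial>M"
    have \<eta>s: "\<eta> \<omega> \<in> space N" if "\<omega> \<in> space M" for \<omega> using that by (rule measurable_space[rotated]) simp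
    have GH: "AE \<omega> in M. \<forall>q. ?r q < x \<longrightarrow> G q (\<eta> \<omega>) \<le> H (\<eta> \<omega>)"
      unfolding AE_all_countable
    proof
      fix q show "AE \<omega> in M. ?r q < x \<longrightarrow> G q (\<eta> \<omega>) \<le> H (\<eta> \<omega>)"
      proof (cases "?r q < x")
        case True
        then have "AE \<omega> in M. G q (\<eta> \<omega>) \<le> H (\<eta> \<omega>)"
          by (intro cond_prob_fun_mono[OF G H]) (auto simp: E_def F_def)
        then show ?thesis by simp
      qed simp
    qed
    have "?K \<le> (\<integral>\<^sup>+\<omega>. indicator B (\<eta> \<omega>) * ennreal (H (\<eta> \<omega>)) \<partial>M)"
      by (intro nn_integral_mono_AE, use GH AE_space in eventually_elim)
        (auto simp: A intro!: mult_left_mono \<kappa>_le \<eta>s ennreal_leI)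
    also have "\<dots> = emeasure M (F \<inter> \<eta> -` B \<inter> space M)" using H by (simp add: cond_prob_fun_def)
    finally have le: "?K \<le> emeasure M (F \<inter> \<eta> -` B \<inter> space M)" .
    define R where "R = {q. ?r q < x}"
    have ge: "emeasure M (E q \<inter> \<eta> -` B \<inter> space M) \<le> ?K" if "q \<in> R" for q
    proof -
      have "emeasure M (E q \<inter> \<eta> -` B \<inter> space M) = (\<integral>\<^sup>+\<omega>. indicator B (\<eta> \<omega>) * ennreal (G q (\<eta> \<omega>)) \<partial>M)"
        using G[of q] by (simp add: cond_prob_fun_def)
      also have "\<dots> \<le> ?K" using that by (intro nn_integral_mono mult_left_mono) (auto simp: A R_def intro!: \<kappa>_ge \<eta>s)
      finally show ?thesis .
    qed
    have "emeasure M (F \<inter> \<eta> -` B \<inter> space M) \<le> ?K"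
    proof (cases "R = {}")
      case True
      have "F = {}"
      proof (rule ccontr)
        assume "F \<noteq> {}"
        then obtain \<omega> where "Y \<omega> < x" by (auto simp: F_def)
        then obtain z where "Y \<omega> < ereal z" "ereal z < x" using ereal_dense2 by blast
        then obtain z' where "ereal z < ereal z'" "ereal z' < x" using ereal_dense2 by blast
        then obtain q where "z < of_rat q" "of_rat q < z'" using of_rat_dense by auto
        then have "?r q < ereal z'" by simp
        then have "q \<in> R" unfolding R_def using less_trans[OF _ \<open>ereal z' < x\<close>] by blast
        then show False using True by simp
      qed
      then show ?thesis by simp
    next
      case False
      define e where "e = from_nat_into R"
      have eR: "e n \<in> R" for n using False by (simp add: e_def from_nat_into)
      \<comment> \<open>The enumeration of \<open>R\<close> need not be monotone; its running maxima are, and they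
        exhaust the event from below.\<close>
      define m where "m n = Max (e ` {..n})" for n
      have mR: "m n \<in> R" for n
      proof -
        have "m n \<in> e ` {..n}" unfolding m_def by (rule Max_in) auto
        then show ?thesis using eR by auto
      qed
      have inc: "incseq (\<lambda>n. E (m n) \<inter> \<eta> -` B \<inter> space M)"
      proof (rule incseq_SucI)
        fix n
        have "m n \<le> m (Suc n)" unfolding m_def by (intro Max_mono) auto
        then have "?r (m n) \<le> ?r (m (Suc n))" by (simp add: of_rat_less_eq)
        then show "E (m n) \<inter> \<eta> -` B \<inter> space M \<subseteq> E (m (Suc n)) \<inter> \<eta> -` B \<inter> space M"
          by (auto simp: E_def intro: order_trans)
      qed
      have "F \<inter> \<eta> -` B \<inter> space M = (\<Union>n. E (m n) \<inter> \<eta> -` B \<inter> space M)"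
      proof (intro equalityI subsetI)
        fix \<omega> assume \<omega>: "\<omega> \<in> F \<inter> \<eta> -` B \<inter> space M"
        then have "Y \<omega> < x" by (auto simp: F_def)
        then obtain z where z: "Y \<omega> < ereal z" "ereal z < x" using ereal_dense2 by blast
        then obtain z' where z': "ereal z < ereal z'" "ereal z' < x" using ereal_dense2 by blast
        then obtain q where q: "z < of_rat q" "of_rat q < z'" using of_rat_dense by auto
        then have "?r q < ereal z'" by simp
        then have "q \<in> R" unfolding R_def using less_trans[OF _ z'(2)] by blast
        then obtain n where "e n = q" unfolding e_def using from_nat_into_surj[of R q] by auto
        then have "q \<le> m n" unfolding m_def by auto
        then have "?r q \<le> ?r (m n)" by (simp add: of_rat_less_eq)
        moreover have "ereal z < ?r q" using q by simp
        ultimately have "Y \<omega> \<le> ?r (m n)" using z(1) by (meson less_imp_le less_le_trans less_trans)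
        then show "\<omega> \<in> (\<Union>n. E (m n) \<inter> \<eta> -` B \<inter> space M)" using \<omega> by (auto simp: E_def)
      next
        fix \<omega> assume "\<omega> \<in> (\<Union>n. E (m n) \<inter> \<eta> -` B \<inter> space M)"
        then show "\<omega> \<in> F \<inter> \<eta> -` B \<inter> space M" using mR by (auto simp: E_def F_def R_def intro: le_less_trans)
      qed
      then have "emeasure M (F \<inter> \<eta> -` B \<inter> space M) = (SUP n. emeasure M (E (m n) \<inter> \<eta> -` B \<inter> space M))"
        using inc by (subst SUP_emeasure_incseq) auto
      also have "\<dots> \<le> ?K" by (intro SUP_least ge mR)
      finally show ?thesis .
    qed
    with le have "emeasure M (F \<inter> \<eta> -` B \<inter> space M) = ?K" by (rule antisym[rotated])
    moreover have "Y -` A \<inter> \<eta> -` B \<inter> space M = F \<inter> \<eta> -` B \<inter> space M" by (auto simp: A F_def)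
    ultimately show "emeasure M (Y -` A \<inter> \<eta> -` B \<inter> space M) = ?K" by simp
  qed (use \<kappa>m in auto)
  then show ?thesis by blast
qed

lemma cond_law_exists:
  assumes "real_coding L \<phi> r" and [measurable]: "Y \<in> M \<rightarrow>\<^sub>M L" "\<eta> \<in> M \<rightarrow>\<^sub>M N"
  shows "\<exists>\<kappa>. cond_law M \<eta> N Y L \<kappa>"
proof -
  have [measurable]: "\<phi> \<in> borel_measurable L" "r \<in> borel \<rightarrow>\<^sub>M L" and r: "\<And>x. x \<in> space L \<Longrightarrow> r (\<phi> x) = x"
    using assms(1) by (auto simp: real_coding_def)
  obtain \<kappa> where "cond_law M \<eta> N (\<lambda>\<omega>. ereal (\<phi> (Y \<omega>))) borel \<kappa>"
    using cond_law_ereal_exists[of "\<lambda>\<omega>. ereal (\<phi> (Y \<omega>))" \<eta> N] by auto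
  then have "cond_law M \<eta> N Y L (\<lambda>y. distr (\<kappa> y) L (\<lambda>t. r (real_of_ereal t)))"
    by (rule cond_law_distr) (auto simp: r measurable_space[OF \<open>Y \<in> M \<rightarrow>\<^sub>M L\<close>])
  then show ?thesis by blast
qed

end

section \<open>Exchangeability under injections\<close>

text \<open>The sets \<open>U\<close> and \<open>p ` U\<close> have complements of equal size in their union, which a permutation of
  that union may therefore match arbitrarily.\<close>

lemma finite_injection_extends_to_Sym0:
  assumes "finite U" "U \<subseteq> S" "inj_on p U" "p ` U \<subseteq> S"
  shows "\<exists>g\<in>Sym0 S. \<forall>x\<in>U. g x = p x"
proof -
  define V where "V = U \<union> p ` U"
  have V: "finite V" "V \<subseteq> S" using assms by (auto simp: V_def)
  have "card (V - U) = card (V - p ` U)"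
    using assms V by (subst (1 2) card_Diff_subset) (auto simp: V_def card_image)
  then obtain h where h: "bij_betw h (V - U) (V - p ` U)"
    using V by (metis finite_Diff finite_same_card_bij)
  define g where "g x = (if x \<in> U then p x else if x \<in> V then h x else x)" for x
  have "bij_betw g U (p ` U)"
    using assms(3) by (subst bij_betw_cong[of _ _ p]) (auto simp: g_def bij_betw_def)
  moreover have "bij_betw g (V - U) (V - p ` U)"
    using h by (subst bij_betw_cong[of _ _ h]) (auto simp: g_def)
  ultimately have "bij_betw g (U \<union> (V - U)) (p ` U \<union> (V - p ` U))"
    by (rule bij_betw_combine) auto
  then have "bij_betw g V V" by (simp add: V_def Un_absorb1 Un_Diff_cancel sup_commute)
  then have g: "g permutes V" by (rule bij_imp_permutes) (auto simp: g_def V_def)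
  have "{s. g s \<noteq> s} \<subseteq> V" using permutes_not_in[OF g] by auto
  then have "g \<in> Sym0 S" using permutes_subset[OF g V(2)] V(1) unfolding Sym0_def
    by (auto intro: finite_subset)
  then show ?thesis by (intro bexI[of _ g]) (auto simp: g_def)
qed

lemma injection_extends_into_infinite:
  assumes "countable S" "finite U" "infinite W" "inj_on f U"
  shows "\<exists>p. inj_on p (S \<union> U) \<and> (\<forall>x\<in>U. p x = f x) \<and> (\<forall>x\<in>S - U. p x \<in> W - f ` U)"
proof -
  have "infinite (W - f ` U)" using assms by simp
  then obtain g :: "nat \<Rightarrow> 'b" where g: "inj g" "range g \<subseteq> W - f ` U"
    using infinite_countable_subset by blast
  define p where "p x = (if x \<in> U then f x else g (to_nat_on S x))" for x
  have "inj_on p (S \<union> U)"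
  proof (rule inj_onI)
    fix x y assume xy: "x \<in> S \<union> U" "y \<in> S \<union> U" "p x = p y"
    have *: "f v \<noteq> g n" if "v \<in> U" for v n using g(2) that by auto
    consider "x \<in> U" "y \<in> U" | "x \<notin> U" "y \<notin> U" | "x \<in> U" "y \<notin> U" | "x \<notin> U" "y \<in> U" by blast
    then show "x = y"
    proof cases
      case 1 then show ?thesis using xy assms(4) by (auto simp: p_def dest: inj_onD)
    next
      case 2
      then have "to_nat_on S x = to_nat_on S y" using xy g(1) by (auto simp: p_def dest: injD)
      then show ?thesis using xy 2 inj_on_to_nat_on[OF assms(1)] by (auto dest: inj_onD)
    next
      case 3 then show ?thesis using xy(3) * by (simp add: p_def)
    next
      case 4 then show ?thesis using xy(3) *[of y "to_nat_on S x"] by (simp add: p_def)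
    qed
  qed
  then show ?thesis using g(2) by (intro exI[of _ p]) (auto simp: p_def)
qed

lemma nsets_image:
  assumes "inj_on p S" "p ` S \<subseteq> S'" "e \<in> nsets S k"
  shows "p ` e \<in> nsets S' k"
  using assms by (auto simp: nsets_def card_image inj_on_subset)

lemma prod_emb_box:
  assumes "J \<subseteq> I"
  shows "prod_emb I M J (Pi\<^sub>E J A) = {x\<in>space (Pi\<^sub>M I M). \<forall>j\<in>J. x j \<in> A j}"
  using assms by (auto simp: prod_emb_def space_PiM PiE_iff extensional_def)

lemma vertex_action_measurable:
  assumes "inj_on p S" "p ` S \<subseteq> S"
  shows "vertex_action S k p \<in> hypergraph_space S k K \<rightarrow>\<^sub>M hypergraph_space S k K"
  unfolding vertex_action_def hypergraph_space_def
  by (rule measurable_restrict) (auto intro!: measurable_component_singleton nsets_image[OF assms])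

text \<open>Invariance under finitely supported permutations extends to all injections, because the
  probability of a finite-dimensional event sees only finitely many vertices.\<close>

lemma exchangeable_injection:
  assumes ex: "exchangeable_hypergraph S k K \<mu>" and p: "inj_on p S" "p ` S \<subseteq> S"
  shows "distr \<mu> (hypergraph_space S k K) (vertex_action S k p) = \<mu>"
proof -
  let ?H = "hypergraph_space S k K"
  have \<mu>: "sets \<mu> = sets ?H" "prob_space \<mu>"
    using ex by (auto simp: exchangeable_hypergraph_def space_prob_algebra)
  interpret prob_space \<mu> by fact
  have vm: "vertex_action S k q \<in> \<mu> \<rightarrow>\<^sub>M ?H" if "inj_on q S" "q ` S \<subseteq> S" for q
    using vertex_action_measurable[OF that, of k K] by (simp add: measurable_cong_sets[OF \<mu>(1) refl])
  show ?thesis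
  proof (rule measure_eqI_PiM_infinite[of _ "nsets S k" "\<lambda>_. K"])
    show "sets (distr \<mu> ?H (vertex_action S k p)) = sets (Pi\<^sub>M (nsets S k) (\<lambda>_. K))"
      by (simp add: hypergraph_space_def)
    show "sets \<mu> = sets (Pi\<^sub>M (nsets S k) (\<lambda>_. K))" using \<mu> by (simp add: hypergraph_space_def)
    show "finite_measure (distr \<mu> ?H (vertex_action S k p))"
      using prob_space.finite_measure[OF prob_space_distr[OF vm[OF p]]] .
    fix A J assume J: "finite J" "J \<subseteq> nsets S k" and A: "\<And>i. i \<in> J \<Longrightarrow> A i \<in> sets K"
    define X where "X = prod_emb (nsets S k) (\<lambda>_. K) J (Pi\<^sub>E J A)"
    have X: "X \<in> sets ?H" unfolding X_def hypergraph_space_def using J A by (intro sets_PiM_I) auto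
    have "finite (\<Union>J)" "\<Union>J \<subseteq> S" using J by (auto simp: nsets_def)
    then obtain g where g: "g \<in> Sym0 S" "\<And>x. x \<in> \<Union>J \<Longrightarrow> g x = p x"
      using finite_injection_extends_to_Sym0[of "\<Union>J" S p] p by (meson image_mono inj_on_subset order_trans)
    have gp: "inj_on g S" "g ` S \<subseteq> S"
      using g(1) by (auto simp: Sym0_def permutes_in_image intro: permutes_inj_on)
    have im: "g ` e = p ` e" if "e \<in> J" for e using that g(2) by (intro image_cong) auto
    have "vertex_action S k p -` X \<inter> space \<mu> = vertex_action S k g -` X \<inter> space \<mu>"
    proof (intro set_eqI)
      fix \<omega>
      have *: "vertex_action S k q \<omega> \<in> X \<longleftrightarrow> (\<forall>e\<in>J. \<omega> (q ` e) \<in> A e)"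
        if "inj_on q S" "q ` S \<subseteq> S" "\<omega> \<in> space \<mu>" for q
      proof -
        have "vertex_action S k q \<omega> \<in> space ?H" using vm[OF that(1,2)] that(3) by (rule measurable_space)
        moreover have "vertex_action S k q \<omega> e = \<omega> (q ` e)" if "e \<in> J" for e
          using that J by (auto simp: vertex_action_def)
        ultimately show ?thesis unfolding X_def prod_emb_box[OF J(2)] by (simp add: hypergraph_space_def)
      qed
      show "\<omega> \<in> vertex_action S k p -` X \<inter> space \<mu> \<longleftrightarrow> \<omega> \<in> vertex_action S k g -` X \<inter> space \<mu>"
        using *[OF p] *[OF gp] im by auto
    qed
    then have "emeasure (distr \<mu> ?H (vertex_action S k p)) X = emeasure (distr \<mu> ?H (vertex_action S k g)) X"
      using X by (simp add: emeasure_distr[OF vm[OF p]] emeasure_distr[OF vm[OF gp]])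
    also have "\<dots> = emeasure \<mu> X" using ex g(1) by (simp add: exchangeable_hypergraph_def)
    finally show "emeasure (distr \<mu> ?H (vertex_action S k p)) (prod_emb (nsets S k) (\<lambda>_. K) J (Pi\<^sub>E J A)) =
      emeasure \<mu> (prod_emb (nsets S k) (\<lambda>_. K) J (Pi\<^sub>E J A))" by (simp add: X_def)
  qed
qed

section \<open>Products and symmetrizations of kernels\<close>

lemma emeasure_PiM_kernels_box:
  assumes "\<And>i. i \<in> I \<Longrightarrow> m i \<in> space (prob_algebra (L i))"
    and "J \<subseteq> I" "finite J" "\<And>j. j \<in> J \<Longrightarrow> A j \<in> sets (L j)"
  shows "emeasure (Pi\<^sub>M I m) (prod_emb I L J (Pi\<^sub>E J A)) = (\<Prod>j\<in>J. emeasure (m j) (A j))"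
proof -
  have m: "sets (m i) = sets (L i)" "prob_space (m i)" if "i \<in> I" for i
    using assms(1)[OF that] by (auto simp: space_prob_algebra)
  have "prod_emb I L J (Pi\<^sub>E J A) = prod_emb I m J (Pi\<^sub>E J A)"
    using sets_eq_imp_space_eq[OF m(1)] by (auto simp: prod_emb_def PiE_iff)
  moreover have "A j \<in> sets (m j)" if "j \<in> J" for j using m(1)[of j] assms(2,4) that by blast
  ultimately show ?thesis using emeasure_PiM_emb[of I m J A] m(2) assms(2,3) by auto
qed

lemma PiM_in_prob_algebra:
  assumes "\<And>i. i \<in> I \<Longrightarrow> m i \<in> space (prob_algebra (L i))"
  shows "Pi\<^sub>M I m \<in> space (prob_algebra (Pi\<^sub>M I L))"
  using assms unfolding space_prob_algebra by (auto intro!: prob_space_PiM sets_PiM_cong)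

lemma measurable_PiM_kernels:
  assumes "\<And>i. i \<in> I \<Longrightarrow> \<kappa> i \<in> N \<rightarrow>\<^sub>M prob_algebra (L i)"
  shows "(\<lambda>x. Pi\<^sub>M I (\<lambda>i. \<kappa> i x)) \<in> N \<rightarrow>\<^sub>M prob_algebra (Pi\<^sub>M I L)"
proof (rule measurable_prob_algebra_generated[OF sets_PiM Int_stable_prod_algebra prod_algebra_sets_into_space])
  have k: "\<kappa> i x \<in> space (prob_algebra (L i))" if "x \<in> space N" "i \<in> I" for x i
    using assms[OF that(2)] that(1) by (rule measurable_space)
  have P: "Pi\<^sub>M I (\<lambda>i. \<kappa> i x) \<in> space (prob_algebra (Pi\<^sub>M I L))" if "x \<in> space N" for x
    using k that by (intro PiM_in_prob_algebra)
  show "prob_space (Pi\<^sub>M I (\<lambda>i. \<kappa> i x))" "sets (Pi\<^sub>M I (\<lambda>i. \<kappa> i x)) = sets (Pi\<^sub>M I L)" if "x \<in> space N" for x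
    using P[OF that] by (auto simp: space_prob_algebra)
  fix A assume "A \<in> prod_algebra I L"
  then obtain J E where A: "A = prod_emb I L J (Pi\<^sub>E J E)" "finite J" "J \<noteq> {} \<or> I = {}" "J \<subseteq> I" "\<And>i. i \<in> J \<Longrightarrow> E i \<in> sets (L i)"
    by (rule prod_algebraE) blast
  have "(\<lambda>x. \<Prod>j\<in>J. emeasure (\<kappa> j x) (E j)) \<in> borel_measurable N"
  proof (rule borel_measurable_prod_ennreal)
    fix j assume "j \<in> J"
    then have "\<kappa> j \<in> N \<rightarrow>\<^sub>M subprob_algebra (L j)" "E j \<in> sets (L j)"
      using A assms by (auto intro!: measurable_prob_algebraD)
    then show "(\<lambda>x. emeasure (\<kappa> j x) (E j)) \<in> borel_measurable N" by (rule measurable_emeasure_kernel)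
  qed
  then show "(\<lambda>x. emeasure (Pi\<^sub>M I (\<lambda>i. \<kappa> i x)) A) \<in> borel_measurable N"
    by (rule measurable_cong[THEN iffD1, rotated]) (simp add: A emeasure_PiM_kernels_box[of I _ L] k)
qed

definition average :: "'i set \<Rightarrow> ('i \<Rightarrow> 'x measure) \<Rightarrow> 'x measure" where
  "average \<Sigma> F = uniform_count_measure \<Sigma> \<bind> F"

lemma
  assumes \<Sigma>: "finite \<Sigma>" "\<Sigma> \<noteq> {}" and F: "\<And>s. s \<in> \<Sigma> \<Longrightarrow> F s \<in> space (prob_algebra X)"
  shows emeasure_average: "A \<in> sets X \<Longrightarrow> emeasure (average \<Sigma> F) A = (\<Sum>s\<in>\<Sigma>. ennreal (1 / card \<Sigma>) * emeasure (F s) A)"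
    and average_in_prob_algebra: "average \<Sigma> F \<in> space (prob_algebra X)"
proof -
  have F': "F \<in> uniform_count_measure \<Sigma> \<rightarrow>\<^sub>M prob_algebra X"
    using F unfolding uniform_count_measure_def measurable_point_measure_eq1 by auto
  show "emeasure (average \<Sigma> F) A = (\<Sum>s\<in>\<Sigma>. ennreal (1 / card \<Sigma>) * emeasure (F s) A)" if "A \<in> sets X"
    unfolding average_def using \<Sigma> that
    by (subst emeasure_bind[OF _ measurable_prob_algebraD[OF F']])
      (auto simp: space_point_measure uniform_count_measure_def nn_integral_point_measure_finite)
  have "uniform_count_measure \<Sigma> \<in> space (prob_algebra (uniform_count_measure \<Sigma>))"
    using prob_space_uniform_count_measure[OF \<Sigma>] by (simp add: space_prob_algebra)
  from prob_space_bind'[OF this F'] sets_bind'[OF this F'] show "average \<Sigma> F \<in> space (prob_algebra X)"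
    by (simp add: average_def space_prob_algebra)
qed

definition coordinate_action :: "nat \<Rightarrow> (nat \<Rightarrow> nat) \<Rightarrow> (nat set \<Rightarrow> 'z) \<Rightarrow> nat set \<Rightarrow> 'z" where
  "coordinate_action i \<sigma> x = (\<lambda>a\<in>{a. a \<subset> {1..i}}. x (\<sigma> ` a))"

lemma permutes_psubset:
  assumes "\<sigma> permutes B" "a \<subset> B" shows "\<sigma> ` a \<subset> B" "card (\<sigma> ` a) = card a"
proof -
  have "\<sigma> ` a \<subset> \<sigma> ` B" using assms by (intro image_strict_mono permutes_inj_on)
  then show "\<sigma> ` a \<subset> B" using permutes_image[OF assms(1)] by simp
  show "card (\<sigma> ` a) = card a" using permutes_inj_on[OF assms(1)] by (rule card_image)
qed

lemma coordinate_action_measurable: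
  assumes "\<sigma> permutes {1..i}"
  shows "coordinate_action i \<sigma> \<in> kernel_dom Z i \<rightarrow>\<^sub>M kernel_dom Z i"
  unfolding coordinate_action_def kernel_dom_def
proof (rule measurable_restrict)
  fix a assume "a \<in> {a. a \<subset> {1..i}}"
  then have \<sigma>a: "\<sigma> ` a \<in> {a. a \<subset> {1..i}}" "card (\<sigma> ` a) = card a"
    using permutes_psubset[OF assms] by auto
  show "(\<lambda>x. x (\<sigma> ` a)) \<in> (\<Pi>\<^sub>M a\<in>{a. a \<subset> {1..i}}. Z (card a)) \<rightarrow>\<^sub>M Z (card a)"
    using measurable_component_singleton[OF \<sigma>a(1), of "\<lambda>a. Z (card a)"] unfolding \<sigma>a(2) .
qed

lemma coordinate_action_compose:
  assumes "\<sigma> permutes {1..i}"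
  shows "coordinate_action i \<sigma> (coordinate_action i \<tau> x) = coordinate_action i (\<tau> \<circ> \<sigma>) x"
  unfolding coordinate_action_def using permutes_psubset[OF assms] by (auto simp: image_comp)

text \<open>Versions of conditional laws are determined only almost everywhere, whereas \<open>symmetric_kernel\<close>
  demands invariance at every point. Averaging over the finite group of permutations achieves
  this.\<close>

definition symmetrization :: "nat \<Rightarrow> ((nat set \<Rightarrow> 'z) \<Rightarrow> 'x measure) \<Rightarrow> (nat set \<Rightarrow> 'z) \<Rightarrow> 'x measure" where
  "symmetrization i \<kappa> x = average {\<sigma>. \<sigma> permutes {1..i}} (\<lambda>\<sigma>. \<kappa> (coordinate_action i \<sigma> x))"

lemma permutations_finite_nonempty: "finite {\<sigma>. \<sigma> permutes {1..i::nat}}" "{\<sigma>. \<sigma> permutes {1..i::nat}} \<noteq> {}"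
  using finite_permutations[of "{1..i}"] permutes_id[of "{1..i}"] by blast+

lemma coordinate_action_in_prob_algebra:
  assumes \<kappa>: "\<kappa> \<in> kernel_dom Z i \<rightarrow>\<^sub>M prob_algebra X" and x: "x \<in> space (kernel_dom Z i)"
    and \<sigma>: "\<sigma> \<in> {\<sigma>. \<sigma> permutes {1..i}}"
  shows "\<kappa> (coordinate_action i \<sigma> x) \<in> space (prob_algebra X)"
proof -
  have "\<sigma> permutes {1..i}" using \<sigma> by (rule CollectD)
  from measurable_space[OF \<kappa> measurable_space[OF coordinate_action_measurable[OF this] x]] show ?thesis .
qed

lemma emeasure_symmetrization:
  assumes \<kappa>: "\<kappa> \<in> kernel_dom Z i \<rightarrow>\<^sub>M prob_algebra X" and x: "x \<in> space (kernel_dom Z i)" and A: "A \<in> sets X"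
  shows "emeasure (symmetrization i \<kappa> x) A =
    (\<Sum>\<sigma>\<in>{\<sigma>. \<sigma> permutes {1..i}}. ennreal (1 / card {\<sigma>. \<sigma> permutes {1..i}}) * emeasure (\<kappa> (coordinate_action i \<sigma> x)) A)"
  unfolding symmetrization_def
  by (rule emeasure_average[OF permutations_finite_nonempty coordinate_action_in_prob_algebra[OF \<kappa> x] A])

lemma symmetrization_measurable:
  assumes \<kappa>: "\<kappa> \<in> kernel_dom Z i \<rightarrow>\<^sub>M prob_algebra X"
  shows "symmetrization i \<kappa> \<in> kernel_dom Z i \<rightarrow>\<^sub>M prob_algebra X"
proof (rule measurable_prob_algebra_generated[OF sets.sigma_sets_eq[symmetric] sets.Int_stable sets.space_closed])
  have P: "symmetrization i \<kappa> x \<in> space (prob_algebra X)" if "x \<in> space (kernel_dom Z i)" for x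
    unfolding symmetrization_def
    by (rule average_in_prob_algebra[OF permutations_finite_nonempty coordinate_action_in_prob_algebra[OF \<kappa> that]])
  show "prob_space (symmetrization i \<kappa> x)" "sets (symmetrization i \<kappa> x) = sets X" if "x \<in> space (kernel_dom Z i)" for x
    using P[OF that] by (auto simp: space_prob_algebra)
  fix A assume A: "A \<in> sets X"
  have "(\<lambda>x. emeasure (\<kappa> (coordinate_action i \<sigma> x)) A) \<in> borel_measurable (kernel_dom Z i)" if "\<sigma> permutes {1..i}" for \<sigma>
    by (rule measurable_compose[OF coordinate_action_measurable[OF that]
          measurable_emeasure_kernel[OF measurable_prob_algebraD[OF \<kappa>] A]])
  then show "(\<lambda>x. emeasure (symmetrization i \<kappa> x) A) \<in> borel_measurable (kernel_dom Z i)"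
    by (subst measurable_cong[OF emeasure_symmetrization[OF \<kappa> _ A]])
      (auto intro!: borel_measurable_sum borel_measurable_times)
qed

lemma symmetric_kernel_symmetrization:
  assumes \<kappa>: "\<kappa> \<in> kernel_dom Z i \<rightarrow>\<^sub>M prob_algebra X"
  shows "symmetric_kernel Z i X (symmetrization i \<kappa>)"
  unfolding symmetric_kernel_def
proof (intro conjI allI impI ballI symmetrization_measurable \<kappa>)
  fix \<tau> x assume \<tau>: "\<tau> permutes {1..i}" and x: "x \<in> space (kernel_dom Z i)"
  have x': "coordinate_action i \<tau> x \<in> space (kernel_dom Z i)"
    using coordinate_action_measurable[OF \<tau>] x by (rule measurable_space)
  have s: "sets (symmetrization i \<kappa> y) = sets X" if "y \<in> space (kernel_dom Z i)" for y
    using measurable_space[OF symmetrization_measurable[OF \<kappa>] that] by (simp add: space_prob_algebra)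
  have "symmetrization i \<kappa> (coordinate_action i \<tau> x) = symmetrization i \<kappa> x"
  proof (rule measure_eqI)
    fix A assume "A \<in> sets (symmetrization i \<kappa> (coordinate_action i \<tau> x))"
    then have A: "A \<in> sets X" using s[OF x'] by simp
    let ?f = "\<lambda>\<sigma>. ennreal (1 / card {\<sigma>. \<sigma> permutes {1..i}}) * emeasure (\<kappa> (coordinate_action i \<sigma> x)) A"
    have "emeasure (symmetrization i \<kappa> (coordinate_action i \<tau> x)) A = (\<Sum>\<sigma>\<in>{\<sigma>. \<sigma> permutes {1..i}}. ?f (\<tau> \<circ> \<sigma>))"
      unfolding emeasure_symmetrization[OF \<kappa> x' A] by (intro sum.cong) (auto simp: coordinate_action_compose)
    also have "\<dots> = (\<Sum>\<sigma>\<in>{\<sigma>. \<sigma> permutes {1..i}}. ?f \<sigma>)"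
      by (rule setum_permutations_compose_left[OF \<tau>, symmetric])
    finally show "emeasure (symmetrization i \<kappa> (coordinate_action i \<tau> x)) A = emeasure (symmetrization i \<kappa> x) A"
      unfolding emeasure_symmetrization[OF \<kappa> x A] .
  qed (simp add: s x x')
  then show "symmetrization i \<kappa> (\<lambda>a\<in>{a. a \<subset> {1..i}}. x (\<tau> ` a)) = symmetrization i \<kappa> x"
    by (simp add: coordinate_action_def)
qed

lemma cond_law_symmetrization:
  assumes \<kappa>: "\<kappa> \<in> kernel_dom Z i \<rightarrow>\<^sub>M prob_algebra X" and \<eta>: "\<eta> \<in> M \<rightarrow>\<^sub>M kernel_dom Z i"
    and c: "\<And>\<sigma>. \<sigma> permutes {1..i} \<Longrightarrow> cond_law M \<eta> (kernel_dom Z i) Y X (\<lambda>x. \<kappa> (coordinate_action i \<sigma> x))"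
  shows "cond_law M \<eta> (kernel_dom Z i) Y X (symmetrization i \<kappa>)"
  unfolding cond_law_def
proof (intro conjI ballI symmetrization_measurable \<kappa>)
  fix A B assume A: "A \<in> sets X" and B[measurable]: "B \<in> sets (kernel_dom Z i)"
  let ?S = "{\<sigma>. \<sigma> permutes {1..i}}"
  let ?m = "emeasure M (Y -` A \<inter> \<eta> -` B \<inter> space M)"
  let ?f = "\<lambda>\<sigma> \<omega>. indicator B (\<eta> \<omega>) * emeasure (\<kappa> (coordinate_action i \<sigma> (\<eta> \<omega>))) A"
  note [measurable] = \<eta>
  have f[measurable]: "?f \<sigma> \<in> borel_measurable M" if "\<sigma> \<in> ?S" for \<sigma>
  proof -
    have "(\<lambda>x. emeasure (\<kappa> (coordinate_action i \<sigma> x)) A) \<in> borel_measurable (kernel_dom Z i)"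
      by (rule measurable_compose[OF coordinate_action_measurable[OF CollectD[OF that]]
            measurable_emeasure_kernel[OF measurable_prob_algebraD[OF \<kappa>] A]])
    from measurable_compose[OF \<eta> this] show ?thesis by simp
  qed
  have "(\<integral>\<^sup>+\<omega>. indicator B (\<eta> \<omega>) * emeasure (symmetrization i \<kappa> (\<eta> \<omega>)) A \<partial>M)
      = (\<integral>\<^sup>+\<omega>. (\<Sum>\<sigma>\<in>?S. ennreal (1 / card ?S) * ?f \<sigma> \<omega>) \<partial>M)"
    using measurable_space[OF \<eta>]
    by (intro nn_integral_cong) (auto simp: emeasure_symmetrization[OF \<kappa> _ A] sum_distrib_left mult_ac)
  also have "\<dots> = (\<Sum>\<sigma>\<in>?S. ennreal (1 / card ?S) * (\<integral>\<^sup>+\<omega>. ?f \<sigma> \<omega> \<partial>M))"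
    by (subst nn_integral_sum) (auto intro!: sum.cong nn_integral_cmult f borel_measurable_times)
  also have "\<dots> = (\<Sum>\<sigma>\<in>?S. ennreal (1 / card ?S) * ?m)"
    using c A B by (intro sum.cong) (auto simp: cond_law_def)
  also have "\<dots> = ennreal (real (card ?S) * (1 / card ?S)) * ?m"
    by (subst ennreal_mult) (auto simp: ennreal_of_nat_eq_real_of_nat mult_ac)
  also have "real (card ?S) * (1 / card ?S) = 1"
  proof -
    have "card ?S \<noteq> 0" using permutations_finite_nonempty[of i] by (simp only: card_eq_0_iff simp_thms)
    then show ?thesis by simp
  qed
  also have "ennreal 1 * ?m = ?m" by simp
  finally show "?m = (\<integral>\<^sup>+\<omega>. indicator B (\<eta> \<omega>) * emeasure (symmetrization i \<kappa> (\<eta> \<omega>)) A \<partial>M)" by simp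
qed

section \<open>Changing the conditioning variable\<close>

lemma cond_law_kernel_measurable:
  assumes "cond_law M \<eta> N Y L \<kappa>" "A \<in> sets L"
  shows "(\<lambda>y. emeasure (\<kappa> y) A) \<in> borel_measurable N"
  using assms measurable_emeasure_kernel[OF measurable_prob_algebraD] by (auto simp: cond_law_def)

lemma cond_law_measure_preserving:
  assumes c: "cond_law M \<eta> N Y L \<kappa>" and [measurable]: "Y \<in> M \<rightarrow>\<^sub>M L" "\<eta> \<in> M \<rightarrow>\<^sub>M N"
    and t[measurable]: "t \<in> M \<rightarrow>\<^sub>M M" and pres: "distr M M t = M"
    and eq: "\<And>\<omega>. \<omega> \<in> space M \<Longrightarrow> \<eta>' \<omega> = \<eta> (t \<omega>)" "\<And>\<omega>. \<omega> \<in> space M \<Longrightarrow> Y' \<omega> = Y (t \<omega>)"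
  shows "cond_law M \<eta>' N Y' L \<kappa>"
  unfolding cond_law_def
proof (intro conjI ballI)
  show "\<kappa> \<in> N \<rightarrow>\<^sub>M prob_algebra L" using c by (simp add: cond_law_def)
  fix A B assume [measurable]: "A \<in> sets L" "B \<in> sets N"
  note [measurable] = measurable_compose[OF \<open>\<eta> \<in> M \<rightarrow>\<^sub>M N\<close> cond_law_kernel_measurable[OF c \<open>A \<in> sets L\<close>]]
  have "Y' -` A \<inter> \<eta>' -` B \<inter> space M = t -` (Y -` A \<inter> \<eta> -` B \<inter> space M) \<inter> space M"
    using measurable_space[OF t] by (auto simp: eq)
  then have "emeasure M (Y' -` A \<inter> \<eta>' -` B \<inter> space M) = emeasure (distr M M t) (Y -` A \<inter> \<eta> -` B \<inter> space M)"
  proof -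
    have "Y -` A \<inter> \<eta> -` B \<inter> space M = (Y -` A \<inter> space M) \<inter> (\<eta> -` B \<inter> space M)" by auto
    also have "\<dots> \<in> sets M" by measurable
    finally show "Y' -` A \<inter> \<eta>' -` B \<inter> space M = t -` (Y -` A \<inter> \<eta> -` B \<inter> space M) \<inter> space M \<Longrightarrow> ?thesis"
      by (simp add: emeasure_distr)
  qed
  also have "\<dots> = (\<integral>\<^sup>+\<omega>. indicator B (\<eta> \<omega>) * emeasure (\<kappa> (\<eta> \<omega>)) A \<partial>distr M M t)"
    using c unfolding cond_law_def pres by simp
  also have "\<dots> = (\<integral>\<^sup>+\<omega>. indicator B (\<eta> (t \<omega>)) * emeasure (\<kappa> (\<eta> (t \<omega>))) A \<partial>M)"
    by (subst nn_integral_distr) auto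
  also have "\<dots> = (\<integral>\<^sup>+\<omega>. indicator B (\<eta>' \<omega>) * emeasure (\<kappa> (\<eta>' \<omega>)) A \<partial>M)"
    by (intro nn_integral_cong) (simp add: eq)
  finally show "emeasure M (Y' -` A \<inter> \<eta>' -` B \<inter> space M) =
    (\<integral>\<^sup>+\<omega>. indicator B (\<eta>' \<omega>) * emeasure (\<kappa> (\<eta>' \<omega>)) A \<partial>M)" .
qed

text \<open>An invertible relabelling \<open>\<rho>\<close> of the conditioning variable carries the same information.\<close>

lemma cond_law_relabel:
  assumes c: "cond_law M \<eta>' N Y L \<kappa>" and \<eta>: "\<eta> \<in> M \<rightarrow>\<^sub>M N"
    and \<rho>: "\<rho> \<in> N \<rightarrow>\<^sub>M N" and \<rho>': "\<rho>' \<in> N \<rightarrow>\<^sub>M N" and inv: "\<And>y. y \<in> space N \<Longrightarrow> \<rho>' (\<rho> y) = y"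
    and eq: "\<And>\<omega>. \<omega> \<in> space M \<Longrightarrow> \<eta>' \<omega> = \<rho> (\<eta> \<omega>)"
  shows "cond_law M \<eta> N Y L (\<lambda>y. \<kappa> (\<rho> y))"
  unfolding cond_law_def
proof (intro conjI ballI)
  have \<kappa>: "\<kappa> \<in> N \<rightarrow>\<^sub>M prob_algebra L" using c by (simp add: cond_law_def)
  show "(\<lambda>y. \<kappa> (\<rho> y)) \<in> N \<rightarrow>\<^sub>M prob_algebra L" using \<rho> \<kappa> by (rule measurable_compose)
  fix A B assume A: "A \<in> sets L" and B: "B \<in> sets N"
  let ?B = "\<rho>' -` B \<inter> space N"
  have B': "?B \<in> sets N" using \<rho>' B by (rule measurable_sets)
  have iff: "\<eta>' \<omega> \<in> ?B \<longleftrightarrow> \<eta> \<omega> \<in> B" if "\<omega> \<in> space M" for \<omega>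
    using measurable_space[OF \<eta> that] measurable_space[OF \<rho>] by (simp add: eq that inv)
  then have "Y -` A \<inter> \<eta> -` B \<inter> space M = Y -` A \<inter> \<eta>' -` ?B \<inter> space M" by blast
  then have "emeasure M (Y -` A \<inter> \<eta> -` B \<inter> space M) =
      (\<integral>\<^sup>+\<omega>. indicator ?B (\<eta>' \<omega>) * emeasure (\<kappa> (\<eta>' \<omega>)) A \<partial>M)"
    using c A B' unfolding cond_law_def by (simp only:)
  also have "\<dots> = (\<integral>\<^sup>+\<omega>. indicator B (\<eta> \<omega>) * emeasure (\<kappa> (\<rho> (\<eta> \<omega>))) A \<partial>M)"
    using iff by (intro nn_integral_cong) (simp add: indicator_def eq)
  finally show "emeasure M (Y -` A \<inter> \<eta> -` B \<inter> space M) =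
      (\<integral>\<^sup>+\<omega>. indicator B (\<eta> \<omega>) * emeasure (\<kappa> (\<rho> (\<eta> \<omega>))) A \<partial>M)" .
qed

text \<open>Under the integral, the indicator of an event about \<open>Y\<close> may be replaced by its conditional
  probability, as long as all other factors are functions of \<open>\<eta>\<close>.\<close>

lemma cond_law_nn_integral:
  assumes c: "cond_law M \<eta> N Y L \<kappa>" and [measurable]: "Y \<in> M \<rightarrow>\<^sub>M L" "\<eta> \<in> M \<rightarrow>\<^sub>M N" "A \<in> sets L"
    and g[measurable]: "g \<in> borel_measurable N"
  shows "(\<integral>\<^sup>+\<omega>. indicator A (Y \<omega>) * g (\<eta> \<omega>) \<partial>M) = (\<integral>\<^sup>+\<omega>. emeasure (\<kappa> (\<eta> \<omega>)) A * g (\<eta> \<omega>) \<partial>M)"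
proof -
  note [measurable] = measurable_compose[OF \<open>\<eta> \<in> M \<rightarrow>\<^sub>M N\<close> cond_law_kernel_measurable[OF c \<open>A \<in> sets L\<close>]]
  define M1 where "M1 = density M (\<lambda>\<omega>. indicator A (Y \<omega>))"
  define M2 where "M2 = density M (\<lambda>\<omega>. emeasure (\<kappa> (\<eta> \<omega>)) A)"
  have [measurable_cong]: "sets M1 = sets M" "sets M2 = sets M" by (auto simp: M1_def M2_def)
  have "distr M1 N \<eta> = distr M2 N \<eta>"
  proof (rule measure_eqI)
    fix B assume "B \<in> sets (distr M1 N \<eta>)"
    then have [measurable]: "B \<in> sets N" by simp
    have "emeasure (distr M1 N \<eta>) B = (\<integral>\<^sup>+\<omega>. indicator (Y -` A \<inter> \<eta> -` B \<inter> space M) \<omega> \<partial>M)"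
      unfolding M1_def by (subst emeasure_distr)
        (auto simp: emeasure_density simp del: nn_integral_indicator split: split_indicator intro!: nn_integral_cong)
    also have "\<dots> = emeasure M (Y -` A \<inter> \<eta> -` B \<inter> space M)"
    proof (rule nn_integral_indicator)
      have "Y -` A \<inter> \<eta> -` B \<inter> space M = (Y -` A \<inter> space M) \<inter> (\<eta> -` B \<inter> space M)" by auto
      also have "\<dots> \<in> sets M" by measurable
      finally show "Y -` A \<inter> \<eta> -` B \<inter> space M \<in> sets M" .
    qed
    also have "\<dots> = (\<integral>\<^sup>+\<omega>. indicator B (\<eta> \<omega>) * emeasure (\<kappa> (\<eta> \<omega>)) A \<partial>M)"
      using c by (simp add: cond_law_def)
    also have "\<dots> = emeasure (distr M2 N \<eta>) B"
      unfolding M2_def by (subst emeasure_distr) (auto simp: emeasure_density split: split_indicator intro!: nn_integral_cong)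
    finally show "emeasure (distr M1 N \<eta>) B = emeasure (distr M2 N \<eta>) B" .
  qed simp
  then have "(\<integral>\<^sup>+y. g y \<partial>distr M1 N \<eta>) = (\<integral>\<^sup>+y. g y \<partial>distr M2 N \<eta>)" by simp
  then have "(\<integral>\<^sup>+\<omega>. g (\<eta> \<omega>) \<partial>M1) = (\<integral>\<^sup>+\<omega>. g (\<eta> \<omega>) \<partial>M2)"
    by (simp add: nn_integral_distr)
  then show ?thesis unfolding M1_def M2_def by (simp add: nn_integral_density)
qed

section \<open>Node variables from a reserve of vertices\<close>

lemma subsets_upto_iff: "u \<in> subsets_upto S i \<longleftrightarrow> u \<subseteq> S \<and> finite u \<and> card u \<le> i"
  by (auto simp: subsets_upto_def nsets_def)

text \<open>The vertices of the hypergraph are split into a copy \<open>a ` S\<close> of \<open>S\<close> and the infinite reserve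
  \<open>T\<close>. The coding \<open>\<phi>\<close> of colours, followed by \<open>code\<close>, turns a sequence of colours into one real
  number.\<close>

locale exchangeable_array =
  fixes S :: "'s set" and k :: nat and K :: "'c measure" and \<mu> :: "('s set \<Rightarrow> 'c) measure"
    and a :: "'s \<Rightarrow> 's" and T :: "'s set" and \<phi> :: "'c \<Rightarrow> real"
    and code :: "(nat \<Rightarrow> real) \<Rightarrow> real" and dec :: "real \<Rightarrow> nat \<Rightarrow> real"
  assumes countable: "countable S"
    and exchangeable: "exchangeable_hypergraph S k K \<mu>"
    and inj_a: "inj_on a S" and a_S: "a ` S \<subseteq> S"
    and T_def: "T = S - a ` S" and infinite_T: "infinite T"
    and \<phi>_measurable: "\<phi> \<in> borel_measurable K"
    and code: "real_coding borel code dec"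
begin

text \<open>An enumeration, possibly with repetitions, of the \<open>j\<close>-element subsets of the reserve; for
  \<open>j = 0\<close> it is constantly the empty set.\<close>

definition reserve :: "nat \<Rightarrow> nat \<Rightarrow> 's set" where
  "reserve j n = from_nat_into (nsets T j) n"

text \<open>The node variable at \<open>u\<close> comes in two forms: \<open>Y u\<close> as a sequence of reals, whose
  finite-dimensional events are accessible, and \<open>X u\<close> as a single real, which is the form the
  recipe uses.\<close>

definition Y :: "'s set \<Rightarrow> ('s set \<Rightarrow> 'c) \<Rightarrow> nat \<Rightarrow> real" where
  "Y u \<omega> n = \<phi> (\<omega> (a ` u \<union> reserve (k - card u) n))"

definition X :: "'s set \<Rightarrow> ('s set \<Rightarrow> 'c) \<Rightarrow> real" where
  "X u \<omega> = code (Y u \<omega>)"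

abbreviation Zr :: "nat \<Rightarrow> real measure" where
  "Zr \<equiv> (\<lambda>_. borel)"

abbreviation proper :: "(nat \<Rightarrow> 's) \<Rightarrow> 's set \<Rightarrow> ('s set \<Rightarrow> 'c) \<Rightarrow> nat set \<Rightarrow> real" where
  "proper f u \<omega> \<equiv> pullback f u (\<lambda>v. X v \<omega>)"

lemma sets_\<mu>: "sets \<mu> = sets (hypergraph_space S k K)" and prob_\<mu>: "prob_space \<mu>"
  using exchangeable by (auto simp: exchangeable_hypergraph_def space_prob_algebra)

sublocale prob_space \<mu> by (rule prob_\<mu>)

lemma code_measurable[measurable]: "code \<in> borel_measurable borel"
  and dec_measurable[measurable]: "dec \<in> borel_measurable borel" and dec_code[simp]: "dec (code s) = s"
  using code by (auto simp: real_coding_def)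

lemma T_S: "T \<subseteq> S" "T \<inter> a ` S = {}"
  by (auto simp: T_def)

lemma countable_nsets_T: "countable (nsets T j)"
  by (rule countable_subset[OF _ countable_Collect_finite_subset[OF countable_subset[OF T_S(1) countable]]])
    (auto simp: nsets_def)

lemma reserve_in: "reserve j n \<in> nsets T j"
proof -
  obtain w where "finite w" "card w = j" "w \<subseteq> T" using infinite_arbitrarily_large[OF infinite_T] by blast
  then have "nsets T j \<noteq> {}" by (auto simp: nsets_def)
  then show ?thesis unfolding reserve_def by (rule from_nat_into)
qed

lemma reserve_index: "w \<in> nsets T j \<Longrightarrow> reserve j (to_nat_on (nsets T j) w) = w"
  unfolding reserve_def by (rule from_nat_into_to_nat_on[OF countable_nsets_T])

lemma edge_in:
  assumes "u \<in> subsets_upto S k" shows "a ` u \<union> reserve (k - card u) n \<in> nsets S k"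
proof -
  have u: "u \<subseteq> S" "finite u" "card u \<le> k" using assms by (auto simp: subsets_upto_iff)
  have r: "reserve (k - card u) n \<subseteq> T" "finite (reserve (k - card u) n)" "card (reserve (k - card u) n) = k - card u"
    using reserve_in[of "k - card u" n] by (auto simp: nsets_def)
  have "card (a ` u) = card u" using card_image[OF inj_on_subset[OF inj_a u(1)]] .
  moreover have "a ` u \<inter> reserve (k - card u) n = {}" using T_S r u by blast
  ultimately have "card (a ` u \<union> reserve (k - card u) n) = k" using u r by (simp add: card_Un_disjoint)
  moreover have "a ` u \<subseteq> S" using image_mono[OF u(1)] a_S by (rule order_trans)
  moreover have "reserve (k - card u) n \<subseteq> S" using r T_S by blast
  ultimately show ?thesis using u r by (simp add: nsets_def)
qed

lemma coordinate_measurable: "e \<in> nsets S k \<Longrightarrow> (\<lambda>\<omega>. \<omega> e) \<in> \<mu> \<rightarrow>\<^sub>M K"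
  by (subst measurable_cong_sets[OF sets_\<mu> refl]) (auto simp: hypergraph_space_def)

lemma Y_measurable: "u \<in> subsets_upto S k \<Longrightarrow> Y u \<in> borel_measurable \<mu>"
  by (rule measurable_coordinatewise_then_product)
    (simp add: Y_def measurable_compose[OF coordinate_measurable[OF edge_in] \<phi>_measurable])

lemma X_measurable: "u \<in> subsets_upto S k \<Longrightarrow> X u \<in> borel_measurable \<mu>"
  unfolding X_def by (rule measurable_compose[OF Y_measurable code_measurable])

lemma X_restrict_measurable:
  "V \<subseteq> subsets_upto S k \<Longrightarrow> (\<lambda>\<omega>. \<lambda>v\<in>V. X v \<omega>) \<in> \<mu> \<rightarrow>\<^sub>M (\<Pi>\<^sub>M v\<in>V. borel)"
  by (rule measurable_restrict) (auto intro: X_measurable)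

lemma nsets_subsets_upto: "u \<in> nsets S i \<Longrightarrow> i \<le> k \<Longrightarrow> u \<in> subsets_upto S k"
  by (auto simp: subsets_upto_iff nsets_def)

lemma image_proper_subset:
  assumes u: "u \<in> nsets S i" and f: "bij_betw f {1..i} u" and b: "b \<subset> {1..i}"
  shows "f ` b \<subset> u" "f ` b \<in> subsets_upto S i"
proof -
  have inj: "inj_on f {1..i}" and im: "f ` {1..i} = u" using f by (auto simp: bij_betw_def)
  show *: "f ` b \<subset> u" using image_strict_mono[OF inj b] im by simp
  then show "f ` b \<in> subsets_upto S i" using u psubset_card_mono[OF _ *] by (auto simp: subsets_upto_iff nsets_def finite_subset)
qed

lemma pullback_measurable:
  assumes u: "u \<in> nsets S i" and f: "bij_betw f {1..i} u" and V: "\<And>v. v \<subset> u \<Longrightarrow> v \<in> V"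
  shows "pullback f u \<in> (\<Pi>\<^sub>M v\<in>V. borel) \<rightarrow>\<^sub>M kernel_dom Zr i"
proof -
  have cu: "card u = i" using u by (simp add: nsets_def)
  show ?thesis unfolding kernel_dom_def pullback_def cu
    by (rule measurable_restrict) (use image_proper_subset[OF u f] V in \<open>auto intro!: measurable_component_singleton\<close>)
qed

lemma proper_measurable:
  assumes u: "u \<in> nsets S i" and f: "bij_betw f {1..i} u" and i: "i \<le> k"
  shows "proper f u \<in> \<mu> \<rightarrow>\<^sub>M kernel_dom Zr i"
proof -
  have cu: "card u = i" using u by (simp add: nsets_def)
  have "X (f ` b) \<in> borel_measurable \<mu>" if "b \<subset> {1..i}" for b
    using image_proper_subset(2)[OF u f that] i by (intro X_measurable) (auto simp: subsets_upto_iff)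
  then show ?thesis unfolding kernel_dom_def pullback_def cu
    by (intro measurable_restrict) auto
qed

lemma vertex_action_preserving:
  assumes "inj_on p S" "p ` S \<subseteq> S"
  shows "vertex_action S k p \<in> \<mu> \<rightarrow>\<^sub>M \<mu>" "distr \<mu> \<mu> (vertex_action S k p) = \<mu>"
proof -
  show "vertex_action S k p \<in> \<mu> \<rightarrow>\<^sub>M \<mu>"
    using vertex_action_measurable[OF assms, of k K] by (simp add: measurable_cong_sets[OF sets_\<mu> sets_\<mu>])
  have "distr \<mu> \<mu> (vertex_action S k p) = distr \<mu> (hypergraph_space S k K) (vertex_action S k p)"
    by (rule distr_cong) (auto simp: sets_\<mu>)
  also have "\<dots> = \<mu>" by (rule exchangeable_injection[OF exchangeable assms])
  finally show "distr \<mu> \<mu> (vertex_action S k p) = \<mu>" .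
qed

lemma Y_vertex_action:
  "u \<in> subsets_upto S k \<Longrightarrow> Y u (vertex_action S k p \<omega>) n = \<phi> (\<omega> (p ` (a ` u \<union> reserve (k - card u) n)))"
  using edge_in by (simp add: Y_def vertex_action_def)

text \<open>A relabelling \<open>q\<close> of the vertices acts on the node variables through the injection that moves
  the copy \<open>a ` S\<close> according to \<open>q\<close> and fixes the reserve.\<close>

lemma relabelling_exists:
  assumes q: "inj_on q S" "q ` S \<subseteq> S"
  shows "\<exists>p. inj_on p S \<and> p ` S \<subseteq> S \<and> (\<forall>u\<in>subsets_upto S k. \<forall>\<omega>. Y u (vertex_action S k p \<omega>) = Y (q ` u) \<omega>)"
proof -
  define p where "p x = (if x \<in> a ` S then a (q (inv_into S a x)) else x)" for x
  have pa: "p (a x) = a (q x)" if "x \<in> S" for x using that inj_a by (simp add: p_def)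
  have pT: "p x = x" if "x \<in> T" for x using that T_S by (auto simp: p_def)
  have ST: "a ` S \<union> T = S" using a_S T_def by auto
  have 1: "inj_on p (a ` S)"
  proof (rule inj_onI, safe)
    fix x y assume xy: "x \<in> S" "y \<in> S" "p (a x) = p (a y)"
    then have "a (q x) = a (q y)" by (simp add: pa)
    then have "q x = q y" by (rule inj_onD[OF inj_a]) (use xy q(2) in auto)
    then have "x = y" using xy(1,2) by (rule inj_onD[OF q(1)])
    then show "a x = a y" by simp
  qed
  have 2: "inj_on p T" by (rule inj_onI) (simp add: pT)
  have 3: "p ` (a ` S) \<subseteq> a ` S" "p ` T = T" using pa pT q(2) by auto
  have "inj_on p (a ` S \<union> T)"
    using 1 2 3 T_S(2) by (subst inj_on_Un) blast
  then have "inj_on p S" unfolding ST .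
  moreover
  have "p ` (a ` S \<union> T) \<subseteq> a ` S \<union> T" using 3 by blast
  then have "p ` S \<subseteq> S" unfolding ST .
  moreover have "Y u (vertex_action S k p \<omega>) = Y (q ` u) \<omega>" if u: "u \<in> subsets_upto S k" for u \<omega>
  proof
    fix n
    have uS: "u \<subseteq> S" using u by (simp add: subsets_upto_iff)
    have "card (q ` u) = card u" using card_image[OF inj_on_subset[OF q(1) uS]] .
    moreover have "p ` a ` u = a ` q ` u" using uS pa by (force simp: image_image)
    moreover have "p ` reserve j n = reserve j n" for j using pT reserve_in[of j n] by (force simp: nsets_def)
    ultimately show "Y u (vertex_action S k p \<omega>) n = Y (q ` u) \<omega> n"
      unfolding Y_vertex_action[OF u] by (simp add: Y_def image_Un)
  qed
  ultimately show ?thesis by blast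
qed

text \<open>An injection of \<open>S\<close> extending \<open>f' \<circ> inv f\<close> carries the joint law at \<open>u\<close> to the joint law at
  \<open>u'\<close>.\<close>

lemma cond_law_any_enumeration:
  assumes i: "i \<le> k" and u: "u \<in> nsets S i" and f: "bij_betw f {1..i} u"
    and u': "u' \<in> nsets S i" and f': "bij_betw f' {1..i} u'"
    and c: "cond_law \<mu> (proper f u) (kernel_dom Zr i) (Y u) borel \<kappa>"
  shows "cond_law \<mu> (proper f' u') (kernel_dom Zr i) (Y u') borel \<kappa>"
proof -
  have uS: "u \<subseteq> S" "finite u" "u' \<subseteq> S" "card u = i" "card u' = i" using u u' by (auto simp: nsets_def)
  have S_inf: "infinite S" using infinite_T T_S finite_subset by blast
  let ?h = "f' \<circ> the_inv_into {1..i} f"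
  have h: "bij_betw ?h u u'" using bij_betw_the_inv_into[OF f] f' by (rule bij_betw_trans)
  obtain q where q: "inj_on q (S \<union> u)" "\<forall>x\<in>u. q x = ?h x" "\<forall>x\<in>S - u. q x \<in> S - ?h ` u"
    using injection_extends_into_infinite[OF countable uS(2) S_inf, of ?h] h by (auto simp: bij_betw_def)
  have q1: "inj_on q S" using q(1) by (rule inj_on_subset) auto
  have q2: "q ` S \<subseteq> S"
  proof
    fix y assume "y \<in> q ` S"
    then obtain x where "x \<in> S" "y = q x" by auto
    then show "y \<in> S" using q bij_betwE[OF h] uS by (cases "x \<in> u") auto
  qed
  have qf: "q (f j) = f' j" if "j \<in> {1..i}" for j
    using q(2) bij_betwE[OF f] that the_inv_into_f_f[of f "{1..i}"] f by (auto simp: bij_betw_def)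
  have qfb: "q ` f ` b = f' ` b" if "b \<subseteq> {1..i}" for b
    using that qf unfolding image_image by (intro image_cong) auto
  obtain p where p: "inj_on p S" "p ` S \<subseteq> S"
    and Yp: "\<And>v \<omega>. v \<in> subsets_upto S k \<Longrightarrow> Y v (vertex_action S k p \<omega>) = Y (q ` v) \<omega>"
    using relabelling_exists[OF q1 q2] by blast
  show ?thesis
  proof (rule cond_law_measure_preserving[OF c _ _ vertex_action_preserving[OF p]])
    show "Y u \<in> borel_measurable \<mu>" using u i by (intro Y_measurable nsets_subsets_upto)
    show "proper f u \<in> \<mu> \<rightarrow>\<^sub>M kernel_dom Zr i" using u f i by (rule proper_measurable)
    fix \<omega>
    show "proper f' u' \<omega> = proper f u (vertex_action S k p \<omega>)"
      unfolding pullback_def uS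
    proof (rule restrict_ext)
      fix b assume "b \<in> {a. a \<subset> {1..i}}"
      then have b: "b \<subset> {1..i}" by simp
      have "f ` b \<in> subsets_upto S k" using image_proper_subset(2)[OF u f b] i by (auto simp: subsets_upto_iff)
      then show "X (f' ` b) \<omega> = X (f ` b) (vertex_action S k p \<omega>)"
        using qfb[of b] b by (simp add: X_def Yp)
    qed
    have "q ` u = u'" using qfb[of "{1..i}"] f f' by (simp add: bij_betw_def)
    then show "Y u' \<omega> = Y u (vertex_action S k p \<omega>)" using u i by (simp add: Yp nsets_subsets_upto)
  qed
qed

text \<open>Take the conditional law at one set \<open>u0\<close> with one enumeration; it serves every set and every
  enumeration. In particular it may be composed with any permutation of \<open>{1..i}\<close> and remains a
  version, and so does the average of all these.\<close>

lemma symmetric_conditional_kernel: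
  assumes i: "i \<le> k"
  shows "\<exists>\<kappa>. symmetric_kernel Zr i borel \<kappa> \<and>
    (\<forall>u\<in>nsets S i. \<forall>f. bij_betw f {1..i} u \<longrightarrow> cond_law \<mu> (proper f u) (kernel_dom Zr i) (Y u) borel \<kappa>)"
proof -
  have S_inf: "infinite S" using infinite_T T_S finite_subset by blast
  then obtain u0 where "finite u0" "card u0 = i" "u0 \<subseteq> S" using infinite_arbitrarily_large by blast
  then have u0: "u0 \<in> nsets S i" by (auto simp: nsets_def)
  have "card {1..i} = card u0" using \<open>card u0 = i\<close> by simp
  then obtain f0 where f0: "bij_betw f0 {1..i} u0"
    using \<open>finite u0\<close> finite_same_card_bij[of "{1..i}" u0] by blast
  obtain \<phi>' r' where "real_coding (borel :: (nat \<Rightarrow> real) measure) \<phi>' r'" using sequence_real_coding by blast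
  from cond_law_exists[OF this Y_measurable proper_measurable[OF u0 f0 i]] u0 i
  obtain \<kappa> where "cond_law \<mu> (proper f0 u0) (kernel_dom Zr i) (Y u0) borel \<kappa>"
    using nsets_subsets_upto by blast
  then have c: "cond_law \<mu> (proper f u) (kernel_dom Zr i) (Y u) borel \<kappa>" if "u \<in> nsets S i" "bij_betw f {1..i} u" for u f
    using cond_law_any_enumeration[OF i u0 f0] that by blast
  have \<kappa>: "\<kappa> \<in> kernel_dom Zr i \<rightarrow>\<^sub>M prob_algebra borel" using c[OF u0 f0] by (simp add: cond_law_def)
  have "cond_law \<mu> (proper f u) (kernel_dom Zr i) (Y u) borel (symmetrization i \<kappa>)"
    if u: "u \<in> nsets S i" and f: "bij_betw f {1..i} u" for u f
  proof (rule cond_law_symmetrization[OF \<kappa> proper_measurable[OF u f i]])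
    fix \<sigma> assume \<sigma>: "\<sigma> permutes {1..i}"
    have cu: "card u = i" using u by (simp add: nsets_def)
    have f\<sigma>: "bij_betw (f \<circ> \<sigma>) {1..i} u" using permutes_imp_bij[OF \<sigma>] f by (rule bij_betw_trans)
    show "cond_law \<mu> (proper f u) (kernel_dom Zr i) (Y u) borel (\<lambda>x. \<kappa> (coordinate_action i \<sigma> x))"
    proof (rule cond_law_relabel[OF c[OF u f\<sigma>] proper_measurable[OF u f i]])
      show "coordinate_action i \<sigma> \<in> kernel_dom Zr i \<rightarrow>\<^sub>M kernel_dom Zr i" using \<sigma> by (rule coordinate_action_measurable)
      show "coordinate_action i (inv \<sigma>) \<in> kernel_dom Zr i \<rightarrow>\<^sub>M kernel_dom Zr i"
        using permutes_inv[OF \<sigma>] by (rule coordinate_action_measurable)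
      show "coordinate_action i (inv \<sigma>) (coordinate_action i \<sigma> y) = y" if "y \<in> space (kernel_dom Zr i)" for y
        unfolding coordinate_action_compose[OF permutes_inv[OF \<sigma>]] permutes_inv_o(1)[OF \<sigma>]
        using that by (auto simp: coordinate_action_def kernel_dom_def space_PiM PiE_iff extensional_def)
      show "proper (f \<circ> \<sigma>) u \<omega> = coordinate_action i \<sigma> (proper f u \<omega>)" for \<omega>
        unfolding pullback_def coordinate_action_def cu using permutes_psubset[OF \<sigma>]
        by (intro restrict_ext) (simp add: image_comp)
    qed
  qed
  then show ?thesis using symmetric_kernel_symmetrization[OF \<kappa>] by blast
qed

end

section \<open>Conditional independence of the nodes\<close>

lemma sets_sequence_boxes:
  "sets (borel :: (nat \<Rightarrow> real) measure) = sigma_sets (space borel) (prod_algebra UNIV (\<lambda>_. borel :: real measure))"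
proof -
  have "sets (borel :: (nat \<Rightarrow> real) measure) = sets (Pi\<^sub>M UNIV (\<lambda>_. borel :: real measure))"
    by (rule sets_PiM_equal_borel[symmetric])
  then show ?thesis by (simp add: sets_PiM)
qed

lemma cond_prob_fun_of_cond_law:
  assumes c: "cond_law M \<eta> N W L \<kappa>" and A: "A \<in> sets L" and \<eta>: "\<eta> \<in> M \<rightarrow>\<^sub>M N"
  shows "cond_prob_fun M (W -` A \<inter> space M) \<eta> N (\<lambda>y. min 1 (measure (\<kappa> y) A))"
  unfolding cond_prob_fun_def
proof (intro conjI allI ballI)
  have \<kappa>: "\<kappa> \<in> N \<rightarrow>\<^sub>M prob_algebra L" using c by (simp add: cond_law_def)
  have [measurable]: "(\<lambda>y. measure (\<kappa> y) A) \<in> borel_measurable N"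
    using cond_law_kernel_measurable[OF c A] unfolding measure_def by measurable
  show "(\<lambda>y. min 1 (measure (\<kappa> y) A)) \<in> borel_measurable N" by measurable
  fix B assume B: "B \<in> sets N"
  have "W -` A \<inter> space M \<inter> \<eta> -` B \<inter> space M = W -` A \<inter> \<eta> -` B \<inter> space M" by auto
  then have "emeasure M (W -` A \<inter> space M \<inter> \<eta> -` B \<inter> space M) =
      (\<integral>\<^sup>+\<omega>. indicator B (\<eta> \<omega>) * emeasure (\<kappa> (\<eta> \<omega>)) A \<partial>M)"
    using c A B unfolding cond_law_def by (simp only:)
  also have "\<dots> = (\<integral>\<^sup>+\<omega>. indicator B (\<eta> \<omega>) * ennreal (min 1 (measure (\<kappa> (\<eta> \<omega>)) A)) \<partial>M)"
  proof (intro nn_integral_cong)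
    fix \<omega> assume "\<omega> \<in> space M"
    then have "prob_space (\<kappa> (\<eta> \<omega>))"
      using measurable_space[OF \<kappa> measurable_space[OF \<eta>]] by (simp add: space_prob_algebra)
    then interpret P: prob_space "\<kappa> (\<eta> \<omega>)" .
    show "indicator B (\<eta> \<omega>) * emeasure (\<kappa> (\<eta> \<omega>)) A = indicator B (\<eta> \<omega>) * ennreal (min 1 (measure (\<kappa> (\<eta> \<omega>)) A))"
      by (simp add: P.emeasure_eq_measure min_absorb2)
  qed
  finally show "emeasure M (W -` A \<inter> space M \<inter> \<eta> -` B \<inter> space M) =
      (\<integral>\<^sup>+\<omega>. indicator B (\<eta> \<omega>) * ennreal (min 1 (measure (\<kappa> (\<eta> \<omega>)) A)) \<partial>M)" .
qed (auto simp: measure_nonneg)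

context exchangeable_array
begin

text \<open>This injection keeps everything that an event about finitely many entries of \<open>Y u\<close> can see and
  pushes the rest of the hypergraph into the reserve.\<close>

lemma compression_exists:
  assumes u: "u \<in> subsets_upto S k" and T0: "finite T0" "T0 \<subseteq> T"
  shows "\<exists>p. inj_on p S \<and> p ` S \<subseteq> S \<and> (\<forall>x\<in>a ` u \<union> T0. p x = x) \<and> (\<forall>x\<in>S. x \<notin> a ` u \<longrightarrow> p x \<in> T)"
proof -
  let ?U = "a ` u \<union> T0"
  have uS: "u \<subseteq> S" "finite u" using u by (auto simp: subsets_upto_iff)
  then have U: "finite ?U" "?U \<subseteq> S" using T0 T_S(1) order_trans[OF image_mono[OF uS(1)] a_S] by auto
  obtain p where p: "inj_on p (S \<union> ?U)" "\<forall>x\<in>?U. p x = id x" "\<forall>x\<in>S - ?U. p x \<in> T - id ` ?U"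
    using injection_extends_into_infinite[OF countable U(1) infinite_T, of id] by auto
  have "inj_on p S" using p(1) by (rule inj_on_subset) auto
  moreover have T: "p x \<in> T" if "x \<in> S" "x \<notin> a ` u" for x
    using p(2,3) that T0(2) by (cases "x \<in> T0") auto
  moreover have "p ` S \<subseteq> S"
  proof
    fix y assume "y \<in> p ` S"
    then obtain x where "x \<in> S" "y = p x" by auto
    then show "y \<in> S" using p(2) T[of x] T_S(1) by (cases "x \<in> a ` u") auto
  qed
  ultimately show ?thesis using p(2) by auto
qed

text \<open>The conditional independence at the core of the theorem. By \<open>cond_lawI_generator\<close> only events
  about finitely many entries of \<open>Y u\<close> matter, and for these \<open>cond_prob_fun_transfer\<close> applies to
  the injection \<open>p\<close> of \<open>compression_exists\<close>. The set \<open>e v n\<close> is the edge behind the \<open>n\<close>-th entry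
  of \<open>Y v\<close>. If \<open>v \<noteq> u\<close> then \<open>p\<close> maps it to \<open>a ` (v \<inter> u) \<union> w\<close> with \<open>w \<subseteq> T\<close>, an edge that occurs in
  \<open>Y (v \<inter> u)\<close>; so the decoded \<open>X (v \<inter> u)\<close> provides its colour.\<close>

lemma cond_law_other_coordinates:
  assumes i: "i \<le> k" and u: "u \<in> nsets S i" and f: "bij_betw f {1..i} u"
    and c: "cond_law \<mu> (proper f u) (kernel_dom Zr i) (Y u) borel \<kappa>"
  shows "cond_law \<mu> (\<lambda>\<omega>. \<lambda>v\<in>subsets_upto S i - {u}. X v \<omega>) (\<Pi>\<^sub>M v\<in>subsets_upto S i - {u}. borel)
    (Y u) borel (\<lambda>z. \<kappa> (pullback f u z))"
proof -
  define V where "V = subsets_upto S i - {u}"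
  define N' where "N' = (\<Pi>\<^sub>M v\<in>V. (borel :: real measure))"
  define \<zeta> where "\<zeta> \<omega> = (\<lambda>v\<in>V. X v \<omega>)" for \<omega>
  have uS: "u \<subseteq> S" "finite u" "card u = i" using u by (auto simp: nsets_def)
  have uk: "u \<in> subsets_upto S k" using nsets_subsets_upto[OF u i] .
  have Vk: "V \<subseteq> subsets_upto S k" using i by (auto simp: V_def subsets_upto_iff)
  have \<zeta>: "\<zeta> \<in> \<mu> \<rightarrow>\<^sub>M N'" unfolding \<zeta>_def N'_def by (rule X_restrict_measurable[OF Vk])
  have proper_V: "v \<in> V" if "v \<subset> u" for v
    using that uS psubset_card_mono[of u v] by (auto simp: V_def subsets_upto_iff finite_subset)
  have h: "pullback f u \<in> N' \<rightarrow>\<^sub>M kernel_dom Zr i"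
    unfolding N'_def by (rule pullback_measurable[OF u f]) (rule proper_V)
  have \<eta>: "proper f u \<in> \<mu> \<rightarrow>\<^sub>M kernel_dom Zr i" by (rule proper_measurable[OF u f i])
  have h\<zeta>: "proper f u \<omega> = pullback f u (\<zeta> \<omega>)" for \<omega>
    unfolding pullback_def uS
    by (intro restrict_ext) (use image_proper_subset(1)[OF u f] proper_V in \<open>auto simp: \<zeta>_def\<close>)
  have \<kappa>: "\<kappa> \<in> kernel_dom Zr i \<rightarrow>\<^sub>M prob_algebra borel" using c by (simp add: cond_law_def)
  have "cond_law \<mu> \<zeta> N' (Y u) borel (\<lambda>z. \<kappa> (pullback f u z))"
  proof (rule cond_lawI_generator[OF sets_sequence_boxes Int_stable_prod_algebra])
    show "prod_algebra UNIV (\<lambda>_. borel :: real measure) \<subseteq> Pow (space (borel :: (nat \<Rightarrow> real) measure))" by simp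
    show "Y u \<in> borel_measurable \<mu>" by (rule Y_measurable[OF uk])
    show "\<zeta> \<in> \<mu> \<rightarrow>\<^sub>M N'" by (rule \<zeta>)
    show "(\<lambda>z. \<kappa> (pullback f u z)) \<in> N' \<rightarrow>\<^sub>M prob_algebra borel" using h \<kappa> by (rule measurable_compose)
    fix A :: "(nat \<Rightarrow> real) set" and B assume A: "A \<in> prod_algebra UNIV (\<lambda>_. borel)" and B: "B \<in> sets N'"
    have Ab: "A \<in> sets borel" unfolding sets_sequence_boxes using A by (rule sigma_sets.Basic)
    obtain J E where J: "A = prod_emb UNIV (\<lambda>_. borel :: real measure) J (Pi\<^sub>E J E)" "finite J"
      using A by (rule prod_algebraE) blast
    have A_iff: "s \<in> A \<longleftrightarrow> (\<forall>j\<in>J. s j \<in> E j)" for s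
      unfolding J(1) by (subst prod_emb_box) (auto simp: space_PiM)
    define T0 where "T0 = (\<Union>n\<in>J. reserve (k - i) n)"
    have "finite (reserve (k - i) n)" "reserve (k - i) n \<subseteq> T" for n
      using reserve_in[of "k - i" n] by (simp_all add: nsets_def)
    then have T0: "finite T0" "T0 \<subseteq> T" using J(2) unfolding T0_def by (blast, blast)
    obtain p where p: "inj_on p S" "p ` S \<subseteq> S" "\<And>x. x \<in> a ` u \<union> T0 \<Longrightarrow> p x = x"
        "\<And>x. x \<in> S \<Longrightarrow> x \<notin> a ` u \<Longrightarrow> p x \<in> T"
      using compression_exists[OF uk T0] by (elim exE conjE) (rule that, assumption+, erule bspec, assumption, simp)
    let ?t = "vertex_action S k p"
    define e where "e v n = a ` v \<union> reserve (k - card v) n" for v n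
    \<comment> \<open>The set of all \<open>j\<close> with \<open>f j \<in> v\<close> is the index under which \<open>v \<inter> u\<close> appears in the
      pulled-back coordinates.\<close>
    define g where "g y = (\<lambda>v\<in>V. code (\<lambda>n. dec (y {j\<in>{1..i}. f j \<in> v})
        (to_nat_on (nsets T (k - card (v \<inter> u))) (p ` e v n \<inter> T))))" for y :: "nat set \<Rightarrow> real"
    have preim: "{j\<in>{1..i}. f j \<in> v} \<subset> {1..i}" "f ` {j\<in>{1..i}. f j \<in> v} = v \<inter> u" "v \<inter> u \<subset> u" if "v \<in> V" for v
    proof -
      have v: "finite v" "card v \<le> card u" "v \<noteq> u" using that uS by (auto simp: V_def subsets_upto_iff)
      have "\<not> u \<subseteq> v" using v card_seteq[of v u] by auto
      then show vu: "v \<inter> u \<subset> u" by auto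
      show im: "f ` {j\<in>{1..i}. f j \<in> v} = v \<inter> u" using f by (auto simp: bij_betw_def)
      show "{j\<in>{1..i}. f j \<in> v} \<subset> {1..i}"
        using im vu f by (auto simp: bij_betw_def)
    qed
    have "cond_prob_fun \<mu> (Y u -` A \<inter> space \<mu>) \<zeta> N' (\<lambda>z. min 1 (measure (\<kappa> (pullback f u z)) A))"
    proof (rule cond_prob_fun_transfer[OF cond_prob_fun_of_cond_law[OF c Ab \<eta>] _ \<eta> \<zeta> h _ vertex_action_preserving[OF p(1,2)]])
      show "Y u -` A \<inter> space \<mu> \<in> sets \<mu>" using Y_measurable[OF uk] Ab by (rule measurable_sets)
      show "g \<in> kernel_dom Zr i \<rightarrow>\<^sub>M N'"
        unfolding N'_def g_def
      proof (rule measurable_restrict)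
        fix v assume "v \<in> V"
        then have *: "{j\<in>{1..i}. f j \<in> v} \<in> {a. a \<subset> {1..i}}" using preim(1) by blast
        have "(\<lambda>y. y {j\<in>{1..i}. f j \<in> v}) \<in> borel_measurable (kernel_dom Zr i)"
          unfolding kernel_dom_def using measurable_component_singleton[OF *] .
        then have d: "(\<lambda>y. dec (y {j\<in>{1..i}. f j \<in> v})) \<in> kernel_dom Zr i \<rightarrow>\<^sub>M borel"
          by (rule measurable_compose[OF _ dec_measurable])
        show "(\<lambda>y. code (\<lambda>n. dec (y {j\<in>{1..i}. f j \<in> v})
            (to_nat_on (nsets T (k - card (v \<inter> u))) (p ` e v n \<inter> T)))) \<in> borel_measurable (kernel_dom Zr i)"
          by (rule measurable_compose[OF measurable_coordinatewise_then_product code_measurable])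
            (rule measurable_compose[OF d sequence_coordinate_measurable])
      qed
      fix \<omega> assume \<omega>: "\<omega> \<in> space \<mu>"
      have t\<omega>: "?t \<omega> \<in> space \<mu>" using vertex_action_preserving(1)[OF p(1,2)] \<omega> by (rule measurable_space)
      have "Y u (?t \<omega>) n = Y u \<omega> n" if "n \<in> J" for n
      proof -
        have "p ` e u n = id ` e u n"
          using that p(3) uS by (intro image_cong) (auto simp: e_def T0_def)
        then have "\<phi> (\<omega> (p ` e u n)) = \<phi> (\<omega> (e u n))" by simp
        then show ?thesis unfolding Y_vertex_action[OF uk] unfolding Y_def e_def .
      qed
      then show "?t \<omega> \<in> Y u -` A \<inter> space \<mu> \<longleftrightarrow> \<omega> \<in> Y u -` A \<inter> space \<mu>"
        using \<omega> t\<omega> by (auto simp: A_iff)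
      show "proper f u \<omega> = pullback f u (\<zeta> \<omega>)" by (rule h\<zeta>)
      show "\<zeta> (?t \<omega>) = g (proper f u \<omega>)"
        unfolding \<zeta>_def g_def
      proof (rule restrict_ext)
        fix v assume v: "v \<in> V"
        then have vk: "v \<in> subsets_upto S k" using Vk by blast
        have vS: "v \<subseteq> S" using vk by (simp add: subsets_upto_iff)
        let ?b = "{j\<in>{1..i}. f j \<in> v}"
        have y: "proper f u \<omega> ?b = X (v \<inter> u) \<omega>"
          unfolding pullback_def uS using preim[OF v] by simp
        have "Y v (?t \<omega>) n = dec (proper f u \<omega> ?b) (to_nat_on (nsets T (k - card (v \<inter> u))) (p ` e v n \<inter> T))" for n
        proof -
          have en: "e v n \<in> nsets S k" unfolding e_def by (rule edge_in[OF vk])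
          then have eS: "e v n \<subseteq> S" "finite (e v n)" "card (e v n) = k" by (auto simp: nsets_def)
          have rT: "reserve (k - card v) n \<subseteq> T" using reserve_in[of "k - card v" n] by (auto simp: nsets_def)
          have fix_u: "p (a x) = a x" if "x \<in> u" for x using that p(3) by auto
          have to_T: "p x \<in> T" if xe: "x \<in> e v n" and xn: "x \<notin> a ` (v \<inter> u)" for x
          proof (rule p(4))
            show "x \<in> S" using xe eS by auto
            show "x \<notin> a ` u"
            proof
              assume "x \<in> a ` u"
              then obtain x' where x': "x' \<in> u" "x = a x'" by auto
              then have "x \<notin> T" using T_S(2) uS by auto
              then obtain x'' where "x'' \<in> v" "x = a x''" using xe rT by (auto simp: e_def)
              then have "x' = x''" using x' inj_onD[OF inj_a, of x' x''] vS uS by auto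
              then show False using x' \<open>x'' \<in> v\<close> xn by auto
            qed
          qed
          define w where "w = p ` e v n \<inter> T"
          have pe: "p ` e v n = a ` (v \<inter> u) \<union> w"
          proof (intro equalityI subsetI)
            fix x assume "x \<in> p ` e v n"
            then obtain x' where x': "x' \<in> e v n" "x = p x'" by auto
            show "x \<in> a ` (v \<inter> u) \<union> w"
            proof (cases "x' \<in> a ` (v \<inter> u)")
              case True
              then show ?thesis using x' fix_u by auto
            next
              case False
              then show ?thesis using x' to_T by (auto simp: w_def)
            qed
          next
            fix x assume "x \<in> a ` (v \<inter> u) \<union> w"
            then show "x \<in> p ` e v n"
            proof
              assume "x \<in> a ` (v \<inter> u)"
              then obtain x' where "x' \<in> v" "x' \<in> u" "x = a x'" by auto
              then have "x = p (a x')" "a x' \<in> e v n" using fix_u by (auto simp: e_def)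
              then show ?thesis by blast
            qed (simp add: w_def)
          qed
          have "card (a ` (v \<inter> u) \<union> w) = k" unfolding pe[symmetric] using card_image[OF inj_on_subset[OF p(1) eS(1)]] eS by simp
          moreover have fin: "finite w" "w \<subseteq> T" using eS by (auto simp: w_def)
          moreover have "a ` (v \<inter> u) \<inter> w = {}" using T_S(2) uS fin by blast
          moreover have "card (a ` (v \<inter> u)) = card (v \<inter> u)"
            using uS by (intro card_image inj_on_subset[OF inj_a]) auto
          moreover have "finite (a ` (v \<inter> u))" using uS by auto
          ultimately have "card (v \<inter> u) + card w = k" by (simp add: card_Un_disjoint)
          then have w: "w \<in> nsets T (k - card (v \<inter> u))" using fin by (auto simp: nsets_def)
          have 1: "dec (proper f u \<omega> ?b) (to_nat_on (nsets T (k - card (v \<inter> u))) w) = \<phi> (\<omega> (a ` (v \<inter> u) \<union> w))"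
          proof -
            have "dec (proper f u \<omega> ?b) = Y (v \<inter> u) \<omega>" unfolding y unfolding X_def dec_code ..
            then show ?thesis by (simp only: Y_def reserve_index[OF w])
          qed
          have 2: "Y v (?t \<omega>) n = \<phi> (\<omega> (p ` e v n))" unfolding Y_vertex_action[OF vk] e_def ..
          show ?thesis unfolding w_def[symmetric] 1 2 unfolding pe ..
        qed
        then show "X v (?t \<omega>) = code (\<lambda>n. dec (proper f u \<omega> ?b) (to_nat_on (nsets T (k - card (v \<inter> u))) (p ` e v n \<inter> T)))"
          unfolding X_def by presburger
      qed
    qed
    then have "emeasure \<mu> (Y u -` A \<inter> space \<mu> \<inter> \<zeta> -` B \<inter> space \<mu>) =
        (\<integral>\<^sup>+\<omega>. indicator B (\<zeta> \<omega>) * ennreal (min 1 (measure (\<kappa> (pullback f u (\<zeta> \<omega>))) A)) \<partial>\<mu>)"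
      using B unfolding cond_prob_fun_def by blast
    also have "\<dots> = (\<integral>\<^sup>+\<omega>. indicator B (\<zeta> \<omega>) * emeasure (\<kappa> (pullback f u (\<zeta> \<omega>))) A \<partial>\<mu>)"
    proof (intro nn_integral_cong)
      fix \<omega> assume "\<omega> \<in> space \<mu>"
      then have "prob_space (\<kappa> (pullback f u (\<zeta> \<omega>)))"
        using measurable_space[OF \<kappa> measurable_space[OF h measurable_space[OF \<zeta>]]] by (simp add: space_prob_algebra)
      then interpret P: prob_space "\<kappa> (pullback f u (\<zeta> \<omega>))" .
      show "indicator B (\<zeta> \<omega>) * ennreal (min 1 (measure (\<kappa> (pullback f u (\<zeta> \<omega>))) A)) =
          indicator B (\<zeta> \<omega>) * emeasure (\<kappa> (pullback f u (\<zeta> \<omega>))) A"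
        by (simp add: P.emeasure_eq_measure min_absorb2)
    qed
    also have "Y u -` A \<inter> space \<mu> \<inter> \<zeta> -` B \<inter> space \<mu> = Y u -` A \<inter> \<zeta> -` B \<inter> space \<mu>" by auto
    finally show "emeasure \<mu> (Y u -` A \<inter> \<zeta> -` B \<inter> space \<mu>) =
        (\<integral>\<^sup>+\<omega>. indicator B (\<zeta> \<omega>) * emeasure (\<kappa> (pullback f u (\<zeta> \<omega>))) A \<partial>\<mu>)" .
  qed
  then show ?thesis unfolding \<zeta>_def N'_def V_def .
qed

end

section \<open>The joint law of all nodes\<close>

lemma symmetric_kernel_distr:
  assumes P: "symmetric_kernel Z i W P" and f: "f \<in> W \<rightarrow>\<^sub>M W'"
  shows "symmetric_kernel Z i W' (\<lambda>x. distr (P x) W' f)"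
proof -
  have [measurable]: "P \<in> kernel_dom Z i \<rightarrow>\<^sub>M prob_algebra W" "f \<in> W \<rightarrow>\<^sub>M W'"
    using P f by (auto simp: symmetric_kernel_def)
  have "(\<lambda>x. distr (P x) W' f) \<in> kernel_dom Z i \<rightarrow>\<^sub>M prob_algebra W'" by measurable
  then show ?thesis unfolding symmetric_kernel_def
  proof (intro conjI allI impI ballI)
    fix \<sigma> x assume "\<sigma> permutes {1..i}" "x \<in> space (kernel_dom Z i)"
    then have "P (\<lambda>a\<in>{a. a \<subset> {1..i}}. x (\<sigma> ` a)) = P x" using P unfolding symmetric_kernel_def by blast
    then show "distr (P (\<lambda>a\<in>{a. a \<subset> {1..i}}. x (\<sigma> ` a))) W' f = distr (P x) W' f" by (rule arg_cong)
  qed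
qed

lemma some_enumeration:
  assumes "u \<in> nsets S i"
  shows "bij_betw (SOME f. bij_betw f {1..card u} u) {1..i} u"
proof -
  have u: "finite u" "card u = i" using assms by (auto simp: nsets_def)
  then have "\<exists>f. bij_betw f {1..card u} u" by (intro finite_same_card_bij) auto
  then have "bij_betw (SOME f. bij_betw f {1..card u} u) {1..card u} u" by (rule someI_ex)
  then show ?thesis using u by simp
qed

lemma subsets_upto_Suc:
  "subsets_upto S (Suc j) = subsets_upto S j \<union> nsets S (Suc j)" "subsets_upto S j \<inter> nsets S (Suc j) = {}"
  by (auto simp: subsets_upto_iff nsets_def)

lemma psubset_in_lower_level:
  assumes "u \<in> nsets S (Suc j)" "v \<subset> u"
  shows "v \<in> subsets_upto S j"
proof -
  have u: "u \<subseteq> S" "finite u" "card u = Suc j" using assms(1) by (simp_all add: nsets_def)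
  then have "card v < Suc j" using psubset_card_mono[OF u(2) assms(2)] by simp
  moreover have "finite v" "v \<subseteq> S" using u assms(2) by (auto intro: finite_subset)
  ultimately show ?thesis by (simp add: subsets_upto_iff)
qed

context exchangeable_array
begin

lemma kernel_at_measurable:
  assumes P: "P \<in> kernel_dom Zr i \<rightarrow>\<^sub>M prob_algebra W" and u: "u \<in> nsets S i" and V: "\<And>v. v \<subset> u \<Longrightarrow> v \<in> V"
  shows "kernel_at P u \<in> (\<Pi>\<^sub>M v\<in>V. borel) \<rightarrow>\<^sub>M prob_algebra W"
  unfolding kernel_at_def[abs_def]
  by (rule measurable_compose[OF pullback_measurable[OF u some_enumeration[OF u]] P]) (rule V)

lemma kernel_at_cong:
  assumes u: "u \<in> nsets S i" and z: "\<And>v. v \<subset> u \<Longrightarrow> z v = z' v"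
  shows "kernel_at P u z = kernel_at P u z'"
proof -
  have cu: "card u = i" using u by (simp add: nsets_def)
  have "pullback (SOME f. bij_betw f {1..card u} u) u z = pullback (SOME f. bij_betw f {1..card u} u) u z'"
    unfolding pullback_def
    by (rule restrict_ext) (use image_proper_subset(1)[OF u some_enumeration[OF u]] z cu in auto)
  then show ?thesis by (simp add: kernel_at_def)
qed

definition node_data :: "nat \<Rightarrow> ('s set \<Rightarrow> 'c) \<Rightarrow> 's set \<Rightarrow> real" where
  "node_data j \<omega> = (\<lambda>v\<in>subsets_upto S j. X v \<omega>)"

lemma node_data_measurable: "j \<le> k \<Longrightarrow> node_data j \<in> \<mu> \<rightarrow>\<^sub>M levels_space S Zr j"
  unfolding node_data_def levels_space_def by (rule X_restrict_measurable) (auto simp: subsets_upto_iff)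

text \<open>Given all other nodes up to level \<open>i\<close>, the node \<open>u\<close> may be redrawn from \<open>kernel_at P u\<close> without
  changing the joint law. Unlike a description of the level as a whole, this property of single
  nodes can be iterated.\<close>

definition resampling_kernel :: "nat \<Rightarrow> ((nat set \<Rightarrow> real) \<Rightarrow> real measure) \<Rightarrow> bool" where
  "resampling_kernel i P \<longleftrightarrow> symmetric_kernel Zr i borel P \<and>
    (\<forall>u\<in>nsets S i. cond_law \<mu> (\<lambda>\<omega>. \<lambda>v\<in>subsets_upto S i - {u}. X v \<omega>) (\<Pi>\<^sub>M v\<in>subsets_upto S i - {u}. borel)
      (X u) borel (kernel_at P u))"

lemma resampling_kernel_exists:
  assumes i: "i \<le> k"
  shows "\<exists>P. resampling_kernel i P"
proof -
  obtain \<kappa> where \<kappa>: "symmetric_kernel Zr i borel \<kappa>"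
    "\<And>u f. u \<in> nsets S i \<Longrightarrow> bij_betw f {1..i} u \<Longrightarrow> cond_law \<mu> (proper f u) (kernel_dom Zr i) (Y u) borel \<kappa>"
    using symmetric_conditional_kernel[OF i] by blast
  define P where "P x = distr (\<kappa> x) borel code" for x
  have "cond_law \<mu> (\<lambda>\<omega>. \<lambda>v\<in>subsets_upto S i - {u}. X v \<omega>) (\<Pi>\<^sub>M v\<in>subsets_upto S i - {u}. borel)
      (X u) borel (kernel_at P u)" if u: "u \<in> nsets S i" for u
  proof -
    let ?f = "SOME f. bij_betw f {1..card u} u"
    have uk: "u \<in> subsets_upto S k" using nsets_subsets_upto[OF u i] .
    have c: "cond_law \<mu> (\<lambda>\<omega>. \<lambda>v\<in>subsets_upto S i - {u}. X v \<omega>) (\<Pi>\<^sub>M v\<in>subsets_upto S i - {u}. borel)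
      (Y u) borel (\<lambda>z. \<kappa> (pullback ?f u z))"
      using some_enumeration[OF u] by (intro cond_law_other_coordinates[OF i u] \<kappa>(2)[OF u])
    have Vk: "subsets_upto S i - {u} \<subseteq> subsets_upto S k" using i by (auto simp: subsets_upto_iff)
    show ?thesis unfolding kernel_at_def[abs_def] P_def
      by (rule cond_law_distr[OF c Y_measurable[OF uk] X_restrict_measurable[OF Vk] code_measurable]) (rule X_def)
  qed
  then show ?thesis
    unfolding resampling_kernel_def using symmetric_kernel_distr[OF \<kappa>(1) code_measurable]
    by (intro exI[of _ P]) (simp add: P_def[abs_def])
qed

text \<open>Replace the indicators of the events \<open>X u \<in> A u\<close> by their conditional probabilities one after
  another. At each step the remaining factors, whether already replaced or not, depend only on
  nodes other than \<open>u\<close>, so that the defining property of a \<open>resampling_kernel\<close> applies.\<close>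

lemma joint_law_of_level:
  assumes j: "Suc j \<le> k" and P: "resampling_kernel (Suc j) P"
    and J: "finite J" "J \<subseteq> nsets S (Suc j)" and C: "C \<in> sets (levels_space S Zr j)"
    and A: "\<And>u. u \<in> J \<Longrightarrow> A u \<in> sets borel"
  shows "emeasure \<mu> {\<omega>\<in>space \<mu>. node_data j \<omega> \<in> C \<and> (\<forall>u\<in>J. X u \<omega> \<in> A u)} =
    (\<integral>\<^sup>+\<omega>. indicator C (node_data j \<omega>) * (\<Prod>u\<in>J. emeasure (kernel_at P u (node_data j \<omega>)) (A u)) \<partial>\<mu>)"
proof -
  have Pm: "P \<in> kernel_dom Zr (Suc j) \<rightarrow>\<^sub>M prob_algebra borel"
    using P by (simp add: resampling_kernel_def symmetric_kernel_def)
  have proper_in: "v \<in> subsets_upto S j" if "v \<subset> u" "u \<in> J" for u v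
    using psubset_in_lower_level[of u S j v] that J by blast
  \<comment> \<open>The factor at \<open>u\<close> once the nodes in \<open>Q\<close> have been treated.\<close>
  define F where "F Q u \<omega> = (if u \<in> Q then emeasure (kernel_at P u (node_data j \<omega>)) (A u) else indicator (A u) (X u \<omega>))" for Q u \<omega>
  have swap: "(\<integral>\<^sup>+\<omega>. indicator C (node_data j \<omega>) * (\<Prod>u\<in>J. F {} u \<omega>) \<partial>\<mu>) =
      (\<integral>\<^sup>+\<omega>. indicator C (node_data j \<omega>) * (\<Prod>u\<in>J. F Q u \<omega>) \<partial>\<mu>)" if "finite Q" "Q \<subseteq> J" for Q
    using that
  proof (induction Q rule: finite_induct)
    case (insert u Q)
    then have u: "u \<in> J" "u \<notin> Q" "u \<in> nsets S (Suc j)" using J by auto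
    have uk: "u \<in> subsets_upto S k" using nsets_subsets_upto[OF u(3) j] .
    let ?V = "subsets_upto S (Suc j) - {u}"
    let ?\<zeta> = "\<lambda>\<omega>. \<lambda>v\<in>?V. X v \<omega>"
    have low: "subsets_upto S j \<subseteq> ?V" using u(3) by (auto simp: subsets_upto_iff nsets_def)
    have Jin: "w \<in> ?V" if "w \<in> J - {u}" for w using that J by (auto simp: subsets_upto_Suc)
    have c: "cond_law \<mu> ?\<zeta> (\<Pi>\<^sub>M v\<in>?V. borel) (X u) borel (kernel_at P u)"
      using P u(3) by (simp add: resampling_kernel_def)
    have \<zeta>: "?\<zeta> \<in> \<mu> \<rightarrow>\<^sub>M (\<Pi>\<^sub>M v\<in>?V. borel)" using j by (intro X_restrict_measurable) (auto simp: subsets_upto_iff)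
    define g where "g z = indicator C (restrict z (subsets_upto S j)) *
      (\<Prod>w\<in>J - {u}. if w \<in> Q then emeasure (kernel_at P w z) (A w) else indicator (A w) (z w))" for z :: "'s set \<Rightarrow> real"
    have g: "g \<in> borel_measurable (\<Pi>\<^sub>M v\<in>?V. borel)"
    proof -
      have "(\<lambda>z. restrict z (subsets_upto S j)) \<in> (\<Pi>\<^sub>M v\<in>?V. (borel :: real measure)) \<rightarrow>\<^sub>M levels_space S Zr j"
        unfolding levels_space_def using low by (intro measurable_restrict_subset)
      then have 1: "(\<lambda>z. indicator C (restrict z (subsets_upto S j)) :: ennreal) \<in> borel_measurable (\<Pi>\<^sub>M v\<in>?V. borel)"
        by (rule measurable_compose[OF _ borel_measurable_indicator[OF C]])
      have 2: "(\<lambda>z. if w \<in> Q then emeasure (kernel_at P w z) (A w) else indicator (A w) (z w))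
          \<in> borel_measurable (\<Pi>\<^sub>M v\<in>?V. borel)" if w: "w \<in> J - {u}" for w
      proof (cases "w \<in> Q")
        case True
        have "kernel_at P w \<in> (\<Pi>\<^sub>M v\<in>?V. borel) \<rightarrow>\<^sub>M prob_algebra borel"
          using w J low proper_in by (intro kernel_at_measurable[OF Pm]) auto
        then have "(\<lambda>z. emeasure (kernel_at P w z) (A w)) \<in> borel_measurable (\<Pi>\<^sub>M v\<in>?V. borel)"
          using A[of w] w by (intro measurable_emeasure_kernel[OF measurable_prob_algebraD]) auto
        then show ?thesis using True by simp
      next
        case False
        have "(\<lambda>z. z w) \<in> (\<Pi>\<^sub>M v\<in>?V. borel) \<rightarrow>\<^sub>M (borel :: real measure)"
          using Jin[OF w] by (rule measurable_component_singleton)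
        from measurable_compose[OF this borel_measurable_indicator[of "A w"]] show ?thesis using False w A by simp
      qed
      show ?thesis unfolding g_def by (intro borel_measurable_times_ennreal borel_measurable_prod_ennreal 1 2)
    qed
    have split: "indicator C (node_data j \<omega>) * (\<Prod>w\<in>J. F Q' w \<omega>) = F Q' u \<omega> * g (?\<zeta> \<omega>)"
      if "Q' = Q \<or> Q' = insert u Q" for Q' \<omega>
    proof -
      have r: "restrict (?\<zeta> \<omega>) (subsets_upto S j) = node_data j \<omega>"
        using low by (auto simp: node_data_def Int_absorb1)
      have k: "kernel_at P w (?\<zeta> \<omega>) = kernel_at P w (node_data j \<omega>)" if "w \<in> J" for w
        using that J low proper_in by (intro kernel_at_cong[of w "Suc j"]) (auto simp: node_data_def)
      have "g (?\<zeta> \<omega>) = indicator C (node_data j \<omega>) * (\<Prod>w\<in>J - {u}. F Q' w \<omega>)"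
        unfolding g_def r using that k Jin
        by (intro arg_cong2[where f="(*)"] prod.cong refl) (auto simp: F_def)
      moreover have "(\<Prod>w\<in>J. F Q' w \<omega>) = F Q' u \<omega> * (\<Prod>w\<in>J - {u}. F Q' w \<omega>)"
        using J(1) u(1) by (rule prod.remove)
      ultimately show ?thesis by (simp add: mult_ac)
    qed
    have "(\<integral>\<^sup>+\<omega>. indicator C (node_data j \<omega>) * (\<Prod>w\<in>J. F {} w \<omega>) \<partial>\<mu>) =
        (\<integral>\<^sup>+\<omega>. indicator C (node_data j \<omega>) * (\<Prod>w\<in>J. F Q w \<omega>) \<partial>\<mu>)" using insert by simp
    also have "\<dots> = (\<integral>\<^sup>+\<omega>. indicator (A u) (X u \<omega>) * g (?\<zeta> \<omega>) \<partial>\<mu>)"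
      by (subst split) (auto simp: F_def u(2))
    also have "\<dots> = (\<integral>\<^sup>+\<omega>. emeasure (kernel_at P u (?\<zeta> \<omega>)) (A u) * g (?\<zeta> \<omega>) \<partial>\<mu>)"
      by (rule cond_law_nn_integral[OF c X_measurable[OF uk] \<zeta> A[OF u(1)] g])
    also have "\<dots> = (\<integral>\<^sup>+\<omega>. F (insert u Q) u \<omega> * g (?\<zeta> \<omega>) \<partial>\<mu>)"
    proof -
      have "kernel_at P u (?\<zeta> \<omega>) = kernel_at P u (node_data j \<omega>)" for \<omega>
        using u low proper_in by (intro kernel_at_cong[of u "Suc j"]) (auto simp: node_data_def)
      then show ?thesis by (simp add: F_def)
    qed
    also have "\<dots> = (\<integral>\<^sup>+\<omega>. indicator C (node_data j \<omega>) * (\<Prod>w\<in>J. F (insert u Q) w \<omega>) \<partial>\<mu>)"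
      by (subst split) auto
    finally show ?case .
  qed simp
  have Lm: "node_data j \<in> \<mu> \<rightarrow>\<^sub>M levels_space S Zr j" using j by (intro node_data_measurable) simp
  have Xm: "X u \<in> borel_measurable \<mu>" if "u \<in> J" for u
    using that J j nsets_subsets_upto by (intro X_measurable) blast
  have ev: "{\<omega>\<in>space \<mu>. node_data j \<omega> \<in> C \<and> (\<forall>u\<in>J. X u \<omega> \<in> A u)} = (node_data j -` C \<inter> space \<mu>) \<inter> {\<omega>\<in>space \<mu>. \<forall>u\<in>J. X u \<omega> \<in> A u}"
    by auto
  have "{\<omega>\<in>space \<mu>. \<forall>u\<in>J. X u \<omega> \<in> A u} \<in> sets \<mu>"
  proof (rule sets.sets_Collect_finite_All[OF _ J(1)])
    fix u assume u: "u \<in> J"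
    have "{\<omega>\<in>space \<mu>. X u \<omega> \<in> A u} = X u -` A u \<inter> space \<mu>" by auto
    then show "{\<omega>\<in>space \<mu>. X u \<omega> \<in> A u} \<in> sets \<mu>" using measurable_sets[OF Xm[OF u] A[OF u]] by simp
  qed
  then have ev_sets: "{\<omega>\<in>space \<mu>. node_data j \<omega> \<in> C \<and> (\<forall>u\<in>J. X u \<omega> \<in> A u)} \<in> sets \<mu>"
    unfolding ev using measurable_sets[OF Lm C] by (rule sets.Int[rotated])
  have ind: "(\<Prod>u\<in>J'. indicator (A u) (X u \<omega>) :: ennreal) = indicator {\<omega>. \<forall>u\<in>J'. X u \<omega> \<in> A u} \<omega>" if "finite J'" for J' \<omega>
    using that by (induction J' rule: finite_induct) (auto split: split_indicator)
  have "emeasure \<mu> {\<omega>\<in>space \<mu>. node_data j \<omega> \<in> C \<and> (\<forall>u\<in>J. X u \<omega> \<in> A u)} =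
      (\<integral>\<^sup>+\<omega>. indicator C (node_data j \<omega>) * (\<Prod>u\<in>J. F {} u \<omega>) \<partial>\<mu>)"
    unfolding nn_integral_indicator[OF ev_sets, symmetric]
    by (intro nn_integral_cong) (auto simp: F_def ind[OF J(1)] split: split_indicator)
  also have "\<dots> = (\<integral>\<^sup>+\<omega>. indicator C (node_data j \<omega>) * (\<Prod>u\<in>J. F J u \<omega>) \<partial>\<mu>)"
    by (rule swap) (use J in auto)
  also have "\<dots> = (\<integral>\<^sup>+\<omega>. indicator C (node_data j \<omega>) * (\<Prod>u\<in>J. emeasure (kernel_at P u (node_data j \<omega>)) (A u)) \<partial>\<mu>)"
    by (simp add: F_def cong: prod.cong)
  finally show ?thesis .
qed

lemma level_kernels_measurable:
  assumes P: "P \<in> kernel_dom Zr (Suc j) \<rightarrow>\<^sub>M prob_algebra W"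
  shows "(\<lambda>z. \<Pi>\<^sub>M u\<in>nsets S (Suc j). kernel_at P u z) \<in> levels_space S Zr j \<rightarrow>\<^sub>M prob_algebra (\<Pi>\<^sub>M u\<in>nsets S (Suc j). W)"
proof (rule measurable_PiM_kernels)
  fix u assume u: "u \<in> nsets S (Suc j)"
  have "v \<in> subsets_upto S j" if "v \<subset> u" for v
    using psubset_in_lower_level[OF u that] .
  then show "kernel_at P u \<in> levels_space S Zr j \<rightarrow>\<^sub>M prob_algebra W"
    unfolding levels_space_def by (rule kernel_at_measurable[OF P u])
qed

lemma node_data_in_space: "j \<le> k \<Longrightarrow> \<omega> \<in> space \<mu> \<Longrightarrow> node_data j \<omega> \<in> space (levels_space S Zr j)"
  using node_data_measurable by (rule measurable_space)

text \<open>Both sides are compared on finite-dimensional boxes, which split into a condition on the lower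
  levels and one on the new level; the latter is covered by \<open>joint_law_of_level\<close>.\<close>

lemma levels_law_eq:
  assumes P: "\<And>i. 1 \<le> i \<Longrightarrow> i < k \<Longrightarrow> resampling_kernel i (P i)" and j: "j < k"
  shows "levels_law S Zr (distr \<mu> borel (X {})) P j = distr \<mu> (levels_space S Zr j) (node_data j)"
  using j
proof (induction j)
  case 0
  have e: "{} \<in> subsets_upto S k" by (simp add: subsets_upto_iff)
  have s0: "subsets_upto S 0 = {{}}" by (auto simp: subsets_upto_iff)
  have m: "(\<lambda>x. \<lambda>u\<in>{{}}. x) \<in> borel \<rightarrow>\<^sub>M levels_space S Zr 0"
    unfolding levels_space_def s0 by (rule measurable_restrict) simp
  have "levels_law S Zr (distr \<mu> borel (X {})) P 0 = distr \<mu> (levels_space S Zr 0) ((\<lambda>x. \<lambda>u\<in>{{}}. x) \<circ> X {})"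
    by (simp add: distr_distr[OF m X_measurable[OF e]])
  also have "\<dots> = distr \<mu> (levels_space S Zr 0) (node_data 0)"
    by (intro distr_cong refl) (auto simp: node_data_def s0)
  finally show ?case .
next
  case (Suc j)
  let ?H = "nsets S (Suc j)" and ?Lo = "subsets_upto S j"
  let ?Pi = "\<lambda>z. \<Pi>\<^sub>M u\<in>?H. kernel_at (P (Suc j)) u z"
  let ?N = "levels_space S Zr j" and ?N' = "levels_space S Zr (Suc j)"
  let ?f = "\<lambda>z. distr (?Pi z) ?N' (\<lambda>y. merge ?Lo ?H (z, y))"
  have res: "resampling_kernel (Suc j) (P (Suc j))" using P Suc.prems by simp
  then have Pm: "P (Suc j) \<in> kernel_dom Zr (Suc j) \<rightarrow>\<^sub>M prob_algebra borel"
    by (simp add: resampling_kernel_def symmetric_kernel_def)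
  have Lm: "node_data j \<in> \<mu> \<rightarrow>\<^sub>M ?N" using Suc.prems by (intro node_data_measurable) simp
  have Lm': "node_data (Suc j) \<in> \<mu> \<rightarrow>\<^sub>M ?N'" using Suc.prems by (intro node_data_measurable) simp
  have mm: "merge ?Lo ?H \<in> ?N \<Otimes>\<^sub>M (\<Pi>\<^sub>M u\<in>?H. (borel :: real measure)) \<rightarrow>\<^sub>M ?N'"
    unfolding levels_space_def subsets_upto_Suc by (rule measurable_merge)
  have Pim: "?Pi \<in> ?N \<rightarrow>\<^sub>M prob_algebra (\<Pi>\<^sub>M u\<in>?H. borel)" by (rule level_kernels_measurable[OF Pm])
  have fm: "?f \<in> ?N \<rightarrow>\<^sub>M prob_algebra ?N'"
    by (rule measurable_distr_prob_space2[OF Pim]) (use mm in simp)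
  have inP: "distr \<mu> ?N (node_data j) \<in> space (prob_algebra ?N)"
    by (simp add: space_prob_algebra prob_space_distr[OF Lm])
  have "distr \<mu> ?N (node_data j) \<bind> ?f = distr \<mu> ?N' (node_data (Suc j))"
  proof (rule measure_eqI_PiM_infinite[of _ "subsets_upto S (Suc j)" "\<lambda>_. borel"])
    show "sets (distr \<mu> ?N (node_data j) \<bind> ?f) = sets (\<Pi>\<^sub>M v\<in>subsets_upto S (Suc j). borel)"
      using sets_bind'[OF inP fm] by (simp add: levels_space_def)
    show "sets (distr \<mu> ?N' (node_data (Suc j))) = sets (\<Pi>\<^sub>M v\<in>subsets_upto S (Suc j). borel)"
      by (simp add: levels_space_def)
    show "finite_measure (distr \<mu> ?N (node_data j) \<bind> ?f)"
      using prob_space.finite_measure[OF prob_space_bind'[OF inP fm]] .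
    fix A :: "'s set \<Rightarrow> real set" and J assume J: "finite J" "J \<subseteq> subsets_upto S (Suc j)" and A: "\<And>i. i \<in> J \<Longrightarrow> A i \<in> sets borel"
    define B where "B = prod_emb (subsets_upto S (Suc j)) (\<lambda>_. borel) J (Pi\<^sub>E J A)"
    have B: "B \<in> sets ?N'" unfolding B_def levels_space_def using J A by (intro sets_PiM_I) auto
    have B_iff: "x \<in> B \<longleftrightarrow> x \<in> space ?N' \<and> (\<forall>v\<in>J. x v \<in> A v)" for x
      unfolding B_def prod_emb_box[OF J(2)] by (simp add: levels_space_def)
    define Jl Jh where "Jl = J \<inter> ?Lo" and "Jh = J \<inter> ?H"
    have JJ: "J = Jl \<union> Jh" using J by (auto simp: Jl_def Jh_def subsets_upto_Suc)
    have Jh: "finite Jh" "Jh \<subseteq> ?H" using J by (auto simp: Jh_def)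
    define C where "C = prod_emb ?Lo (\<lambda>_. borel) Jl (Pi\<^sub>E Jl A)"
    have C: "C \<in> sets ?N" unfolding C_def levels_space_def using J A by (intro sets_PiM_I) (auto simp: Jl_def)
    have C_iff: "z \<in> C \<longleftrightarrow> z \<in> space ?N \<and> (\<forall>v\<in>Jl. z v \<in> A v)" for z
      unfolding C_def by (subst prod_emb_box) (auto simp: levels_space_def Jl_def)
    define D where "D = prod_emb ?H (\<lambda>_. borel :: real measure) Jh (Pi\<^sub>E Jh A)"
    have D_iff: "y \<in> D \<longleftrightarrow> y \<in> space (\<Pi>\<^sub>M u\<in>?H. (borel :: real measure)) \<and> (\<forall>u\<in>Jh. y u \<in> A u)" for y
      unfolding D_def by (subst prod_emb_box) (auto simp: Jh_def)
    have f_B: "emeasure (?f z) B = indicator C z * (\<Prod>u\<in>Jh. emeasure (kernel_at (P (Suc j)) u z) (A u))"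
      if z: "z \<in> space ?N" for z
    proof -
      have kz: "kernel_at (P (Suc j)) u z \<in> space (prob_algebra borel)" if u: "u \<in> ?H" for u
      proof (rule measurable_space[OF _ z])
        have "v \<in> subsets_upto S j" if "v \<subset> u" for v
          using psubset_in_lower_level[OF u that] .
        then show "kernel_at (P (Suc j)) u \<in> ?N \<rightarrow>\<^sub>M prob_algebra borel"
          unfolding levels_space_def by (rule kernel_at_measurable[OF Pm u])
      qed
      have "sets (?Pi z) = sets (\<Pi>\<^sub>M u\<in>?H. (borel :: real measure))"
        using measurable_space[OF Pim z] by (simp add: space_prob_algebra)
      note sPi = this sets_eq_imp_space_eq[OF this]
      have mz: "(\<lambda>y. merge ?Lo ?H (z, y)) \<in> ?Pi z \<rightarrow>\<^sub>M ?N'"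
        unfolding measurable_cong_sets[OF sPi(1) refl]
        using measurable_compose[OF measurable_Pair1'[OF z] mm] by simp
      have "(\<lambda>y. merge ?Lo ?H (z, y)) -` B \<inter> space (?Pi z) = (if z \<in> C then D else {})"
      proof (intro set_eqI)
        fix y
        show "y \<in> (\<lambda>y. merge ?Lo ?H (z, y)) -` B \<inter> space (?Pi z) \<longleftrightarrow> y \<in> (if z \<in> C then D else {})"
        proof (cases "y \<in> space (?Pi z)")
          case True
          have "merge ?Lo ?H (z, y) v = z v" if "v \<in> Jl" for v using that by (simp add: Jl_def merge_def)
          moreover have "merge ?Lo ?H (z, y) v = y v" if "v \<in> Jh" for v
            using that subsets_upto_Suc(2)[of S j] by (auto simp: Jh_def merge_def)
          moreover have "merge ?Lo ?H (z, y) \<in> space ?N'" using mz True by (rule measurable_space)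
          ultimately show ?thesis using True z
            by (auto simp: B_iff C_iff D_iff sPi(2) JJ ball_Un)
        next
          case False
          then show ?thesis by (simp add: D_iff sPi(2))
        qed
      qed
      then have "emeasure (?f z) B = emeasure (?Pi z) (if z \<in> C then D else {})"
        using B by (simp add: emeasure_distr[OF mz])
      also have "\<dots> = indicator C z * (\<Prod>u\<in>Jh. emeasure (kernel_at (P (Suc j)) u z) (A u))"
        using emeasure_PiM_kernels_box[of ?H "\<lambda>u. kernel_at (P (Suc j)) u z" "\<lambda>_. borel" Jh A] kz Jh A
        by (auto simp: D_def Jh_def)
      finally show ?thesis .
    qed
    have m1: "(\<lambda>z. emeasure (?f z) B) \<in> borel_measurable ?N"
      by (rule measurable_emeasure_kernel[OF measurable_prob_algebraD[OF fm] B])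
    have "emeasure (distr \<mu> ?N (node_data j) \<bind> ?f) B = (\<integral>\<^sup>+z. emeasure (?f z) B \<partial>distr \<mu> ?N (node_data j))"
      by (rule emeasure_bind[where N="?N'"])
        (use fm B prob_space.not_empty[OF prob_space_distr[OF Lm]] in
          \<open>auto intro!: measurable_prob_algebraD simp: measurable_cong_sets[OF sets_distr refl]\<close>)
    also have "\<dots> = (\<integral>\<^sup>+\<omega>. emeasure (?f (node_data j \<omega>)) B \<partial>\<mu>)"
      by (rule nn_integral_distr[OF Lm]) (subst measurable_cong_sets[OF sets_distr refl], rule m1)
    also have "\<dots> = (\<integral>\<^sup>+\<omega>. indicator C (node_data j \<omega>) * (\<Prod>u\<in>Jh. emeasure (kernel_at (P (Suc j)) u (node_data j \<omega>)) (A u)) \<partial>\<mu>)"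
      using Suc.prems by (intro nn_integral_cong f_B node_data_in_space) auto
    also have "\<dots> = emeasure \<mu> {\<omega>\<in>space \<mu>. node_data j \<omega> \<in> C \<and> (\<forall>u\<in>Jh. X u \<omega> \<in> A u)}"
      using Suc.prems A by (intro joint_law_of_level[OF _ res Jh C, symmetric]) (auto simp: Jh_def)
    also have "{\<omega>\<in>space \<mu>. node_data j \<omega> \<in> C \<and> (\<forall>u\<in>Jh. X u \<omega> \<in> A u)} = node_data (Suc j) -` B \<inter> space \<mu>"
    proof (intro set_eqI)
      fix \<omega>
      show "\<omega> \<in> {\<omega>\<in>space \<mu>. node_data j \<omega> \<in> C \<and> (\<forall>u\<in>Jh. X u \<omega> \<in> A u)} \<longleftrightarrow> \<omega> \<in> node_data (Suc j) -` B \<inter> space \<mu>"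
      proof (cases "\<omega> \<in> space \<mu>")
        case True
        have "node_data j \<omega> v = X v \<omega>" if "v \<in> Jl" for v using that by (simp add: node_data_def Jl_def)
        moreover have "node_data (Suc j) \<omega> v = X v \<omega>" if "v \<in> Jl \<union> Jh" for v
          using that by (auto simp: node_data_def Jl_def Jh_def subsets_upto_Suc)
        moreover have "node_data j \<omega> \<in> space ?N" "node_data (Suc j) \<omega> \<in> space ?N'"
          using measurable_space[OF Lm True] measurable_space[OF Lm' True] .
        ultimately show ?thesis using True by (auto simp: B_iff C_iff JJ ball_Un)
      qed simp
    qed
    also have "emeasure \<mu> (node_data (Suc j) -` B \<inter> space \<mu>) = emeasure (distr \<mu> ?N' (node_data (Suc j))) B"
      by (rule emeasure_distr[OF Lm' B, symmetric])
    finally show "emeasure (distr \<mu> ?N (node_data j) \<bind> ?f) (prod_emb (subsets_upto S (Suc j)) (\<lambda>_. borel) J (Pi\<^sub>E J A)) =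
        emeasure (distr \<mu> ?N' (node_data (Suc j))) (prod_emb (subsets_upto S (Suc j)) (\<lambda>_. borel) J (Pi\<^sub>E J A))"
      unfolding B_def .
  qed
  then show ?case using Suc by simp
qed

text \<open>At the last level the code of a node \<open>e\<close> holds the constant sequence with value \<open>\<phi> (\<omega> (a ` e))\<close>,
  since the only subset of the reserve of size \<open>0\<close> is empty. Decoding its entry \<open>0\<close> gives the
  colour of \<open>a ` e\<close>, and these colours have law \<open>\<mu>\<close> because \<open>a\<close> is an injection.\<close>

lemma recipe_law_eq:
  assumes P: "\<And>i. 1 \<le> i \<Longrightarrow> i \<le> k \<Longrightarrow> resampling_kernel i (P i)" and k: "1 \<le> k"
    and r: "r \<in> borel \<rightarrow>\<^sub>M K" "\<And>x. x \<in> space K \<Longrightarrow> r (\<phi> x) = x"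
  shows "recipe_law S k Zr (distr \<mu> borel (X {})) P (\<lambda>x. distr (P k x) K (\<lambda>t. r (dec t 0))) = \<mu>"
proof -
  obtain j where kj: "k = Suc j" using k by (cases k) auto
  then have jk: "j \<le> k" "Suc j \<le> k" "j < k" "k - 1 = j" and Pk: "P k = P (Suc j)" by simp_all
  let ?rr = "\<lambda>t. r (dec t 0)" and ?N = "levels_space S Zr j" and ?H = "hypergraph_space S k K"
  define Q where "Q x = distr (P k x) K ?rr" for x
  have res: "resampling_kernel (Suc j) (P (Suc j))" using P kj by simp
  have Pm: "P k \<in> kernel_dom Zr (Suc j) \<rightarrow>\<^sub>M prob_algebra borel"
  proof -
    have "P (Suc j) \<in> kernel_dom Zr (Suc j) \<rightarrow>\<^sub>M prob_algebra borel"
      using res unfolding resampling_kernel_def symmetric_kernel_def by blast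
    then show ?thesis by (simp add: kj)
  qed
  from measurable_compose[OF measurable_compose[OF dec_measurable sequence_coordinate_measurable] r(1)]
  have rr[measurable]: "?rr \<in> borel \<rightarrow>\<^sub>M K" .
  have Qm: "Q \<in> kernel_dom Zr (Suc j) \<rightarrow>\<^sub>M prob_algebra K"
    using Pm unfolding Q_def by measurable
  have Lm: "node_data j \<in> \<mu> \<rightarrow>\<^sub>M ?N" using kj by (intro node_data_measurable) simp
  let ?f = "\<lambda>z. \<Pi>\<^sub>M e\<in>nsets S k. kernel_at Q e z"
  have fm: "?f \<in> ?N \<rightarrow>\<^sub>M prob_algebra ?H"
    using level_kernels_measurable[OF Qm] by (simp add: kj hypergraph_space_def)
  have inP: "distr \<mu> ?N (node_data j) \<in> space (prob_algebra ?N)"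
    by (simp add: space_prob_algebra prob_space_distr[OF Lm])
  have "distr \<mu> ?N (node_data j) \<bind> ?f = distr \<mu> ?H (vertex_action S k a)"
  proof (rule measure_eqI_PiM_infinite[of _ "nsets S k" "\<lambda>_. K"])
    have am: "vertex_action S k a \<in> \<mu> \<rightarrow>\<^sub>M ?H"
      using vertex_action_measurable[OF inj_a a_S, of k K] by (simp add: measurable_cong_sets[OF sets_\<mu> refl])
    show "sets (distr \<mu> ?N (node_data j) \<bind> ?f) = sets (Pi\<^sub>M (nsets S k) (\<lambda>_. K))"
      using sets_bind'[OF inP fm] by (simp add: hypergraph_space_def)
    show "sets (distr \<mu> ?H (vertex_action S k a)) = sets (Pi\<^sub>M (nsets S k) (\<lambda>_. K))"
      by (simp add: hypergraph_space_def)
    show "finite_measure (distr \<mu> ?N (node_data j) \<bind> ?f)"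
      using prob_space.finite_measure[OF prob_space_bind'[OF inP fm]] .
    fix A J assume J: "finite J" "J \<subseteq> nsets S k" and A: "\<And>i. i \<in> J \<Longrightarrow> A i \<in> sets K"
    define B where "B = prod_emb (nsets S k) (\<lambda>_. K) J (Pi\<^sub>E J A)"
    have B: "B \<in> sets ?H" unfolding B_def hypergraph_space_def using J A by (intro sets_PiM_I) auto
    have B_iff: "x \<in> B \<longleftrightarrow> x \<in> space ?H \<and> (\<forall>e\<in>J. x e \<in> A e)" for x
      unfolding B_def prod_emb_box[OF J(2)] by (simp add: hypergraph_space_def)
    let ?A = "\<lambda>e. ?rr -` A e"
    have J': "J \<subseteq> nsets S (Suc j)" using J(2) kj by simp
    have A': "?A e \<in> sets borel" if "e \<in> J" for e using measurable_sets[OF rr A[OF that]] by simp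
    have f_B: "emeasure (?f z) B = (\<Prod>e\<in>J. emeasure (kernel_at (P k) e z) (?A e))" if z: "z \<in> space ?N" for z
    proof -
      have kQ: "kernel_at Q e z \<in> space (prob_algebra K)"
        if e: "e \<in> nsets S k" for e
      proof (rule measurable_space[OF _ z])
        have e': "e \<in> nsets S (Suc j)" using e kj by simp
        show "kernel_at Q e \<in> ?N \<rightarrow>\<^sub>M prob_algebra K"
          unfolding levels_space_def
          by (rule kernel_at_measurable[OF Qm e']) (rule psubset_in_lower_level[OF e'])
      qed
      have kP': "kernel_at (P k) e z \<in> space (prob_algebra borel)"
        if e: "e \<in> nsets S k" for e
      proof (rule measurable_space[OF _ z])
        have e': "e \<in> nsets S (Suc j)" using e kj by simp
        show "kernel_at (P k) e \<in> ?N \<rightarrow>\<^sub>M prob_algebra borel"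
          unfolding levels_space_def
          by (rule kernel_at_measurable[OF Pm e']) (rule psubset_in_lower_level[OF e'])
      qed
      have kP: "sets (kernel_at (P k) e z) = sets borel" if "e \<in> nsets S k" for e
        using kP'[OF that] by (simp add: space_prob_algebra)
      have "emeasure (kernel_at Q e z) (A e) = emeasure (kernel_at (P k) e z) (?A e)" if e: "e \<in> J" for e
      proof -
        have s: "sets (kernel_at (P k) e z) = sets borel" using kP e J by blast
        have "kernel_at Q e z = distr (kernel_at (P k) e z) K ?rr" by (simp add: kernel_at_def Q_def)
        moreover have "?rr \<in> kernel_at (P k) e z \<rightarrow>\<^sub>M K" using rr by (simp add: measurable_cong_sets[OF s refl])
        ultimately show ?thesis using A[OF e] sets_eq_imp_space_eq[OF s] by (simp add: emeasure_distr)
      qed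
      then show ?thesis
        using emeasure_PiM_kernels_box[of "nsets S k" "\<lambda>e. kernel_at Q e z" "\<lambda>_. K" J A] kQ J A
        by (simp add: B_def)
    qed
    have m1: "(\<lambda>z. emeasure (?f z) B) \<in> borel_measurable ?N"
      by (rule measurable_emeasure_kernel[OF measurable_prob_algebraD[OF fm] B])
    have "emeasure (distr \<mu> ?N (node_data j) \<bind> ?f) B = (\<integral>\<^sup>+z. emeasure (?f z) B \<partial>distr \<mu> ?N (node_data j))"
      by (rule emeasure_bind[where N="?H"])
        (use fm B prob_space.not_empty[OF prob_space_distr[OF Lm]] in
          \<open>auto intro!: measurable_prob_algebraD simp: measurable_cong_sets[OF sets_distr refl]\<close>)
    also have "\<dots> = (\<integral>\<^sup>+\<omega>. emeasure (?f (node_data j \<omega>)) B \<partial>\<mu>)"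
      by (rule nn_integral_distr[OF Lm]) (subst measurable_cong_sets[OF sets_distr refl], rule m1)
    also have "\<dots> = (\<integral>\<^sup>+\<omega>. indicator (space ?N) (node_data j \<omega>) * (\<Prod>e\<in>J. emeasure (kernel_at (P k) e (node_data j \<omega>)) (?A e)) \<partial>\<mu>)"
      using node_data_in_space[OF jk(1)] by (intro nn_integral_cong) (simp add: f_B)
    also have "\<dots> = emeasure \<mu> {\<omega>\<in>space \<mu>. node_data j \<omega> \<in> space ?N \<and> (\<forall>e\<in>J. X e \<omega> \<in> ?A e)}"
      unfolding Pk by (rule joint_law_of_level[OF jk(2) res J(1) J' sets.top A', symmetric])
    also have "{\<omega>\<in>space \<mu>. node_data j \<omega> \<in> space ?N \<and> (\<forall>e\<in>J. X e \<omega> \<in> ?A e)} = vertex_action S k a -` B \<inter> space \<mu>"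
    proof (intro set_eqI)
      fix \<omega>
      show "\<omega> \<in> {\<omega>\<in>space \<mu>. node_data j \<omega> \<in> space ?N \<and> (\<forall>e\<in>J. X e \<omega> \<in> ?A e)} \<longleftrightarrow> \<omega> \<in> vertex_action S k a -` B \<inter> space \<mu>"
      proof (cases "\<omega> \<in> space \<mu>")
        case True
        have "?rr (X e \<omega>) = \<omega> (a ` e)" if e: "e \<in> J" for e
        proof -
          have ek: "e \<in> nsets S k" using e J by auto
          then have "card e = k" by (simp add: nsets_def)
          then have "reserve (k - card e) 0 = {}" using reserve_in[of 0 0] by (auto simp: nsets_def)
          then have "?rr (X e \<omega>) = r (\<phi> (\<omega> (a ` e)))" by (simp add: X_def Y_def)
          moreover have "\<omega> (a ` e) \<in> space K"
            using coordinate_measurable[OF nsets_image[OF inj_a a_S ek]] True by (rule measurable_space)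
          ultimately show ?thesis using r(2) by simp
        qed
        moreover have "vertex_action S k a \<omega> e = \<omega> (a ` e)" if "e \<in> J" for e
          using that J by (auto simp: vertex_action_def)
        moreover have "node_data j \<omega> \<in> space ?N" "vertex_action S k a \<omega> \<in> space ?H"
          using measurable_space[OF Lm True] measurable_space[OF am True] .
        ultimately show ?thesis using True by (auto simp: B_iff)
      qed simp
    qed
    also have "emeasure \<mu> (vertex_action S k a -` B \<inter> space \<mu>) = emeasure (distr \<mu> ?H (vertex_action S k a)) B"
      by (rule emeasure_distr[OF am B, symmetric])
    finally show "emeasure (distr \<mu> ?N (node_data j) \<bind> ?f) (prod_emb (nsets S k) (\<lambda>_. K) J (Pi\<^sub>E J A)) =
        emeasure (distr \<mu> ?H (vertex_action S k a)) (prod_emb (nsets S k) (\<lambda>_. K) J (Pi\<^sub>E J A))"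
      unfolding B_def .
  qed
  also have "\<dots> = \<mu>" by (rule exchangeable_injection[OF exchangeable inj_a a_S])
  finally have "distr \<mu> ?N (node_data j) \<bind> ?f = \<mu>" .
  moreover have "levels_law S Zr (distr \<mu> borel (X {})) P j = distr \<mu> ?N (node_data j)"
    using P jk(3) by (intro levels_law_eq) auto
  ultimately show ?thesis unfolding recipe_law_def Q_def jk(4) by simp
qed

end

theorem theorem2p9:
  fixes S :: "'s set" and k :: nat and K :: "'c measure" and \<mu> :: "('s set \<Rightarrow> 'c) measure"
  assumes "countable S" and "infinite S" and "k \<ge> 1" and "standard_borel K"
    and "exchangeable_hypergraph S k K \<mu>"
  shows "\<exists>(Z :: nat \<Rightarrow> real measure) \<mu>0 P Q.
    ingredients k K Z \<mu>0 P Q \<and> recipe_law S k Z \<mu>0 P Q = \<mu>"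
proof -
  have "prob_space \<mu>" "sets \<mu> = sets (hypergraph_space S k K)"
    using assms(5) by (auto simp: exchangeable_hypergraph_def space_prob_algebra)
  then have "space (hypergraph_space S k K) \<noteq> {}"
    using prob_space.not_empty sets_eq_imp_space_eq by metis
  moreover obtain e where "finite e" "card e = k" "e \<subseteq> S" using infinite_arbitrarily_large[OF assms(2)] by blast
  then have "e \<in> nsets S k" by (auto simp: nsets_def)
  ultimately have "space K \<noteq> {}" by (auto simp: hypergraph_space_def space_PiM PiE_eq_empty_iff)
  then obtain \<phi> r where \<phi>: "real_coding K \<phi> r" using standard_borel_real_coding[OF assms(4)] by blast
  obtain code dec where code: "real_coding (borel :: (nat \<Rightarrow> real) measure) code dec"
    using sequence_real_coding by blast
  define en where "en = from_nat_into S"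
  have en: "bij_betw en UNIV S" unfolding en_def using assms by (intro bij_betw_from_nat_into)
  \<comment> \<open>The copy of \<open>S\<close> takes the even positions of an enumeration; the odd ones form the
    reserve.\<close>
  define a where "a x = en (2 * to_nat_on S x)" for x
  have inj_en: "inj en" and range_en: "range en = S" using en by (auto simp: bij_betw_def)
  have inj_a: "inj_on a S"
    unfolding a_def by (intro inj_onI) (use inj_en inj_on_to_nat_on[OF assms(1)] in \<open>auto dest!: injD dest: inj_onD\<close>)
  have "a ` S \<subseteq> S" using range_en by (auto simp: a_def)
  have "range (\<lambda>n. en (2 * n + 1)) \<subseteq> S - a ` S"
  proof -
    have "en (2 * n + 1) \<noteq> a x" for n x
    proof
      assume "en (2 * n + 1) = a x"
      then have "2 * n + 1 = 2 * to_nat_on S x" unfolding a_def using injD[OF inj_en] by blast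
      then show False by presburger
    qed
    moreover have "en m \<in> S" for m using range_en by blast
    ultimately show ?thesis by fast
  qed
  moreover have "infinite (range (\<lambda>n. en (2 * n + 1)))"
    by (rule range_inj_infinite) (use inj_en in \<open>auto intro!: injI dest!: injD\<close>)
  ultimately have inf: "infinite (S - a ` S)" using finite_subset by blast
  interpret exchangeable_array S k K \<mu> a "S - a ` S" \<phi> code dec
    using assms \<phi> code inj_a \<open>a ` S \<subseteq> S\<close> inf by unfold_locales (auto simp: real_coding_def)
  have "\<forall>i. \<exists>P. i \<le> k \<longrightarrow> resampling_kernel i P" using resampling_kernel_exists by blast
  then obtain P where P: "\<And>i. i \<le> k \<Longrightarrow> resampling_kernel i (P i)" by metis
  let ?Q = "\<lambda>x. distr (P k x) K (\<lambda>t. r (dec t 0))"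
  have r: "r \<in> borel \<rightarrow>\<^sub>M K" "\<And>x. x \<in> space K \<Longrightarrow> r (\<phi> x) = x" using \<phi> by (auto simp: real_coding_def)
  from measurable_compose[OF measurable_compose[OF dec_measurable sequence_coordinate_measurable] r(1)]
  have rr: "(\<lambda>t. r (dec t 0)) \<in> borel \<rightarrow>\<^sub>M K" .
  have "ingredients k K Zr (distr \<mu> borel (X {})) P ?Q"
    unfolding ingredients_def
  proof (intro conjI allI impI ballI)
    show "standard_borel (borel :: real measure)" by (rule standard_borel_polish)
    have "X {} \<in> borel_measurable \<mu>" by (rule X_measurable) (simp add: subsets_upto_iff)
    then show "distr \<mu> borel (X {}) \<in> space (prob_algebra borel)"
      by (simp add: space_prob_algebra prob_space_distr)
    show "symmetric_kernel Zr i borel (P i)" if "i \<in> {1..<k}" for i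
      using that P by (simp add: resampling_kernel_def)
    show "symmetric_kernel Zr k K ?Q"
      using P[of k] rr by (intro symmetric_kernel_distr[of _ _ borel]) (auto simp: resampling_kernel_def)
  qed
  moreover have "recipe_law S k Zr (distr \<mu> borel (X {})) P ?Q = \<mu>"
    using P assms(3) r by (intro recipe_law_eq) auto
  ultimately show ?thesis by blast
qed

end
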